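(* Suppose that $$\frac{A(x)}{x\mu(x)}\to\infty\qquad(x\to\infty),$$ and let $x_0$ be a positive integer such that $A(x)>0$ for all $x\ge x_0$. Then both $a(x)$ and $\bar a(x)$ are slowly varying at infinity and, as $x\to\infty$, $$a(x)-a(-x)\sim\frac1{A(x)},$$ $$a(x)\sim\int_{x_0}^x\frac{\mu_-(y)}{A^2(y)}\,dy\qquad\text{and}\qquad a(-x)=\int_{x_0}^x\frac{\mu_+(y)}{A^2(y)}\,dy+o(a(x)).$$
   Context: Let $X,X_1,X_2,\dots$ be i.i.d. integer-valued random variables and $S_n=X_1+\dots+X_n$, $S_0=0$. It is assumed that the random walk $S$ is irreducible on $\mathbb Z$ and recurrent and that $P[|X|>x]>0$ for every $x>0$; it is NOT assumed that $E|X|<\infty$. The potential function is $a(x)=\sum_{n=0}^\infty\big(P[S_n=0]-P[S_n=-x]\big)$, $x\in\mathbb Z$ (the series converges), and $\bar a(x)=\frac12[a(x)+a(-x)]$. For real $x\ge0$: $\mu_-(x)=P[X<-x]$, $\mu_+(x)=P[X>x]$, $\mu=\mu_++\mu_-$, and $A(x)=\int_0^x[\mu_+(y)-\mu_-(y)]\,dy$. $f\sim g$ means $f/g\to1$. *)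

theory Defs
  imports "HOL-Probability.Probability" "HOL-Library.Landau_Symbols"
begin

text \<open>
  Throughout, a family \<open>X\<close> of i.i.d. integer-valued random variables is indexed by \<open>nat\<close>:
  \<open>X 0\<close> is the generic copy, and \<open>X 1, X 2, \<dots>\<close> are the increments of the random walk.
\<close>

definition walk :: "(nat \<Rightarrow> 'a \<Rightarrow> int) \<Rightarrow> nat \<Rightarrow> 'a \<Rightarrow> int" where
  "walk X n \<omega> = (\<Sum>i=1..n. X i \<omega>)"

definition irreducible_walk :: "'a measure \<Rightarrow> (nat \<Rightarrow> 'a \<Rightarrow> int) \<Rightarrow> bool" where
  "irreducible_walk M X \<longleftrightarrow> (\<forall>x y. \<exists>n. \<P>(\<omega> in M. x + walk X n \<omega> = y) > 0)"

definition recurrent_walk :: "'a measure \<Rightarrow> (nat \<Rightarrow> 'a \<Rightarrow> int) \<Rightarrow> bool" where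
  "recurrent_walk M X \<longleftrightarrow> \<P>(\<omega> in M. \<exists>n\<ge>1. walk X n \<omega> = 0) = 1"

text \<open>
  For an irreducible recurrent walk the following series converges (in general only
  conditionally, the two series of probabilities being divergent separately).
\<close>

definition potential :: "'a measure \<Rightarrow> (nat \<Rightarrow> 'a \<Rightarrow> int) \<Rightarrow> int \<Rightarrow> real" where
  "potential M X x =
     (\<Sum>n. \<P>(\<omega> in M. walk X n \<omega> = 0) - \<P>(\<omega> in M. walk X n \<omega> = - x))"

definition sym_potential :: "'a measure \<Rightarrow> (nat \<Rightarrow> 'a \<Rightarrow> int) \<Rightarrow> int \<Rightarrow> real" where
  "sym_potential M X x = (potential M X x + potential M X (- x)) / 2"

definition mu_minus :: "'a measure \<Rightarrow> (nat \<Rightarrow> 'a \<Rightarrow> int) \<Rightarrow> real \<Rightarrow> real" where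
  "mu_minus M X x = \<P>(\<omega> in M. real_of_int (X 0 \<omega>) < - x)"

definition mu_plus :: "'a measure \<Rightarrow> (nat \<Rightarrow> 'a \<Rightarrow> int) \<Rightarrow> real \<Rightarrow> real" where
  "mu_plus M X x = \<P>(\<omega> in M. real_of_int (X 0 \<omega>) > x)"

definition mu_both :: "'a measure \<Rightarrow> (nat \<Rightarrow> 'a \<Rightarrow> int) \<Rightarrow> real \<Rightarrow> real" where
  "mu_both M X x = mu_plus M X x + mu_minus M X x"

definition tail_diff_integral :: "'a measure \<Rightarrow> (nat \<Rightarrow> 'a \<Rightarrow> int) \<Rightarrow> real \<Rightarrow> real" where
  "tail_diff_integral M X x = (LBINT y:{0..x}. mu_plus M X y - mu_minus M X y)"

definition slowly_varying :: "(real \<Rightarrow> real) \<Rightarrow> bool" where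
  "slowly_varying L \<longleftrightarrow>
     L \<in> borel_measurable borel \<and> eventually (\<lambda>x. L x > 0) at_top \<and>
     (\<forall>c>0. ((\<lambda>x. L (c * x) / L x) \<longlongrightarrow> 1) at_top)"

text \<open>
  A function on the integers varies slowly at infinity if the associated step function on the
  reals does; this is the usual convention for regularly varying sequences.
\<close>

definition slowly_varying_int :: "(int \<Rightarrow> real) \<Rightarrow> bool" where
  "slowly_varying_int f \<longleftrightarrow> slowly_varying (\<lambda>x. f \<lfloor>x\<rfloor>)"

end

theory Submission
  imports Defs
begin

text \<open>
  Let \<open>phi\<close> be the characteristic function of a step, \<open>A\<close> the integrated tail difference (\<open>drift\<close>
  below), \<open>mu\<close> the tail of the step (\<open>tail\<close>), and \<open>h = 1/(1 - phi)\<close>. Summing the Fourier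
  inversion formula for \<open>P[S_n = 0] - P[S_n = -x]\<close> over \<open>n\<close> turns the potential into

    \<open>pi a(x) = \<integral>\<^bsub>0\<^esub>\<^bsup>pi\<^esup> Re ((1 - e\<^bsup>ixt\<^esup>) h(t)) dt\<close>,

  and everything rests on how \<open>h\<close> behaves near zero. Since \<open>A(y)\<close> is the mean of the step clipped
  to \<open>[-y, y]\<close>, comparing the step with its clipping at the scale \<open>1/t\<close> gives
  \<open>1 - phi(t) = -i t A(1/t) + O(t\<^sup>2 V(1/t))\<close>, where \<open>V(y)\<close> is the second moment of the clipped step
  (\<open>cis_clip_approx\<close>, \<open>chf_drift\<close>). The hypothesis \<open>y mu(y) = o(A(y))\<close> makes \<open>A\<close> slowly varying and
  \<open>V(y) = o(y A(y))\<close> (\<open>drift_Potter\<close>, \<open>clip_moment2_little\<close>), so \<open>h(t)\<close> is close to the purely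
  imaginary \<open>i/(t A(1/t))\<close>.

  Substituting \<open>t = y/n\<close> in the part of the Fourier integral below \<open>B/n\<close> and letting \<open>n\<close> grow
  therefore produces a Dirichlet integral divided by \<open>A(n)\<close> (\<open>near_part_limit\<close>). Above \<open>B/n\<close> the
  exponential oscillates; after replacing the step by its clipping at \<open>n\<close>, whose characteristic
  function is smooth, one integration by parts bounds that part by a small multiple of \<open>1/A(n)\<close>
  (\<open>oscillating_integral_bound\<close>). Together (\<open>potential_integral_asymptotics\<close>):

    \<open>pi a(\<plusminus>n) = \<integral>\<^bsub>1/n\<^esub>\<^bsup>pi\<^esup> Re h(t) dt \<plusminus> (pi/2)/A(n) + o(1/A(n))\<close>.

  In the even part \<open>Re h\<close> is about \<open>E[1 - cos tX]/(t A(1/t))\<^sup>2\<close>. Integrated against the slowly varying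
  weight \<open>1/A\<^sup>2\<close>, the kernel \<open>1 - cos (X/u)\<close> acts like \<open>pi/2\<close> times the indicator of \<open>u < |X|\<close>, again
  by the Dirichlet integral (\<open>cos_kernel_bound\<close>), so the even part is \<open>(pi/2) \<integral> mu/A\<^sup>2\<close> up to a relatively
  small error (\<open>real_part_asymptotics\<close>). For the odd part, \<open>1/A(x)\<close> is up to a constant
  \<open>\<integral> (mu_- - mu_+)/A\<^sup>2\<close>, because \<open>A' = mu_+ - mu_-\<close>. Half the sum and half
  the difference of these two integrals are the one-sided integrals of the theorem.

  The constants are negligible because \<open>\<integral> mu/A\<^sup>2\<close> diverges, and this is where recurrence enters: if
  the integral were bounded, then \<open>1/A\<close> and \<open>\<integral> Re h\<close> would be bounded as well, and with them the Abel
  sums of the return probabilities (\<open>tail_integral_unbounded\<close>). Slow variation of the potentials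
  follows from that of the comparison integrals, which are monotone
  (\<open>slowly_varying_int_from_monotone\<close>).
\<close>

section \<open>Integration on compact intervals\<close>

text \<open>
  The exceptional points are needed because the tails of an integer law jump at integers, so that
  the functions differentiated later are differentiable only between consecutive integers.
\<close>

lemma set_integral_FTC:
  fixes F :: "real \<Rightarrow> 'a :: euclidean_space"
  assumes "a \<le> b" "finite S"
    and "\<And>x. x \<in> {a<..<b} - S \<Longrightarrow> (F has_vector_derivative f x) (at x)"
    and "continuous_on {a..b} F" and "set_integrable lborel {a..b} f"
  shows "(LBINT x:{a..b}. f x) = F b - F a"
proof -
  have "(f has_integral (F b - F a)) {a..b}"
    by (rule fundamental_theorem_of_calculus_interior_strong) (use assms in auto)
  then show ?thesis
    using set_borel_integral_eq_integral(2)[OF assms(5)] by (simp add: integral_unique)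
qed

lemma set_integral_split:
  fixes f :: "real \<Rightarrow> 'a :: {banach, second_countable_topology}"
  assumes "a \<le> b" "b \<le> c" "set_integrable lborel {a..c} f"
  shows "(LBINT x:{a..c}. f x) = (LBINT x:{a..b}. f x) + (LBINT x:{b..c}. f x)"
proof -
  have "(LBINT x:{a..b} \<union> {b..c}. f x) = (LBINT x:{a..b}. f x) + (LBINT x:{b..c}. f x)"
  proof (rule set_integral_Un_AE)
    show "AE x in lborel. \<not> (x \<in> {a..b} \<and> x \<in> {b..c})"
      using AE_lborel_singleton[of b] by eventually_elim auto
  qed (use assms in \<open>auto intro: set_integrable_subset\<close>)
  moreover have "{a..b} \<union> {b..c} = {a..c}" using assms by auto
  ultimately show ?thesis by simp
qed

lemma set_integrable_bounded_interval:
  fixes f :: "real \<Rightarrow> 'a :: {banach, second_countable_topology}"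
  assumes "f \<in> borel_measurable borel" "\<And>x. x \<in> {a..b} \<Longrightarrow> norm (f x) \<le> B"
  shows "set_integrable lborel {a..b} f"
  unfolding set_integrable_def
proof (rule Bochner_Integration.integrable_bound)
  show "integrable lborel (\<lambda>x. indicator {a..b} x *\<^sub>R B)"
    by (cases "a \<le> b") (auto intro!: integrable_real_indicator simp: )
  show "(\<lambda>x. indicat_real {a..b} x *\<^sub>R f x) \<in> borel_measurable lborel"
    using assms(1) by measurable
  show "AE x in lborel. norm (indicat_real {a..b} x *\<^sub>R f x) \<le> norm (indicat_real {a..b} x *\<^sub>R B)"
    using assms(2) by (intro AE_I2) (auto simp: indicator_def intro: order.trans[OF _ abs_ge_self])
qed

lemma set_integral_mono_le:
  fixes f g :: "real \<Rightarrow> real"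
  assumes "set_integrable lborel {a..b} f" "set_integrable lborel {a..b} g"
    "\<And>x. x \<in> {a..b} \<Longrightarrow> f x \<le> g x"
  shows "(LBINT x:{a..b}. f x) \<le> (LBINT x:{a..b}. g x)"
  using assms by (intro set_integral_mono) auto

lemma norm_set_integral_le:
  fixes f :: "real \<Rightarrow> 'a :: {banach, second_countable_topology}"
  assumes "set_integrable lborel {a..b} f" "set_integrable lborel {a..b} g"
    "\<And>x. x \<in> {a..b} \<Longrightarrow> norm (f x) \<le> g x"
  shows "norm (LBINT x:{a..b}. f x) \<le> (LBINT x:{a..b}. g x)"
proof -
  have "norm (LBINT x:{a..b}. f x) \<le> (LBINT x:{a..b}. norm (f x))"
    using assms(1) by (rule set_integral_norm_bound)
  also have "\<dots> \<le> (LBINT x:{a..b}. g x)"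
    using assms by (intro set_integral_mono set_integrable_norm) auto
  finally show ?thesis .
qed

lemma set_integral_nonneg_interval:
  fixes f :: "real \<Rightarrow> real"
  assumes "\<And>x. x \<in> {a..b} \<Longrightarrow> 0 \<le> f x"
  shows "0 \<le> (LBINT x:{a..b}. f x)"
  unfolding set_lebesgue_integral_def
  by (rule Bochner_Integration.integral_nonneg) (use assms in \<open>auto simp: indicator_def\<close>)

text \<open>
  Expectations under an integer law commute with integration in a parameter as soon as the
  integrand is bounded; measurability only has to be checked in the parameter because the law
  lives on a countable set.
\<close>

lemma pmf_Fubini:
  fixes p :: "int pmf" and f :: "int \<Rightarrow> real \<Rightarrow> real"
  assumes meas: "\<And>k. f k \<in> borel_measurable borel"
    and bound: "\<And>k u. u \<in> {a..b} \<Longrightarrow> \<bar>f k u\<bar> \<le> B"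
  shows "(LBINT u:{a..b}. measure_pmf.expectation p (\<lambda>k. f k u))
           = measure_pmf.expectation p (\<lambda>k. LBINT u:{a..b}. f k u)"
    and "set_integrable lborel {a..b} (\<lambda>u. measure_pmf.expectation p (\<lambda>k. f k u))"
proof -
  interpret pair_sigma_finite "measure_pmf p" lborel ..
  define g where "g = (\<lambda>(k, u). indicator {a..b} u *\<^sub>R f k u)"
  have bB: "\<bar>f k u\<bar> \<le> \<bar>B\<bar>" if "u \<in> {a..b}" for k u
    using bound[OF that, of k] by linarith
  have gm: "g \<in> borel_measurable (measure_pmf p \<Otimes>\<^sub>M lborel)"
  proof -
    have "g \<in> borel_measurable (count_space UNIV \<Otimes>\<^sub>M lborel)"
      unfolding g_def
      by (rule measurable_pair_measure_countable1) (use meas in \<open>auto\<close>)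
    then show ?thesis by (simp cong: measurable_cong_sets sets_pair_measure_cong)
  qed
  have "integrable (measure_pmf p \<Otimes>\<^sub>M lborel) (\<lambda>(k, u). indicator {a..b} u *\<^sub>R \<bar>B\<bar>)"
  proof (rule Fubini_integrable)
    show "(\<lambda>(k, u). indicat_real {a..b} u *\<^sub>R \<bar>B\<bar>) \<in> borel_measurable (measure_pmf p \<Otimes>\<^sub>M lborel)"
      by measurable
  qed (auto intro!: integrable_real_indicator simp: emeasure_lborel_Icc_eq)
  then have gi: "integrable (measure_pmf p \<Otimes>\<^sub>M lborel) g"
    by (rule Bochner_Integration.integrable_bound)
       (use gm bB in \<open>auto simp: g_def indicator_def intro!: AE_I2 intro: order.trans[OF _ abs_ge_self]\<close>)
  have e: "(\<integral>k. indicator {a..b} u *\<^sub>R f k u \<partial>measure_pmf p)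
      = indicator {a..b} u *\<^sub>R measure_pmf.expectation p (\<lambda>k. f k u)" for u
    by simp
  show "(LBINT u:{a..b}. measure_pmf.expectation p (\<lambda>k. f k u))
           = measure_pmf.expectation p (\<lambda>k. LBINT u:{a..b}. f k u)"
    using Fubini_integral[of "\<lambda>k u. indicator {a..b} u *\<^sub>R f k u"] gi
    unfolding set_lebesgue_integral_def g_def e by simp
  show "set_integrable lborel {a..b} (\<lambda>u. measure_pmf.expectation p (\<lambda>k. f k u))"
    using integrable_snd[of "\<lambda>k u. indicator {a..b} u *\<^sub>R f k u"] gi
    unfolding set_integrable_def g_def e by simp
qed

section \<open>Clipped moments of an integer law\<close>

definition clip :: "real \<Rightarrow> real \<Rightarrow> real" where "clip y x = max (- y) (min y x)"

lemma abs_clip: "0 \<le> y \<Longrightarrow> \<bar>clip y x\<bar> = min \<bar>x\<bar> y"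
  by (auto simp: clip_def)

lemma clip_clip: "0 \<le> y \<Longrightarrow> y \<le> z \<Longrightarrow> clip y (clip z x) = clip y x"
  by (auto simp: clip_def)

lemma clip_measurable [measurable]: "clip y \<in> borel_measurable borel"
  unfolding clip_def by measurable

lemma set_integral_indicator_lt:
  assumes "0 \<le> y" "0 \<le> z"
  shows "(LBINT u:{0..y}. indicat_real {u. u < z} u :: real) = min z y"
proof -
  have "(LBINT u:{0..y}. indicat_real {u. u < z} u) = (LBINT u. indicat_real ({0..y} \<inter> {u. u < z}) u)"
    unfolding set_lebesgue_integral_def
    by (rule Bochner_Integration.integral_cong) (auto simp: indicator_def)
  also have "\<dots> = measure lborel ({0..y} \<inter> {u. u < z})" by simp
  also have "\<dots> = min z y"
  proof (cases "z \<le> y")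
    case True
    then have "{0..y} \<inter> {u. u < z} = {0..<z}" by auto
    then show ?thesis using True assms by simp
  next
    case False
    then have "{0..y} \<inter> {u. u < z} = {0..y}" by auto
    then show ?thesis using False assms by simp
  qed
  finally show ?thesis .
qed

lemma layer_cake_clip:
  assumes "0 \<le> y"
  shows "(LBINT u:{0..y}. of_bool (u < x) - of_bool (x < - u) :: real) = clip y x"
proof -
  have i: "set_integrable lborel {0..y} (\<lambda>u. of_bool (u < z) :: real)" for z
    by (rule set_integrable_bounded_interval[where B=1]) auto
  have b: "(LBINT u:{0..y}. of_bool (u < z) :: real) = min (max z 0) y" for z :: real
  proof -
    have "(LBINT u:{0..y}. of_bool (u < z) :: real) = (LBINT u:{0..y}. indicat_real {u. u < max z 0} u)"
      by (rule set_lebesgue_integral_cong) (auto simp: indicator_def)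
    then show ?thesis using set_integral_indicator_lt[of y "max z 0"] assms by simp
  qed
  have "(LBINT u:{0..y}. of_bool (u < x) - of_bool (u < - x)) = clip y x"
    using set_integral_diff(2)[OF i i, of x "- x"] b[of x] b[of "- x"] assms
    by (auto simp: clip_def min_def max_def)
  then show ?thesis by (simp add: less_minus_iff)
qed

lemma layer_cake_min:
  assumes "0 \<le> y"
  shows "(LBINT u:{0..y}. of_bool (u < \<bar>x\<bar>) :: real) = min \<bar>x\<bar> y"
proof -
  have "(LBINT u:{0..y}. of_bool (u < \<bar>x\<bar>) :: real) = (LBINT u:{0..y}. indicat_real {u. u < \<bar>x\<bar>} u)"
    by (rule set_lebesgue_integral_cong) (auto simp: indicator_def)
  then show ?thesis using set_integral_indicator_lt[of y "\<bar>x\<bar>"] assms by simp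
qed

lemma layer_cake_min_square:
  assumes "0 \<le> y"
  shows "(LBINT u:{0..y}. 2 * u * of_bool (u < \<bar>x\<bar>) :: real) = (min \<bar>x\<bar> y)\<^sup>2"
proof -
  have m: "0 \<le> min \<bar>x\<bar> y" using assms by simp
  have "(LBINT u:{0..y}. 2 * u * of_bool (u < \<bar>x\<bar>) :: real) = (LBINT u:{0..min \<bar>x\<bar> y}. 2 * u)"
    unfolding set_lebesgue_integral_def
  proof (rule integral_cong_AE)
    show "AE u in lborel. indicat_real {0..y} u *\<^sub>R (2 * u * of_bool (u < \<bar>x\<bar>) :: real)
       = indicat_real {0..min \<bar>x\<bar> y} u *\<^sub>R (2 * u)"
      using AE_lborel_singleton[of "\<bar>x\<bar>"] by eventually_elim (auto simp: indicator_def)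
  qed auto
  also have "\<dots> = (min \<bar>x\<bar> y)\<^sup>2 - 0\<^sup>2"
    by (rule set_integral_FTC[where S="{}"])
       (use m in \<open>auto intro!: derivative_eq_intros continuous_intros borel_integrable_atLeastAtMost'
          simp: has_real_derivative_iff_has_vector_derivative[symmetric]\<close>)
  finally show ?thesis by simp
qed

text \<open>
  An integer-valued step with law \<open>p\<close>. The name \<open>drift y\<close> is the integrated tail difference
  \<open>A(y)\<close>; it is at the same time the mean of the step clipped to \<open>[-y, y]\<close>, and this second
  reading is the one that makes the characteristic function accessible.
\<close>

locale step_law =
  fixes p :: "int pmf"
begin

abbreviation E :: "(int \<Rightarrow> 'b) \<Rightarrow> 'b :: {banach, second_countable_topology}" where
  "E \<equiv> measure_pmf.expectation p"

definition up_tail :: "real \<Rightarrow> real" where "up_tail y = measure_pmf.prob p {k. y < real_of_int k}"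
definition lo_tail :: "real \<Rightarrow> real" where "lo_tail y = measure_pmf.prob p {k. real_of_int k < - y}"
definition tail :: "real \<Rightarrow> real" where "tail y = up_tail y + lo_tail y"
definition drift :: "real \<Rightarrow> real" where "drift y = (LBINT u:{0..y}. up_tail u - lo_tail u)"
definition clip_moment2 :: "real \<Rightarrow> real" where "clip_moment2 y = E (\<lambda>k. (min \<bar>real_of_int k\<bar> y)\<^sup>2)"
definition chf :: "real \<Rightarrow> complex" where "chf t = E (\<lambda>k. cis (t * real_of_int k))"

lemma integrable_E_bounded:
  fixes f :: "int \<Rightarrow> 'b :: {banach, second_countable_topology}"
  assumes "\<And>k. norm (f k) \<le> B"
  shows "integrable (measure_pmf p) f"
  by (rule measure_pmf.integrable_const_bound[where B=B]) (use assms in auto)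

lemma norm_E_le:
  fixes f :: "int \<Rightarrow> 'b :: {banach, second_countable_topology}" and g :: "int \<Rightarrow> real"
  assumes "\<And>k. norm (f k) \<le> g k" "\<And>k. g k \<le> B"
  shows "norm (E f) \<le> E g"
proof -
  have g: "integrable (measure_pmf p) g"
    by (rule integrable_E_bounded[where B=B])
       (metis abs_of_nonneg assms norm_ge_zero order.trans real_norm_def)
  have "norm (E f) \<le> E (\<lambda>k. norm (f k))" by (rule integral_norm_bound)
  also have "\<dots> \<le> E g"
    by (rule integral_mono)
       (use g assms order.trans[OF assms] in \<open>auto intro!: integrable_norm integrable_E_bounded[where B=B]\<close>)
  finally show ?thesis .
qed

lemma up_tail_eq: "up_tail y = E (\<lambda>k. of_bool (y < real_of_int k))"
proof -
  have "(\<lambda>k. of_bool (y < real_of_int k)) = indicat_real {k. y < real_of_int k}"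
    by (auto simp: indicator_def)
  then show ?thesis by (simp add: up_tail_def)
qed

lemma lo_tail_eq: "lo_tail y = E (\<lambda>k. of_bool (real_of_int k < - y))"
proof -
  have "(\<lambda>k. of_bool (real_of_int k < - y)) = indicat_real {k. real_of_int k < - y}"
    by (auto simp: indicator_def)
  then show ?thesis by (simp add: lo_tail_def)
qed

lemma tail_eq: "0 \<le> y \<Longrightarrow> tail y = E (\<lambda>k. of_bool (y < \<bar>real_of_int k\<bar>))"
proof -
  assume y: "0 \<le> y"
  have "tail y = E (\<lambda>k. of_bool (y < real_of_int k) + of_bool (real_of_int k < - y))"
    unfolding tail_def up_tail_eq lo_tail_eq
    by (subst Bochner_Integration.integral_add) (auto intro!: integrable_E_bounded[where B=1])
  also have "(\<lambda>k. of_bool (y < real_of_int k) + of_bool (real_of_int k < - y) :: real)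
      = (\<lambda>k. of_bool (y < \<bar>real_of_int k\<bar>))"
    using y by (intro ext) auto
  finally show ?thesis .
qed

lemma tails_nonneg: "0 \<le> up_tail y" "0 \<le> lo_tail y" "0 \<le> tail y"
  by (auto simp: up_tail_def lo_tail_def tail_def)

lemma tails_le_1: "up_tail y \<le> 1" "lo_tail y \<le> 1"
  by (auto simp: up_tail_def lo_tail_def)

lemma tail_le_2: "tail y \<le> 2"
  using tails_le_1[of y] by (simp add: tail_def)

lemma up_tail_antimono: "x \<le> y \<Longrightarrow> up_tail y \<le> up_tail x"
  unfolding up_tail_def by (rule measure_pmf.finite_measure_mono) auto

lemma lo_tail_antimono: "x \<le> y \<Longrightarrow> lo_tail y \<le> lo_tail x"
  unfolding lo_tail_def by (rule measure_pmf.finite_measure_mono) auto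

lemma tail_antimono: "x \<le> y \<Longrightarrow> tail y \<le> tail x"
  unfolding tail_def using up_tail_antimono lo_tail_antimono by (meson add_mono)

lemma measurable_antimono:
  fixes f :: "real \<Rightarrow> real"
  assumes "\<And>x y. x \<le> y \<Longrightarrow> f y \<le> f x"
  shows "f \<in> borel_measurable borel"
proof -
  have "(\<lambda>x. - f x) \<in> borel_measurable borel"
    by (rule borel_measurable_mono) (use assms in \<open>auto simp: mono_def\<close>)
  then have "(\<lambda>x. - (- f x)) \<in> borel_measurable borel" by measurable
  then show ?thesis by simp
qed

lemma measurable_tails [measurable]:
  "up_tail \<in> borel_measurable borel" "lo_tail \<in> borel_measurable borel"
  "tail \<in> borel_measurable borel"
  using up_tail_antimono lo_tail_antimono tail_antimono by (auto intro!: measurable_antimono)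

lemma tail_floor: "up_tail y = up_tail (real_of_int \<lfloor>y\<rfloor>)" "lo_tail y = lo_tail (real_of_int \<lfloor>y\<rfloor>)"
proof -
  have "{k. y < real_of_int k} = {k. real_of_int \<lfloor>y\<rfloor> < real_of_int k}"
    by (auto simp: floor_less_iff)
  then show "up_tail y = up_tail (real_of_int \<lfloor>y\<rfloor>)" by (simp add: up_tail_def)
  have "real_of_int k < - y \<longleftrightarrow> real_of_int k < - real_of_int \<lfloor>y\<rfloor>" for k
  proof -
    have "real_of_int k < - y \<longleftrightarrow> \<lfloor>y\<rfloor> < - k" by (simp add: floor_less_iff) linarith
    also have "\<dots> \<longleftrightarrow> real_of_int k < - real_of_int \<lfloor>y\<rfloor>" by linarith
    finally show ?thesis .
  qed
  then show "lo_tail y = lo_tail (real_of_int \<lfloor>y\<rfloor>)" by (simp add: lo_tail_def)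
qed

lemma tails_continuous_off_Ints:
  assumes "y \<notin> \<int>"
  shows "isCont up_tail y" "isCont lo_tail y"
proof -
  define d where "d = min (y - \<lfloor>y\<rfloor>) (1 + \<lfloor>y\<rfloor> - y)"
  have d: "d > 0"
  proof -
    have "real_of_int \<lfloor>y\<rfloor> \<noteq> y" using assms by (metis Ints_of_int)
    moreover have "real_of_int \<lfloor>y\<rfloor> \<le> y" "y < 1 + real_of_int \<lfloor>y\<rfloor>" by linarith+
    ultimately have "real_of_int \<lfloor>y\<rfloor> < y" by linarith
    then show ?thesis using \<open>y < 1 + real_of_int \<lfloor>y\<rfloor>\<close> by (simp add: d_def)
  qed
  have fl: "\<lfloor>x\<rfloor> = \<lfloor>y\<rfloor>" if "x \<in> ball y d" for x
  proof (rule floor_unique)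
    have "\<bar>x - y\<bar> < d" using that by (simp add: dist_real_def abs_minus_commute)
    then have "\<bar>x - y\<bar> < y - \<lfloor>y\<rfloor>" "\<bar>x - y\<bar> < 1 + \<lfloor>y\<rfloor> - y" by (simp_all add: d_def)
    then show "real_of_int \<lfloor>y\<rfloor> \<le> x" "x < real_of_int \<lfloor>y\<rfloor> + 1" by linarith+
  qed
  have ev: "\<forall>\<^sub>F x in nhds y. \<lfloor>x\<rfloor> = \<lfloor>y\<rfloor>"
    using fl d by (meson centre_in_ball eventually_nhds open_ball)
  have same: "up_tail x = up_tail y" "lo_tail x = lo_tail y" if "\<lfloor>x\<rfloor> = \<lfloor>y\<rfloor>" for x
    using trans[OF tail_floor(1)[of x, unfolded that] tail_floor(1)[of y, symmetric]]
      trans[OF tail_floor(2)[of x, unfolded that] tail_floor(2)[of y, symmetric]] .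
  have "isCont up_tail y \<longleftrightarrow> isCont (\<lambda>_. up_tail y) y"
    by (rule isCont_cong) (use ev in \<open>eventually_elim\<close>, rule same(1))
  then show "isCont up_tail y" by simp
  have "isCont lo_tail y \<longleftrightarrow> isCont (\<lambda>_. lo_tail y) y"
    by (rule isCont_cong) (use ev in \<open>eventually_elim\<close>, rule same(2))
  then show "isCont lo_tail y" by simp
qed

lemma finite_Ints_interval: "finite (\<int> \<inter> {a..b::real})"
proof -
  have "\<int> \<inter> {a..b} \<subseteq> real_of_int ` {\<lfloor>a\<rfloor>..\<lceil>b\<rceil>}"
  proof
    fix x assume "x \<in> \<int> \<inter> {a..b}"
    then obtain n where "x = real_of_int n" "a \<le> real_of_int n" "real_of_int n \<le> b"
      by (auto elim: Ints_cases)
    then show "x \<in> real_of_int ` {\<lfloor>a\<rfloor>..\<lceil>b\<rceil>}"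
      by (intro image_eqI[of _ _ n]) (auto, linarith+)
  qed
  then show ?thesis by (rule finite_subset) auto
qed

lemma set_integrable_tails:
  "set_integrable lborel {a..b} up_tail" "set_integrable lborel {a..b} lo_tail"
  "set_integrable lborel {a..b} tail"
  using tails_nonneg order.trans[OF tails_le_1(1), of 2] order.trans[OF tails_le_1(2), of 2] tail_le_2
  by (auto intro!: set_integrable_bounded_interval[where B=2])

subsection \<open>Layer-cake representations\<close>

text \<open>
  Integrals of the tails over \<open>[0, y]\<close>, with weights, are moments of the step clipped to \<open>[-y, y]\<close>:
  its mean, its first and its second absolute moment.
\<close>

lemma drift_eq: "0 \<le> y \<Longrightarrow> drift y = E (\<lambda>k. clip y (real_of_int k))"
proof -
  assume y: "0 \<le> y"
  have "drift y = (LBINT u:{0..y}. E (\<lambda>k. of_bool (u < real_of_int k) - of_bool (real_of_int k < - u)))"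
    unfolding drift_def up_tail_eq lo_tail_eq
    by (subst Bochner_Integration.integral_diff) (auto intro!: integrable_E_bounded[where B=1])
  also have "\<dots> = E (\<lambda>k. LBINT u:{0..y}. of_bool (u < real_of_int k) - of_bool (real_of_int k < - u))"
    by (rule pmf_Fubini(1)[where B=1]) auto
  finally show ?thesis by (simp add: layer_cake_clip[OF y])
qed

lemma integral_tail_eq: "0 \<le> y \<Longrightarrow> (LBINT u:{0..y}. tail u) = E (\<lambda>k. min \<bar>real_of_int k\<bar> y)"
proof -
  assume y: "0 \<le> y"
  have "(LBINT u:{0..y}. tail u) = (LBINT u:{0..y}. E (\<lambda>k. of_bool (u < \<bar>real_of_int k\<bar>)))"
    by (rule set_lebesgue_integral_cong) (auto simp: tail_eq)
  also have "\<dots> = E (\<lambda>k. LBINT u:{0..y}. of_bool (u < \<bar>real_of_int k\<bar>))"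
    by (rule pmf_Fubini(1)[where B=1]) auto
  finally show ?thesis by (simp add: layer_cake_min[OF y])
qed

lemma clip_moment2_eq: "0 \<le> y \<Longrightarrow> clip_moment2 y = (LBINT u:{0..y}. 2 * u * tail u)"
proof -
  assume y: "0 \<le> y"
  have "(LBINT u:{0..y}. 2 * u * tail u)
      = (LBINT u:{0..y}. E (\<lambda>k. 2 * u * of_bool (u < \<bar>real_of_int k\<bar>)))"
    by (rule set_lebesgue_integral_cong) (auto simp: tail_eq)
  also have "\<dots> = E (\<lambda>k. LBINT u:{0..y}. 2 * u * of_bool (u < \<bar>real_of_int k\<bar>))"
    by (rule pmf_Fubini(1)[where B="2 * y"]) auto
  finally show ?thesis by (simp add: layer_cake_min_square[OF y] clip_moment2_def)
qed

lemma clip_moment2_nonneg: "0 \<le> clip_moment2 y"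
  unfolding clip_moment2_def by (rule Bochner_Integration.integral_nonneg) auto

lemma integral_tail_between:
  assumes "0 \<le> y" "y \<le> z"
  shows "(LBINT u:{y..z}. tail u)
    = E (\<lambda>k. min \<bar>real_of_int k\<bar> z - min \<bar>real_of_int k\<bar> y)"
proof -
  have "E (\<lambda>k. min \<bar>real_of_int k\<bar> z - min \<bar>real_of_int k\<bar> y)
     = (LBINT u:{0..z}. tail u) - (LBINT u:{0..y}. tail u)"
    using assms by (subst Bochner_Integration.integral_diff)
      (auto intro!: integrable_E_bounded[where B=z] simp: integral_tail_eq)
  then show ?thesis
    using set_integral_split[of 0 y z tail] set_integrable_tails assms by auto
qed

subsection \<open>Regularity of the drift\<close>

lemma drift_diff:
  assumes "0 \<le> y" "y \<le> z"
  shows "drift z - drift y = (LBINT u:{y..z}. up_tail u - lo_tail u)"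
  using set_integral_split[OF assms set_integral_diff(1)[OF set_integrable_tails(1,2)]]
  by (simp add: drift_def)

text \<open>
  The Lipschitz constant on \<open>[y, z]\<close> is the tail at the left end point, because the tails decrease.
  This is the source of slow variation.
\<close>

lemma drift_lipschitz:
  assumes "0 \<le> y" "y \<le> z"
  shows "\<bar>drift z - drift y\<bar> \<le> (z - y) * tail y"
proof -
  have "norm (LBINT u:{y..z}. up_tail u - lo_tail u) \<le> (LBINT u:{y..z}. tail y)"
  proof (rule norm_set_integral_le)
    fix u assume "u \<in> {y..z}"
    then show "norm (up_tail u - lo_tail u) \<le> tail y"
      using up_tail_antimono[of y u] lo_tail_antimono[of y u] tails_nonneg[of u]
      by (auto simp: tail_def)
  qed (rule set_integral_diff(1) set_integrable_tails borel_integrable_atLeastAtMost' continuous_on_const)+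
  then show ?thesis using drift_diff[OF assms] assms by (simp add: set_lebesgue_integral_def mult.commute)
qed

lemma drift_has_derivative:
  assumes "0 < y" "y \<notin> \<int>"
  shows "(drift has_real_derivative up_tail y - lo_tail y) (at y)"
proof -
  let ?f = "\<lambda>u. up_tail u - lo_tail u"
  have i: "set_integrable lborel {0..z} ?f" for z
    by (intro set_integral_diff(1) set_integrable_tails)
  have "((\<lambda>u. integral {0..u} ?f) has_vector_derivative ?f y) (at y within ({0..y+1} - {}))"
  proof (rule integral_has_vector_derivative_continuous_at)
    show "?f integrable_on {0..y + 1}" using set_borel_integral_eq_integral(1)[OF i] .
    have "isCont ?f y"
      by (rule continuous_diff[OF tails_continuous_off_Ints[OF assms(2)]])
    then show "continuous (at y within {0..y + 1} - {}) ?f"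
      by (rule continuous_at_imp_continuous_at_within)
  qed (use assms in auto)
  then have "((\<lambda>u. integral {0..u} ?f) has_vector_derivative ?f y) (at y within {0..y+1})" by simp
  then have "((\<lambda>u. integral {0..u} ?f) has_real_derivative ?f y) (at y)"
    using assms by (simp add: has_real_derivative_iff_has_vector_derivative at_within_Icc_at)
  moreover have "drift = (\<lambda>u. integral {0..u} ?f)"
    unfolding drift_def using set_borel_integral_eq_integral(2)[OF i] by auto
  ultimately show ?thesis by simp
qed

lemma drift_continuous_on: "continuous_on {0..} drift"
proof (rule continuous_onI)
  fix x e :: real assume x: "x \<in> {0..}" and e: "e > 0"
  have L: "\<bar>drift z - drift y\<bar> \<le> 2 * \<bar>z - y\<bar>" if "0 \<le> y" "0 \<le> z" for y z
  proof -
    have *: "\<bar>drift z - drift y\<bar> \<le> 2 * (z - y)" if "0 \<le> y" "y \<le> z" for y z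
    proof -
      have "(z - y) * tail y \<le> (z - y) * 2"
        using tail_le_2[of y] that by (intro mult_left_mono) auto
      then show ?thesis using drift_lipschitz[OF that] by linarith
    qed
    show ?thesis
    proof (cases "y \<le> z")
      case True
      then show ?thesis using *[of y z] that by simp
    next
      case False
      then show ?thesis using *[of z y] that by simp
    qed
  qed
  show "\<exists>d>0. \<forall>x'\<in>{0..}. dist x' x < d \<longrightarrow> dist (drift x') (drift x) \<le> e"
  proof (intro exI conjI ballI impI)
    show "e / 2 > 0" using e by simp
    fix x' assume "x' \<in> {0..}" "dist x' x < e / 2"
    then show "dist (drift x') (drift x) \<le> e" using L[of x x'] x by (auto simp: dist_real_def)
  qed
qed

end

section \<open>The characteristic function and its clipped version\<close>

lemma norm_cis_minus_1: "norm (cis x - 1) \<le> \<bar>x\<bar>"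
  using iexp_approx1[of x 0] by (simp add: cis_conv_exp)

lemma norm_cis_minus_linear: "norm (cis x - 1 - \<i> * x) \<le> x\<^sup>2 / 2"
  using iexp_approx1[of x 1] by (simp add: cis_conv_exp atMost_Suc algebra_simps numeral_2_eq_2)

text \<open>
  Clipping at the scale \<open>1/t\<close> is what makes the first-order expansion valid with an error that is
  a truncated second moment, whatever the size of \<open>x\<close>.
\<close>

lemma cis_clip_approx:
  assumes t: "t > 0"
  shows "norm (1 - cis (t * x) + \<i> * complex_of_real (t * clip (1/t) x)) \<le> 3 * t\<^sup>2 * (min \<bar>x\<bar> (1/t))\<^sup>2"
proof (cases "\<bar>x\<bar> \<le> 1 / t")
  case True
  then have "clip (1/t) x = x" by (auto simp: clip_def)
  then have "norm (1 - cis (t * x) + \<i> * complex_of_real (t * clip (1/t) x))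
    = norm (cis (t * x) - 1 - \<i> * (t * x))"
    by (metis add_diff_cancel_left' diff_add_cancel minus_diff_eq norm_minus_cancel uminus_add_conv_diff)
  also have "\<dots> \<le> (t * x)\<^sup>2 / 2" by (rule norm_cis_minus_linear)
  also have "\<dots> \<le> 3 * t\<^sup>2 * (min \<bar>x\<bar> (1/t))\<^sup>2"
    using True by (simp add: power_mult_distrib min_def)
  finally show ?thesis .
next
  case False
  then have "min \<bar>x\<bar> (1/t) = 1/t" by simp
  moreover have "\<bar>t * clip (1/t) x\<bar> = 1"
    using abs_clip[of "1/t" x] False t by (simp add: abs_mult)
  then have "norm (\<i> * complex_of_real (t * clip (1/t) x)) = 1"
    by (simp only: norm_mult norm_of_real) simp
  then have "norm (1 - cis (t * x) + \<i> * complex_of_real (t * clip (1/t) x)) \<le> 1 + 1 + 1"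
    by (intro order.trans[OF norm_triangle_ineq] add_mono order.trans[OF norm_triangle_ineq4]) auto
  ultimately show ?thesis using t by (simp add: power_divide)
qed

context step_law begin

text \<open>
  The step clipped to \<open>[-N, N]\<close> has all moments, so that its characteristic function is smooth; it
  stands in for \<open>chf\<close> where a derivative is needed.
\<close>

definition chf_clip :: "real \<Rightarrow> real \<Rightarrow> complex" where
  "chf_clip N t = E (\<lambda>k. cis (t * clip N (real_of_int k)))"

definition chf_clip_deriv :: "real \<Rightarrow> real \<Rightarrow> complex" where
  "chf_clip_deriv N t = E (\<lambda>k. \<i> * complex_of_real (clip N (real_of_int k)) * cis (t * clip N (real_of_int k)))"

lemma chf_eq_char: "chf = char (distr (measure_pmf p) borel real_of_int)"
proof
  fix t show "chf t = char (distr (measure_pmf p) borel real_of_int) t"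
    unfolding chf_def char_def by (subst integral_distr) (auto simp: cis_conv_exp)
qed

lemma chf_continuous: "isCont chf t"
proof -
  interpret real_distribution "distr (measure_pmf p) borel real_of_int"
    by (rule prob_space.real_distribution_distr[OF measure_pmf.prob_space_axioms]) auto
  show ?thesis unfolding chf_eq_char by (rule isCont_char)
qed

lemma chf_continuous_on: "continuous_on S chf"
  using chf_continuous by (intro continuous_at_imp_continuous_on) auto

lemma chf_measurable [measurable]: "chf \<in> borel_measurable borel"
  using chf_continuous_on by (intro borel_measurable_continuous_onI) auto

lemma norm_chf_le_1: "norm (chf t) \<le> 1"
  using norm_E_le[of "\<lambda>k. cis (t * real_of_int k)" "\<lambda>_. 1" 1] by (simp add: chf_def)

lemma Re_chf_le_1: "Re (chf t) \<le> 1"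
  using norm_chf_le_1[of t] complex_Re_le_cmod order.trans by blast

text \<open>
  Only the clipping of \<open>g\<close> at the scale \<open>1/t\<close> enters, so the same estimate serves the step itself and
  the step clipped at any \<open>N \<ge> 1/t\<close>.
\<close>

lemma E_cis_drift:
  fixes g :: "int \<Rightarrow> real"
  assumes t: "t > 0"
    and g: "\<And>k. clip (1/t) (g k) = clip (1/t) (real_of_int k)"
  shows "norm (1 - E (\<lambda>k. cis (t * g k)) + \<i> * complex_of_real (t * drift (1/t)))
    \<le> 3 * t\<^sup>2 * clip_moment2 (1/t)"
proof -
  let ?c = "\<lambda>k. clip (1/t) (real_of_int k)"
  have i1: "integrable (measure_pmf p) (\<lambda>k. cis (t * g k))"
    by (rule integrable_E_bounded[where B=1]) simp
  have i2: "integrable (measure_pmf p) ?c"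
    by (rule integrable_E_bounded[where B="1/t"]) (use abs_clip[of "1/t"] t in auto)
  have i3: "integrable (measure_pmf p) (\<lambda>k. \<i> * complex_of_real (t * ?c k))"
    using i2 by simp
  have m: "min \<bar>g k\<bar> (1/t) = min \<bar>real_of_int k\<bar> (1/t)" for k
    using abs_clip[of "1/t" "g k"] abs_clip[of "1/t" "real_of_int k"] g t by simp
  have "E (\<lambda>k. 1 - cis (t * g k) + \<i> * complex_of_real (t * ?c k))
     = 1 - E (\<lambda>k. cis (t * g k)) + \<i> * complex_of_real (t * drift (1/t))"
    using i1 i2 i3 t by (simp add: drift_eq)
  moreover have "norm (E (\<lambda>k. 1 - cis (t * g k) + \<i> * complex_of_real (t * ?c k)))
     \<le> E (\<lambda>k. 3 * t\<^sup>2 * (min \<bar>real_of_int k\<bar> (1/t))\<^sup>2)"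
  proof (rule norm_E_le)
    fix k
    show "norm (1 - cis (t * g k) + \<i> * complex_of_real (t * ?c k))
       \<le> 3 * t\<^sup>2 * (min \<bar>real_of_int k\<bar> (1/t))\<^sup>2"
      using cis_clip_approx[OF t, of "g k"] unfolding g m .
    have "(min \<bar>real_of_int k\<bar> (1/t))\<^sup>2 \<le> (1/t)\<^sup>2" using t by (intro power_mono) auto
    then have "t\<^sup>2 * (min \<bar>real_of_int k\<bar> (1/t))\<^sup>2 \<le> t\<^sup>2 * (1/t)\<^sup>2"
      by (rule mult_left_mono) simp
    also have "\<dots> = 1" using t by (simp add: power_divide)
    finally show "3 * t\<^sup>2 * (min \<bar>real_of_int k\<bar> (1/t))\<^sup>2 \<le> 3" by simp
  qed
  ultimately show ?thesis by (simp add: clip_moment2_def)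
qed

lemma chf_drift:
  "t > 0 \<Longrightarrow> norm (1 - chf t + \<i> * complex_of_real (t * drift (1/t))) \<le> 3 * t\<^sup>2 * clip_moment2 (1/t)"
  unfolding chf_def by (rule E_cis_drift) auto

lemma chf_clip_drift:
  "t > 0 \<Longrightarrow> 1/t \<le> N \<Longrightarrow>
    norm (1 - chf_clip N t + \<i> * complex_of_real (t * drift (1/t))) \<le> 3 * t\<^sup>2 * clip_moment2 (1/t)"
  unfolding chf_clip_def by (rule E_cis_drift) (auto intro!: clip_clip)

lemma chf_minus_clip:
  assumes "0 \<le> N"
  shows "norm (chf t - chf_clip N t) \<le> 2 * tail N"
proof -
  have "chf t - chf_clip N t = E (\<lambda>k. cis (t * real_of_int k) - cis (t * clip N (real_of_int k)))"
    unfolding chf_def chf_clip_def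
    by (subst Bochner_Integration.integral_diff) (auto intro!: integrable_E_bounded[where B=1])
  moreover have "norm (E (\<lambda>k. cis (t * real_of_int k) - cis (t * clip N (real_of_int k))))
     \<le> E (\<lambda>k. 2 * of_bool (N < \<bar>real_of_int k\<bar>))"
  proof (rule norm_E_le)
    fix k
    show "norm (cis (t * real_of_int k) - cis (t * clip N (real_of_int k)))
       \<le> 2 * of_bool (N < \<bar>real_of_int k\<bar>)"
    proof (cases "N < \<bar>real_of_int k\<bar>")
      case True
      then show ?thesis
        using norm_triangle_ineq4[of "cis (t * real_of_int k)" "cis (t * clip N (real_of_int k))"] by simp
    next
      case False
      then have "clip N (real_of_int k) = real_of_int k" by (auto simp: clip_def)
      then show ?thesis by simp
    qed
    show "2 * of_bool (N < \<bar>real_of_int k\<bar>) \<le> (2::real)" by simp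
  qed
  ultimately show ?thesis using tail_eq[OF assms] by simp
qed

text \<open>
  The derivative is the mean of \<open>c e\<^bsup>itc\<^esup>\<close> for the clipped step \<open>c\<close>. Clipping further at \<open>1/t\<close> and
  dropping the exponential leaves \<open>drift (1/t)\<close>; the exponential costs a second moment, and the
  part of the step between \<open>1/t\<close> and \<open>N\<close> costs the integral of the tail there.
\<close>

lemma chf_clip_deriv_bound:
  assumes t: "t > 0" and N: "1/t \<le> N"
  shows "norm (chf_clip_deriv N t)
    \<le> \<bar>drift (1/t)\<bar> + 2 * t * clip_moment2 (1/t) + (LBINT u:{1/t..N}. tail u)"
proof -
  let ?y = "1/t"
  let ?c = "\<lambda>k. clip N (real_of_int k)" and ?d = "\<lambda>k. clip ?y (real_of_int k)"
  let ?m = "\<lambda>z k. min \<bar>real_of_int k\<bar> z"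
  have y: "0 < ?y" "0 \<le> N" using t N order.trans[of 0 "1/t" N] by auto
  have ic: "integrable (measure_pmf p) (\<lambda>k. \<i> * complex_of_real (?c k) * cis (t * ?c k))"
    by (rule integrable_E_bounded[where B=N]) (use abs_clip[of N] y in \<open>auto simp: norm_mult\<close>)
  have id: "integrable (measure_pmf p) ?d"
    by (rule integrable_E_bounded[where B="?y"]) (use abs_clip[of ?y] y in auto)
  have "norm (E (\<lambda>k. \<i> * complex_of_real (?c k) * cis (t * ?c k) - \<i> * complex_of_real (?d k)))
     \<le> E (\<lambda>k. 2 * t * (?m ?y k)\<^sup>2 + (?m N k - ?m ?y k))"
  proof (rule norm_E_le)
    fix k
    have "norm (\<i> * complex_of_real (?c k) * cis (t * ?c k) - \<i> * complex_of_real (?d k))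
       = norm (\<i> * (complex_of_real (?c k) * cis (t * ?c k) - complex_of_real (?d k)))"
      by (simp add: algebra_simps)
    also have "\<dots> = norm (complex_of_real (?c k) * cis (t * ?c k) - complex_of_real (?d k))"
      by (simp add: norm_mult)
    also have "\<dots> = norm (complex_of_real (?c k - ?d k) * cis (t * ?c k)
         + complex_of_real (?d k) * (cis (t * ?c k) - 1))"
      by (simp add: algebra_simps)
    also have "\<dots> \<le> \<bar>?c k - ?d k\<bar> + \<bar>?d k\<bar> * norm (cis (t * ?c k) - 1)"
      by (rule order.trans[OF norm_triangle_ineq]) (simp only: norm_mult norm_of_real norm_cis, simp)
    also have "\<bar>?c k - ?d k\<bar> = ?m N k - ?m ?y k"
      using y N unfolding clip_def by linarith
    also have "\<bar>?d k\<bar> * norm (cis (t * ?c k) - 1) \<le> 2 * t * (?m ?y k)\<^sup>2"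
    proof (cases "\<bar>real_of_int k\<bar> \<le> ?y")
      case True
      then have e: "?c k = real_of_int k" "?d k = real_of_int k" "?m ?y k = \<bar>real_of_int k\<bar>"
        using N by (auto simp: clip_def)
      have "\<bar>real_of_int k\<bar> * norm (cis (t * real_of_int k) - 1) \<le> \<bar>real_of_int k\<bar> * \<bar>t * real_of_int k\<bar>"
        by (intro mult_left_mono norm_cis_minus_1) simp
      also have "\<dots> = t * \<bar>real_of_int k\<bar>\<^sup>2" using t by (simp add: abs_mult power2_eq_square)
      moreover have "0 \<le> t * \<bar>real_of_int k\<bar>\<^sup>2" using t by simp
      ultimately show ?thesis unfolding e by linarith
    next
      case False
      then have e: "?m ?y k = ?y" "\<bar>?d k\<bar> = ?y" using abs_clip[of ?y] y by auto
      have "norm (cis (t * ?c k) - 1) \<le> 2"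
        using norm_triangle_ineq4[of "cis (t * ?c k)" 1] by simp
      then have "?y * norm (cis (t * ?c k) - 1) \<le> ?y * 2" using y by (intro mult_left_mono) auto
      also have "\<dots> = 2 * t * ?y\<^sup>2" using t by (simp add: power2_eq_square)
      finally show ?thesis unfolding e .
    qed
    finally show "norm (\<i> * complex_of_real (?c k) * cis (t * ?c k) - \<i> * complex_of_real (?d k))
       \<le> 2 * t * (?m ?y k)\<^sup>2 + (?m N k - ?m ?y k)" by simp
    have "2 * t * (?m ?y k)\<^sup>2 \<le> 2 * t * ?y\<^sup>2"
      using t y by (intro mult_left_mono power_mono) auto
    moreover have "?m N k - ?m ?y k \<le> N" using y by linarith
    ultimately show "2 * t * (?m ?y k)\<^sup>2 + (?m N k - ?m ?y k) \<le> 2 * t * ?y\<^sup>2 + N" by linarith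
  qed
  moreover have "E (\<lambda>k. \<i> * complex_of_real (?c k) * cis (t * ?c k) - \<i> * complex_of_real (?d k))
     = chf_clip_deriv N t - \<i> * complex_of_real (drift ?y)"
    using ic id y by (simp add: chf_clip_deriv_def drift_eq)
  moreover have "E (\<lambda>k. 2 * t * (?m ?y k)\<^sup>2 + (?m N k - ?m ?y k))
     = 2 * t * clip_moment2 ?y + (LBINT u:{?y..N}. tail u)"
  proof -
    have "integrable (measure_pmf p) (\<lambda>k. (?m ?y k)\<^sup>2)"
      by (rule integrable_E_bounded[where B="?y\<^sup>2"]) (use y in \<open>auto intro!: power_mono\<close>)
    moreover have "integrable (measure_pmf p) (\<lambda>k. ?m N k - ?m ?y k)"
      by (rule integrable_E_bounded[where B=N]) (insert y N, unfold real_norm_def, linarith)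
    ultimately show ?thesis using y N integral_tail_between[of ?y N]
      by (subst Bochner_Integration.integral_add) (auto simp: clip_moment2_def)
  qed
  moreover have "norm (chf_clip_deriv N t)
     \<le> norm (chf_clip_deriv N t - \<i> * complex_of_real (drift ?y)) + \<bar>drift ?y\<bar>"
    using norm_triangle_ineq[of "chf_clip_deriv N t - \<i> * complex_of_real (drift ?y)" "\<i> * complex_of_real (drift ?y)"]
    by (simp add: norm_mult)
  ultimately show ?thesis by simp
qed

lemma chf_clip_deriv_bound_uniform:
  assumes "0 \<le> N"
  shows "norm (chf_clip_deriv N t) \<le> (LBINT u:{0..N}. tail u)"
  unfolding chf_clip_deriv_def integral_tail_eq[OF assms]
  by (rule norm_E_le[where B=N]) (use abs_clip[OF assms] in \<open>auto simp: norm_mult\<close>)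

text \<open>
  Boundedness of the clipped step makes the quadratic Taylor remainder of the exponential uniform, so
  differentiation passes under the expectation.
\<close>

lemma chf_clip_has_derivative:
  assumes N: "0 \<le> N"
  shows "(chf_clip N has_vector_derivative chf_clip_deriv N t) (at t)"
proof -
  let ?c = "\<lambda>k. clip N (real_of_int k)"
  have cN: "\<bar>?c k\<bar> \<le> N" for k using abs_clip[OF N] by simp
  have bound: "norm (chf_clip N s - chf_clip N t - (s - t) *\<^sub>R chf_clip_deriv N t) \<le> N\<^sup>2 * \<bar>s - t\<bar>\<^sup>2" for s
  proof -
    have "chf_clip N s - chf_clip N t - (s - t) *\<^sub>R chf_clip_deriv N t
      = E (\<lambda>k. cis (s * ?c k) - cis (t * ?c k) - (s - t) *\<^sub>R (\<i> * complex_of_real (?c k) * cis (t * ?c k)))"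
    proof -
      have "integrable (measure_pmf p) (\<lambda>k. cis (u * ?c k))" for u
        by (rule integrable_E_bounded[where B=1]) simp
      moreover have "integrable (measure_pmf p) (\<lambda>k. \<i> * complex_of_real (?c k) * cis (t * ?c k))"
        by (rule integrable_E_bounded[where B=N]) (use cN in \<open>auto simp: norm_mult\<close>)
      ultimately show ?thesis unfolding chf_clip_def chf_clip_deriv_def
        by (simp del: scaleR_conv_of_real)
    qed
    also have "norm \<dots> \<le> E (\<lambda>k. N\<^sup>2 * \<bar>s - t\<bar>\<^sup>2)"
    proof (rule norm_E_le[where B="N\<^sup>2 * \<bar>s - t\<bar>\<^sup>2"])
      fix k
      have "cis (s * ?c k) - cis (t * ?c k) - (s - t) *\<^sub>R (\<i> * complex_of_real (?c k) * cis (t * ?c k))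
         = cis (t * ?c k) * (cis ((s - t) * ?c k) - 1 - \<i> * complex_of_real ((s - t) * ?c k))"
        by (simp add: algebra_simps cis_mult scaleR_conv_of_real)
      also have "norm \<dots> \<le> ((s - t) * ?c k)\<^sup>2 / 2"
        using norm_cis_minus_linear[of "(s - t) * ?c k"] by (simp add: norm_mult)
      also have "\<dots> \<le> ((s - t) * ?c k)\<^sup>2" by simp
      also have "\<dots> \<le> N\<^sup>2 * \<bar>s - t\<bar>\<^sup>2"
      proof -
        have "(?c k)\<^sup>2 \<le> N\<^sup>2" using power_mono[OF cN[of k], of 2] by simp
        then have "(s - t)\<^sup>2 * (?c k)\<^sup>2 \<le> (s - t)\<^sup>2 * N\<^sup>2" by (rule mult_left_mono) simp
        then show ?thesis by (simp add: power_mult_distrib mult.commute)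
      qed
      finally show "norm (cis (s * ?c k) - cis (t * ?c k) - (s - t) *\<^sub>R (\<i> * complex_of_real (?c k) * cis (t * ?c k)))
         \<le> N\<^sup>2 * \<bar>s - t\<bar>\<^sup>2" .
    qed simp
    finally show ?thesis by simp
  qed
  have lim: "((\<lambda>s. norm (chf_clip N s - chf_clip N t - (s - t) *\<^sub>R chf_clip_deriv N t) / norm (s - t)) \<longlongrightarrow> 0) (at t)"
  proof (rule Lim_null_comparison)
    show "\<forall>\<^sub>F s in at t. norm (norm (chf_clip N s - chf_clip N t - (s - t) *\<^sub>R chf_clip_deriv N t) / norm (s - t))
        \<le> N\<^sup>2 * \<bar>s - t\<bar>"
    proof (rule eventually_at_topological[THEN iffD2], intro exI[of _ UNIV] conjI ballI impI)
      fix s assume "s \<noteq> t"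
      then show "norm (norm (chf_clip N s - chf_clip N t - (s - t) *\<^sub>R chf_clip_deriv N t) / norm (s - t))
        \<le> N\<^sup>2 * \<bar>s - t\<bar>"
        using bound[of s] by (simp add: divide_le_eq power2_eq_square mult.assoc)
    qed auto
    show "((\<lambda>s. N\<^sup>2 * \<bar>s - t\<bar>) \<longlongrightarrow> 0) (at t)"
      by (rule tendsto_eq_intros refl | simp)+
  qed
  show ?thesis
    unfolding has_vector_derivative_def has_derivative_iff_norm
    using lim by (auto intro: bounded_linear_scaleR_left)
qed

lemma chf_clip_deriv_continuous_on:
  assumes N: "0 \<le> N"
  shows "continuous_on S (chf_clip_deriv N)"
proof (rule continuous_onI)
  fix x e :: real assume e: "e > 0"
  let ?c = "\<lambda>k. clip N (real_of_int k)"
  have cN: "\<bar>?c k\<bar> \<le> N" for k using abs_clip[OF N] by simp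
  have L: "dist (chf_clip_deriv N s) (chf_clip_deriv N t) \<le> N * N * \<bar>s - t\<bar>" for s t
  proof -
    let ?f = "\<lambda>u k. \<i> * complex_of_real (?c k) * cis (u * ?c k)"
    have "integrable (measure_pmf p) (?f u)" for u
      by (rule integrable_E_bounded[where B=N]) (use cN in \<open>auto simp: norm_mult\<close>)
    then have "chf_clip_deriv N s - chf_clip_deriv N t = E (\<lambda>k. ?f s k - ?f t k)"
      by (simp add: chf_clip_deriv_def)
    also have "norm \<dots> \<le> E (\<lambda>k. N * N * \<bar>s - t\<bar>)"
    proof (rule norm_E_le[where B="N * N * \<bar>s - t\<bar>"])
      fix k
      have "?f s k - ?f t k = \<i> * complex_of_real (?c k) * cis (t * ?c k) * (cis ((s - t) * ?c k) - 1)"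
        by (simp add: algebra_simps cis_mult)
      also have "norm \<dots> = \<bar>?c k\<bar> * norm (cis ((s - t) * ?c k) - 1)"
        by (simp only: norm_mult norm_cis norm_of_real) simp
      also have "\<dots> \<le> \<bar>?c k\<bar> * \<bar>(s - t) * ?c k\<bar>" by (intro mult_left_mono norm_cis_minus_1) simp
      also have "\<dots> = (\<bar>?c k\<bar> * \<bar>?c k\<bar>) * \<bar>s - t\<bar>" by (simp add: abs_mult)
      also have "\<dots> \<le> (N * N) * \<bar>s - t\<bar>" using cN N by (intro mult_right_mono mult_mono) auto
      finally show "norm (?f s k - ?f t k) \<le> N * N * \<bar>s - t\<bar>" .
    qed simp
    finally show ?thesis by (simp add: dist_norm)
  qed
  show "\<exists>d>0. \<forall>x'\<in>S. dist x' x < d \<longrightarrow> dist (chf_clip_deriv N x') (chf_clip_deriv N x) \<le> e"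
  proof (intro exI conjI ballI impI)
    show "e / (N * N + 1) > 0" using e by (simp add: add_nonneg_pos)
    fix x' assume "dist x' x < e / (N * N + 1)"
    then have "\<bar>x' - x\<bar> * (N * N + 1) \<le> e"
      by (simp add: dist_real_def pos_less_divide_eq add_nonneg_pos less_imp_le)
    then have "N * N * \<bar>x' - x\<bar> \<le> e" by (simp add: algebra_simps)
    then show "dist (chf_clip_deriv N x') (chf_clip_deriv N x) \<le> e" using L[of x' x] by linarith
  qed
qed

end

section \<open>Slow variation of the drift\<close>

lemma increasing_off_finite:
  fixes F :: "real \<Rightarrow> real"
  assumes "a \<le> b" "finite S" "continuous_on {a..b} F"
    and der: "\<And>x. x \<in> {a<..<b} - S \<Longrightarrow> (F has_real_derivative f x) (at x)"
    and nonneg: "\<And>x. x \<in> {a<..<b} - S \<Longrightarrow> 0 \<le> f x"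
  shows "F a \<le> F b"
proof -
  let ?g = "\<lambda>x. if x \<in> {a<..<b} - S then f x else 0"
  have "(?g has_integral (F b - F a)) {a..b}"
  proof (rule fundamental_theorem_of_calculus_interior_strong)
    fix x assume "x \<in> {a<..<b} - S"
    then show "(F has_vector_derivative ?g x) (at x)"
      using der by (simp add: has_real_derivative_iff_has_vector_derivative)
  qed (use assms in auto)
  then have "0 \<le> F b - F a"
    by (rule has_integral_nonneg) (use nonneg in auto)
  then show ?thesis by simp
qed

lemma set_integral_powr:
  fixes r :: real
  assumes "0 < a" "a \<le> b" "r \<noteq> -1"
  shows "(LBINT v:{a..b}. v powr r) = (b powr (r + 1) - a powr (r + 1)) / (r + 1)"
    and "set_integrable lborel {a..b} (\<lambda>v. v powr r)"
proof -
  show i: "set_integrable lborel {a..b} (\<lambda>v. v powr r)"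
    using assms by (intro borel_integrable_atLeastAtMost' continuous_intros) auto
  have "(LBINT v:{a..b}. v powr r) = b powr (r + 1) / (r + 1) - a powr (r + 1) / (r + 1)"
  proof (rule set_integral_FTC[where S="{}"])
    fix x assume "x \<in> {a<..<b} - {}"
    then show "((\<lambda>v. v powr (r + 1) / (r + 1)) has_vector_derivative x powr r) (at x)"
      using assms unfolding has_real_derivative_iff_has_vector_derivative[symmetric]
      by (auto intro!: derivative_eq_intros simp: powr_diff)
  qed (use assms i in \<open>auto intro!: continuous_intros\<close>)
  then show "(LBINT v:{a..b}. v powr r) = (b powr (r + 1) - a powr (r + 1)) / (r + 1)"
    by (simp add: diff_divide_distrib)
qed

lemma filterlim_powr_at_top:
  fixes r :: real
  assumes "r > 0"
  shows "filterlim (\<lambda>u. u powr r) at_top at_top"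
proof -
  have "filterlim (\<lambda>u. exp (r * ln u)) at_top at_top"
    by (rule filterlim_compose[OF exp_at_top filterlim_tendsto_pos_mult_at_top[OF tendsto_const assms ln_at_top]])
  moreover have "\<forall>\<^sub>F u in at_top. exp (r * ln u) = u powr r"
    using eventually_gt_at_top[of 0] by eventually_elim (simp add: powr_def)
  ultimately show ?thesis
    using filterlim_cong[OF refl refl, of "\<lambda>u. exp (r * ln u)" "\<lambda>u. u powr r" at_top at_top] by simp
qed

text \<open>
  Scaling by \<open>c < 1\<close> is the inverse of scaling by \<open>1/c\<close>.
\<close>

lemma ratio_limit_scale:
  fixes F :: "real \<Rightarrow> real"
  assumes "\<And>c. c \<ge> 1 \<Longrightarrow> ((\<lambda>x. F (c * x) / F x) \<longlongrightarrow> 1) at_top" "c > 0"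
  shows "((\<lambda>x. F (c * x) / F x) \<longlongrightarrow> 1) at_top"
proof (cases "c \<ge> 1")
  case False
  have "filterlim (\<lambda>x. c * x) at_top at_top"
    using assms(2) by (rule filterlim_tendsto_pos_mult_at_top[OF tendsto_const _ filterlim_ident])
  moreover have "((\<lambda>x. F (inverse c * x) / F x) \<longlongrightarrow> 1) at_top"
    using False assms by (intro assms(1)) (simp add: one_le_inverse)
  ultimately have "((\<lambda>x. F (inverse c * (c * x)) / F (c * x)) \<longlongrightarrow> 1) at_top"
    by (rule filterlim_compose[rotated])
  then have "((\<lambda>x. inverse (F x / F (c * x))) \<longlongrightarrow> inverse 1) at_top"
    using assms(2) by (intro tendsto_inverse) (auto simp: mult.assoc[symmetric])
  then show ?thesis by simp
qed (use assms in auto)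

text \<open>
  From \<open>T\<close> on the drift is positive and beats the tail; the factor 8 makes the logarithm of the drift vary
  more slowly than \<open>ln u / 4\<close>.
\<close>

locale small_tails = step_law +
  fixes T :: nat
  assumes T_pos: "1 \<le> T"
    and drift_pos: "\<And>u. real T \<le> u \<Longrightarrow> 0 < drift u"
    and tail_small: "\<And>u. real T \<le> u \<Longrightarrow> 8 * (u * tail u) \<le> drift u"
    and tail_ratio: "((\<lambda>u. u * tail u / drift u) \<longlongrightarrow> 0) at_top"
begin

lemma T_pos': "1 \<le> real T" "0 < real T" using T_pos by auto

lemma abs_drift_deriv_le: "\<bar>up_tail u - lo_tail u\<bar> \<le> tail u"
  using tails_nonneg[of u] by (auto simp: tail_def)

text \<open>
  The logarithmic derivative of the drift is at most \<open>tail/drift \<le> 1/(4u)\<close> in absolute value, so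
  \<open>ln u / 4 \<plusminus> ln (drift u)\<close> is nondecreasing. Exponents below one half are what the later integrals
  need, since the square of the drift occurs in denominators.
\<close>

lemma drift_Potter:
  assumes "real T \<le> u" "u \<le> v"
  shows "drift v \<le> drift u * (v / u) powr (1/4)" "drift u \<le> drift v * (v / u) powr (1/4)"
proof -
  have pos: "0 < u" "0 < v" "0 < drift u" "0 < drift v"
    using assms T_pos' drift_pos by auto
  have cont: "continuous_on {u..v} drift"
    using continuous_on_subset[OF drift_continuous_on, of "{u..v}"] pos by auto
  have step: "s * ln (drift u) + ln u / 4 \<le> s * ln (drift v) + ln v / 4" if s: "\<bar>s\<bar> = 1" for s :: real
  proof (rule increasing_off_finite[where S="\<int> \<inter> {u..v}" and a=u and b=v
        and F="\<lambda>x. s * ln (drift x) + ln x / 4"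
        and f="\<lambda>x. s * ((up_tail x - lo_tail x) / drift x) + 1 / (4 * x)"])
    show "continuous_on {u..v} (\<lambda>x. s * ln (drift x) + ln x / 4)"
      using assms drift_pos pos
      by (intro continuous_intros cont ballI) (force simp: less_imp_neq[symmetric])+
    fix x assume x: "x \<in> {u<..<v} - \<int> \<inter> {u..v}"
    then have xT: "real T \<le> x" "0 < x" "x \<notin> \<int>" "0 < drift x"
      using assms pos drift_pos by auto
    show "((\<lambda>x. s * ln (drift x) + ln x / 4) has_real_derivative
      (s * ((up_tail x - lo_tail x) / drift x) + 1 / (4 * x))) (at x)"
      using xT by (auto intro!: derivative_eq_intros drift_has_derivative)
    have "\<bar>s * ((up_tail x - lo_tail x) / drift x)\<bar> \<le> tail x / drift x"
      using s xT abs_drift_deriv_le[of x] by (simp add: abs_mult divide_right_mono)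
    also have "\<dots> \<le> 1 / (4 * x)"
    proof -
      have "tail x * (4 * x) \<le> drift x"
        using tail_small[OF xT(1)] mult_nonneg_nonneg[of x "tail x"] xT tails_nonneg(3)[of x]
        by (simp add: algebra_simps)
      then show ?thesis using xT by (simp add: divide_simps)
    qed
    finally have "\<bar>s * ((up_tail x - lo_tail x) / drift x)\<bar> \<le> 1 / (4 * x)" .
    moreover have "0 \<le> y + z" if "\<bar>y\<bar> \<le> z" for y z :: real using that by linarith
    ultimately show "0 \<le> s * ((up_tail x - lo_tail x) / drift x) + 1 / (4 * x)" by blast
  qed (use assms finite_Ints_interval in auto)
  have expand: "a \<le> b * (v / u) powr (1/4)" if "ln a \<le> ln b + (ln v - ln u) / 4" "0 < a" "0 < b" for a b
  proof -
    have "a \<le> exp (ln b + (ln v - ln u) / 4)" using that by (metis exp_le_cancel_iff exp_ln)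
    also have "\<dots> = b * (v / u) powr (1/4)"
      using that pos by (simp add: exp_add powr_def ln_div)
    finally show ?thesis .
  qed
  show "drift v \<le> drift u * (v / u) powr (1/4)"
    using step[of "-1"] pos by (intro expand) (auto simp: field_simps)
  show "drift u \<le> drift v * (v / u) powr (1/4)"
    using step[of "1"] pos by (intro expand) (auto simp: field_simps)
qed

text \<open>Freezing the drift below \<open>T\<close> keeps the growth bounds and makes them hold on all of \<open>(0, \<infinity>)\<close>.\<close>

definition L :: "real \<Rightarrow> real" where "L u = drift (max u (real T))"

lemma L_pos: "0 < L u" unfolding L_def by (rule drift_pos) simp

lemma L_eq: "real T \<le> u \<Longrightarrow> L u = drift u" by (simp add: L_def max_def)

lemma L_Potter:
  assumes "0 < u" "u \<le> v"
  shows "L v \<le> L u * (v / u) powr (1/4)" "L u \<le> L v * (v / u) powr (1/4)"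
proof -
  let ?u = "max u (real T)" and ?v = "max v (real T)"
  have "?v / ?u \<le> v / u" using assms T_pos' by (auto simp: max_def field_simps)
  then have "(?v / ?u) powr (1/4) \<le> (v / u) powr (1/4)" using T_pos' assms by (intro powr_mono2) auto
  moreover have "L v \<le> L u * (?v / ?u) powr (1/4)" "L u \<le> L v * (?v / ?u) powr (1/4)"
    unfolding L_def using drift_Potter[of ?u ?v] assms by auto
  ultimately show "L v \<le> L u * (v / u) powr (1/4)" "L u \<le> L v * (v / u) powr (1/4)"
    using L_pos[of u] L_pos[of v] mult_left_mono[of "(?v / ?u) powr (1/4)" "(v / u) powr (1/4)"]
    by (meson less_imp_le order.trans)+
qed

lemma L_continuous_on: "continuous_on S L"
  unfolding L_def
  by (rule continuous_on_compose2[OF drift_continuous_on])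
     (use T_pos' in \<open>auto intro!: continuous_intros simp: le_max_iff_disj\<close>)

lemma L_measurable [measurable]: "L \<in> borel_measurable borel"
  by (rule borel_measurable_continuous_onI[OF L_continuous_on])

definition tail_const :: real where "tail_const = 1/8 + 2 * real T / drift (real T)"

lemma tail_const_pos: "0 < tail_const"
  unfolding tail_const_def using T_pos' drift_pos[of "real T"] by (auto intro!: add_pos_nonneg)

lemma tail_le_L: "0 < u \<Longrightarrow> u * tail u \<le> tail_const * L u"
proof (cases "real T \<le> u")
  case True
  then have "8 * (u * tail u) \<le> L u" using tail_small L_eq by simp
  moreover have "L u * (1/8) \<le> L u * tail_const" unfolding tail_const_def
    using L_pos[of u] drift_pos[of "real T"] by (intro mult_left_mono) auto
  ultimately show ?thesis by (simp add: mult.commute)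
next
  case False
  assume u: "0 < u"
  have "u * tail u \<le> real T * 2" using False u tail_le_2 tails_nonneg by (intro mult_mono) auto
  also have "\<dots> = (2 * real T / drift (real T)) * L u"
    using False drift_pos[of "real T"] by (simp add: L_def max_def)
  also have "\<dots> \<le> tail_const * L u"
    unfolding tail_const_def using L_pos[of u] by (intro mult_right_mono) auto
  finally show ?thesis .
qed

lemma integral_tail_le:
  assumes "0 < u" "u \<le> x"
  shows "(LBINT v:{u..x}. tail v) \<le> 4 * tail_const * L u * (x / u) powr (1/4)"
proof -
  let ?c = "tail_const * L u * u powr (-1/4)"
  have "(LBINT v:{u..x}. tail v) \<le> (LBINT v:{u..x}. ?c * v powr (-3/4))"
  proof (rule set_integral_mono_le)
    fix v assume v: "v \<in> {u..x}"
    have "v * tail v \<le> tail_const * (L u * (v / u) powr (1/4))"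
    proof (rule order.trans[OF tail_le_L mult_left_mono])
      show "L v \<le> L u * (v / u) powr (1/4)" using v assms by (intro L_Potter(1)) auto
    qed (use v assms tail_const_pos in auto)
    then have "tail v \<le> tail_const * (L u * (v / u) powr (1/4)) / v"
      using v assms by (simp add: pos_le_divide_eq mult.commute)
    also have "\<dots> = ?c * v powr (-3/4)"
    proof -
      have "v powr (1/4) / v = v powr (-3/4)"
        using v assms powr_diff[of v "1/4" 1] by simp
      then show ?thesis using v assms
        by (simp add: powr_divide powr_minus_divide field_simps)
    qed
    finally show "tail v \<le> ?c * v powr (-3/4)" .
  qed (use assms in \<open>auto intro!: set_integrable_tails set_integrable_mult_right set_integral_powr\<close>)
  also have "\<dots> = ?c * (4 * (x powr (1/4) - u powr (1/4)))"
    using set_integral_powr(1)[of u x "-3/4"] assms by simp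
  also have "\<dots> \<le> ?c * (4 * x powr (1/4))"
    using tail_const_pos L_pos[of u] by (intro mult_left_mono) auto
  also have "\<dots> = 4 * tail_const * L u * (x / u) powr (1/4)"
    using assms by (simp add: powr_divide powr_minus_divide)
  finally show ?thesis .
qed

text \<open>
  By the Lipschitz bound the relative increment over \<open>[x, c x]\<close> is at most \<open>(c - 1) x tail x / drift x\<close>.
\<close>

lemma drift_slowly_varying_ge:
  assumes "c \<ge> 1"
  shows "((\<lambda>x. drift (c * x) / drift x) \<longlongrightarrow> 1) at_top"
proof -
  have "((\<lambda>x. drift (c * x) / drift x - 1) \<longlongrightarrow> 0) at_top"
  proof (rule Lim_null_comparison)
    show "\<forall>\<^sub>F x in at_top. norm (drift (c * x) / drift x - 1) \<le> (c - 1) * (x * tail x / drift x)"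
      using eventually_ge_at_top[of "real T"]
    proof eventually_elim
      case (elim x)
      have x: "0 < x" "0 < drift x" using elim T_pos' drift_pos by auto
      have "\<bar>drift (c * x) - drift x\<bar> \<le> (c * x - x) * tail x"
        using x assms by (intro drift_lipschitz) (auto simp: mult_le_cancel_right1)
      then have "\<bar>drift (c * x) - drift x\<bar> / drift x \<le> (c - 1) * (x * tail x) / drift x"
        using x by (intro divide_right_mono) (auto simp: algebra_simps)
      moreover have "norm (drift (c * x) / drift x - 1) = \<bar>drift (c * x) - drift x\<bar> / drift x"
      proof -
        have "drift (c * x) / drift x - 1 = (drift (c * x) - drift x) / drift x"
          using x by (simp add: diff_divide_distrib)
        then show ?thesis using x by simp
      qed
      ultimately show ?case by simp
    qed
    show "((\<lambda>x. (c - 1) * (x * tail x / drift x)) \<longlongrightarrow> 0) at_top"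
      using tendsto_mult[OF tendsto_const tail_ratio] by simp
  qed
  then show ?thesis using LIM_zero_iff by blast
qed

lemma drift_slowly_varying:
  "c > 0 \<Longrightarrow> ((\<lambda>x. drift (c * x) / drift x) \<longlongrightarrow> 1) at_top"
  by (rule ratio_limit_scale[OF drift_slowly_varying_ge])

lemma times_drift_at_top: "filterlim (\<lambda>u. u * drift u) at_top at_top"
proof (rule filterlim_at_top_mono)
  let ?c = "drift (real T) * real T powr (1/4)"
  show "filterlim (\<lambda>u. ?c * u powr (3/4)) at_top at_top"
    using drift_pos[of "real T"] T_pos'
    by (intro filterlim_tendsto_pos_mult_at_top[OF tendsto_const] filterlim_powr_at_top) auto
  show "\<forall>\<^sub>F u in at_top. ?c * u powr (3/4) \<le> u * drift u"
    using eventually_ge_at_top[of "real T"]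
  proof eventually_elim
    case (elim u)
    have u: "0 < u" using elim T_pos' by simp
    have "drift (real T) * (real T powr (1/4) * u powr (3/4))
        \<le> (drift u * (u / real T) powr (1/4)) * (real T powr (1/4) * u powr (3/4))"
      using drift_Potter(2)[OF order_refl elim] by (intro mult_right_mono) auto
    also have "\<dots> = drift u * (u powr (1/4) * u powr (3/4))"
      using u T_pos' by (simp add: powr_divide)
    also have "\<dots> = u * drift u" using u by (simp add: powr_add[symmetric])
    finally show ?case by (simp add: mult.assoc)
  qed
qed

text \<open>
  Divided by \<open>u\<close>, the clipped second moment is an average of \<open>2 * v * tail v\<close> over \<open>[0, u]\<close>, hence of
  smaller order than the average of the drift, which slow variation makes comparable to \<open>drift u\<close>.
\<close>

lemma clip_moment2_little:
  "((\<lambda>u. clip_moment2 u / (u * drift u)) \<longlongrightarrow> 0) at_top"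
proof (rule tendstoI)
  fix e :: real assume e: "e > 0"
  obtain T1 where T1: "\<And>u. u \<ge> T1 \<Longrightarrow> u * tail u / drift u < e / 8"
    using order_tendstoD(2)[OF tail_ratio, of "e / 8"] e by (auto simp: eventually_at_top_linorder)
  define S where "S = max T1 (real T)"
  have S: "real T \<le> S" "0 < S" using T_pos' by (auto simp: S_def)
  have tl: "v * tail v \<le> e / 8 * drift v" if "v \<ge> S" for v
    using T1[of v] that drift_pos[of v] by (simp add: S_def divide_less_eq)
  have "\<forall>\<^sub>F u in at_top. 2 * clip_moment2 S / e + 1 \<le> u * drift u"
    using times_drift_at_top by (simp add: filterlim_at_top)
  then show "\<forall>\<^sub>F u in at_top. dist (clip_moment2 u / (u * drift u)) 0 < e"
    using eventually_ge_at_top[of S]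
  proof eventually_elim
    case (elim u)
    have u: "0 < u" "0 < drift u" "real T \<le> u" using elim S drift_pos by auto
    let ?c = "e / 4 * drift u * u powr (1/4)"
    have i: "set_integrable lborel {a..b} (\<lambda>v. 2 * v * tail v)" if "0 \<le> a" for a b
    proof (rule set_integrable_bounded_interval[where B="2 * (b * 2)"])
      fix v assume v: "v \<in> {a..b}"
      have "v * tail v \<le> b * 2"
        using v that by (intro mult_mono tail_le_2 tails_nonneg) auto
      then show "norm (2 * v * tail v) \<le> 2 * (b * 2)"
        using v that tails_nonneg(3)[of v] by (simp add: abs_mult)
    qed auto
    have "clip_moment2 u = clip_moment2 S + (LBINT v:{S..u}. 2 * v * tail v)"
      using set_integral_split[OF _ _ i[OF order_refl], of S u] elim S u by (simp add: clip_moment2_eq)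
    also have "(LBINT v:{S..u}. 2 * v * tail v) \<le> (LBINT v:{S..u}. ?c * v powr (-1/4))"
    proof (rule set_integral_mono_le)
      fix v assume v: "v \<in> {S..u}"
      have "2 * v * tail v \<le> 2 * (e / 8 * drift v)" using tl[of v] v by simp
      also have "\<dots> \<le> 2 * (e / 8 * (drift u * (u / v) powr (1/4)))"
        using drift_Potter(2)[of v u] v S e by (intro mult_left_mono) auto
      also have "\<dots> = ?c * v powr (-1/4)"
        using v S by (simp add: powr_divide powr_minus_divide)
      finally show "2 * v * tail v \<le> ?c * v powr (-1/4)" .
    qed (use elim S i in \<open>auto intro!: set_integrable_mult_right set_integral_powr\<close>)
    also have "\<dots> = ?c * ((u powr (3/4) - S powr (3/4)) / (3/4))"
      using set_integral_powr(1)[of S u "-1/4"] elim S by simp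
    also have "\<dots> \<le> ?c * (u powr (3/4) / (3/4))"
      using u e by (intro mult_left_mono divide_right_mono) auto
    also have "\<dots> = e / 3 * drift u * (u powr (1/4) * u powr (3/4))" by simp
    also have "\<dots> = e / 3 * (u * drift u)" using u by (simp add: powr_add[symmetric])
    finally have "clip_moment2 u \<le> clip_moment2 S + e / 3 * (u * drift u)" by simp
    moreover have "2 * clip_moment2 S + e \<le> e * (u * drift u)"
      using elim(1) e by (simp add: field_simps)
    ultimately have "clip_moment2 u < e * (u * drift u)" using e clip_moment2_nonneg[of S] by linarith
    then show ?case
      using u clip_moment2_nonneg[of u] by (simp add: dist_real_def divide_less_eq)
  qed
qed

end

section \<open>The oscillating part of the Fourier integral\<close>

context small_tails begin

lemma tail_tendsto_0: "(tail \<longlongrightarrow> 0) at_top"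
proof (rule Lim_null_comparison)
  let ?c = "drift (real T) * real T powr (-1/4)"
  show "\<forall>\<^sub>F u in at_top. norm (tail u) \<le> ?c * u powr (-3/4)"
    using eventually_ge_at_top[of "real T"]
  proof eventually_elim
    case (elim u)
    have u: "0 < u" using elim T_pos' by simp
    have "u * tail u \<le> drift u"
      using tail_small[OF elim] u tails_nonneg(3)[of u] mult_nonneg_nonneg[of u "tail u"] by linarith
    also have "\<dots> \<le> drift (real T) * (u / real T) powr (1/4)"
      by (rule drift_Potter(1)) (use elim in auto)
    finally have "tail u \<le> drift (real T) * (u / real T) powr (1/4) / u"
      using u by (simp add: pos_le_divide_eq mult.commute)
    also have "\<dots> = ?c * (u powr (1/4) / u)"
      using u T_pos' by (simp add: powr_divide powr_minus_divide)
    also have "u powr (1/4) / u = u powr (-3/4)" using u powr_diff[of u "1/4" 1] by simp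
    finally show ?case using tails_nonneg(3)[of u] by simp
  qed
  have "((\<lambda>u::real. u powr (-3/4)) \<longlongrightarrow> 0) at_top"
    by (rule tendsto_neg_powr[OF _ filterlim_ident]) simp
  then show "((\<lambda>u. ?c * u powr (-3/4)) \<longlongrightarrow> 0) at_top"
    by (rule tendsto_mult_right_zero)
qed

end

text \<open>
  The moment condition makes the linear term of \<open>1 - chf t\<close> dominate the error for \<open>t \<le> 1/T\<close>; on the
  remaining compact range only the absence of zeros matters.
\<close>

locale dominated_walk = small_tails +
  assumes moment_small: "\<And>u. real T \<le> u \<Longrightarrow> 6 * clip_moment2 u \<le> u * drift u"
    and chf_neq_1: "\<And>t. 0 < t \<Longrightarrow> t \<le> pi \<Longrightarrow> chf t \<noteq> 1"
begin

lemma lower_from_drift: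
  assumes t: "0 < t" "real T \<le> 1/t"
    and z: "norm (1 - z + \<i> * complex_of_real (t * drift (1/t))) \<le> 3 * t\<^sup>2 * clip_moment2 (1/t)"
  shows "t * L (1/t) / 2 \<le> norm (1 - z)"
proof -
  have "t\<^sup>2 * (6 * clip_moment2 (1/t)) \<le> t\<^sup>2 * (1/t * drift (1/t))"
    using moment_small[OF t(2)] by (intro mult_left_mono) auto
  also have "\<dots> = t * drift (1/t)" using t by (simp add: power2_eq_square)
  finally have "3 * t\<^sup>2 * clip_moment2 (1/t) \<le> t * drift (1/t) / 2" by simp
  moreover have "norm (\<i> * complex_of_real (t * drift (1/t))) = t * drift (1/t)"
    using t drift_pos[OF t(2)] by (simp only: norm_mult norm_of_real) simp
  moreover have "norm (\<i> * complex_of_real (t * drift (1/t)))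
      \<le> norm (1 - z + \<i> * complex_of_real (t * drift (1/t))) + norm (1 - z)"
    using norm_triangle_ineq4[of "1 - z + \<i> * complex_of_real (t * drift (1/t))" "1 - z"] by simp
  ultimately show ?thesis using z L_eq[OF t(2)] by simp
qed

text \<open>
  For small \<open>t\<close> the bound comes from the expansion with the drift, on \<open>[1/T, pi]\<close> from compactness,
  where \<open>t L(1/t)\<close> is bounded because \<open>L\<close> is frozen. Clipping at \<open>N\<close> moves the characteristic
  function by at most \<open>2 tail N\<close>, which vanishes for large \<open>N\<close>.
\<close>

lemma chf_lower_bounds:
  "\<exists>c>0. \<exists>X\<ge>1. (\<forall>t. 0 < t \<and> t \<le> pi \<longrightarrow> c * (t * L (1/t)) \<le> norm (1 - chf t)) \<and>
     (\<forall>N t. X \<le> N \<and> 1/N \<le> t \<and> t \<le> pi \<longrightarrow> c * (t * L (1/t)) \<le> norm (1 - chf_clip N t))"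
proof -
  have "1 / real T \<le> 1" using T_pos' by simp
  then have T: "0 < 1 / real T" "1 / real T \<le> pi" using T_pos' pi_gt3 by (simp, linarith)
  obtain t0 where t0: "t0 \<in> {1 / real T..pi}" "\<And>t. t \<in> {1 / real T..pi} \<Longrightarrow> norm (1 - chf t0) \<le> norm (1 - chf t)"
  proof -
    have "continuous_on {1 / real T..pi} (\<lambda>t. norm (1 - chf t))"
      by (intro continuous_intros chf_continuous_on)
    then show ?thesis
      using continuous_attains_inf[of "{1 / real T..pi}" "\<lambda>t. norm (1 - chf t)"] T that by auto
  qed
  define m where "m = norm (1 - chf t0)"
  have "0 < t0" using t0(1) T(1) unfolding atLeastAtMost_iff by linarith
  then have m: "m > 0" using chf_neq_1[of t0] t0 by (simp add: m_def)
  define c where "c = min (1/2) (m / (2 * pi * drift (real T)))"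
  have D: "drift (real T) > 0" by (rule drift_pos) simp
  have c: "0 < c" using m D by (simp add: c_def)
  have small: "c * (t * L (1/t)) \<le> t * L (1/t) / 2" if "0 < t" for t
    using mult_right_mono[of c "1/2" "t * L (1/t)"] L_pos[of "1/t"] that by (simp add: c_def)
  have big: "c * (t * L (1/t)) \<le> m / 2" if "1 / real T \<le> t" "t \<le> pi" for t
  proof -
    have t: "0 < t" using that T by linarith
    have "1/t \<le> real T" using that t T_pos' by (simp add: field_simps)
    then have "L (1/t) = drift (real T)" by (simp add: L_def max_def)
    then have tL: "t * L (1/t) \<le> pi * drift (real T)" using that D by simp
    have "c * (t * L (1/t)) \<le> m / (2 * pi * drift (real T)) * (pi * drift (real T))"
    proof (rule mult_mono)
      show "c \<le> m / (2 * pi * drift (real T))" by (simp add: c_def)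
    qed (use tL t D m less_imp_le[OF L_pos[of "1/t"]] in auto)
    also have "\<dots> = m / 2" using D by simp
    finally show ?thesis .
  qed
  obtain X where X: "\<And>N. N \<ge> X \<Longrightarrow> tail N < m / 4"
    using order_tendstoD(2)[OF tail_tendsto_0, of "m/4"] m by (auto simp: eventually_at_top_linorder)
  show ?thesis
  proof (rule exI[of _ c], rule conjI, rule c, rule exI[of _ "max X 1"], intro conjI allI impI)
    fix t assume t: "0 < t \<and> t \<le> pi"
    show "c * (t * L (1/t)) \<le> norm (1 - chf t)"
    proof (cases "1 / real T \<le> t")
      case True
      then have "c * (t * L (1/t)) \<le> m / 2" "m \<le> norm (1 - chf t)"
        using big[of t] t0(2)[of t] t by (auto simp: m_def)
      then show ?thesis using m by linarith
    next
      case False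
      then have "real T \<le> 1/t" using t T_pos' by (simp add: field_simps)
      then show ?thesis
        using order.trans[OF small lower_from_drift[OF _ _ chf_drift], of t] t by auto
    qed
  next
    fix N t :: real assume t: "max X 1 \<le> N \<and> 1/N \<le> t \<and> t \<le> pi"
    then have N: "0 < N" "X \<le> N" by auto
    have "0 < 1 / N" using N by simp
    then have tp: "0 < t" using t by linarith
    then have tN: "1/t \<le> N" using t N by (simp add: field_simps)
    show "c * (t * L (1/t)) \<le> norm (1 - chf_clip N t)"
    proof (cases "1 / real T \<le> t")
      case True
      have "norm (1 - chf t) \<le> norm (1 - chf_clip N t) + norm (chf t - chf_clip N t)"
        using norm_triangle_ineq4[of "1 - chf_clip N t" "chf t - chf_clip N t"] by simp
      moreover have "c * (t * L (1/t)) \<le> m / 2" "m \<le> norm (1 - chf t)"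
        using big[of t] t0(2)[of t] True t by (auto simp: m_def)
      ultimately show ?thesis using X[OF N(2)] chf_minus_clip[of N t] N by linarith
    next
      case False
      then have "real T \<le> 1/t" using tp T_pos' by (simp add: field_simps)
      then show ?thesis
        using order.trans[OF small lower_from_drift[OF _ _ chf_clip_drift], of t N] tp tN by auto
    qed
  qed auto
qed

text \<open>
  The growth bounds turn the three terms of \<open>chf_clip_deriv_bound\<close> into multiples of \<open>L (1/t)\<close>, at the
  price of the factor \<open>(N t)\<^bsup>1/4\<^esup>\<close> from the part of the step between \<open>1/t\<close> and \<open>N\<close>.
\<close>

lemma chf_clip_deriv_upper:
  "\<exists>K>0. \<forall>N t. 0 < t \<and> 1/t \<le> N \<longrightarrow> norm (chf_clip_deriv N t) \<le> K * (L (1/t) * (N * t) powr (1/4))"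
proof -
  have D: "drift (real T) > 0" by (rule drift_pos) simp
  let ?K = "2 + 2 * real T / drift (real T) + 4 * tail_const"
  have "norm (chf_clip_deriv N t) \<le> ?K * (L (1/t) * (N * t) powr (1/4))" if t: "0 < t" "1/t \<le> N" for N t
  proof -
    let ?P = "(N * t) powr (1/4)"
    have "1 \<le> N * t" using t by (simp add: field_simps)
    then have P: "1 \<le> ?P" by (simp add: ge_one_powr_ge_zero)
    then have LP: "L (1/t) \<le> L (1/t) * ?P" using L_pos[of "1/t"] by simp
    have I: "(LBINT u:{1/t..N}. tail u) \<le> 4 * tail_const * (L (1/t) * ?P)"
      using integral_tail_le[of "1/t" N] t by (simp add: mult.assoc)
    have "norm (chf_clip_deriv N t) \<le> (2 + 2 * real T / drift (real T)) * L (1/t) + (LBINT u:{1/t..N}. tail u)"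
    proof (cases "real T \<le> 1/t")
      case True
      have "2 * t * clip_moment2 (1/t) \<le> t * (1/t * drift (1/t))"
      proof -
        have "t * (6 * clip_moment2 (1/t)) \<le> t * (1/t * drift (1/t))"
          using moment_small[OF True] t by (intro mult_left_mono) auto
        moreover have "0 \<le> t * clip_moment2 (1/t)" using t clip_moment2_nonneg by simp
        ultimately show ?thesis by linarith
      qed
      then have "2 * t * clip_moment2 (1/t) \<le> L (1/t)" using t L_eq[OF True] by simp
      moreover have "\<bar>drift (1/t)\<bar> = L (1/t)" using L_eq[OF True] L_pos[of "1/t"] by simp
      moreover have "2 * L (1/t) \<le> (2 + 2 * real T / drift (real T)) * L (1/t)"
        using L_pos[of "1/t"] D by (intro mult_right_mono) auto
      ultimately show ?thesis using chf_clip_deriv_bound[OF t] by linarith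
    next
      case False
      have N0: "0 \<le> 1/t" "0 \<le> N" using t by (auto intro: order.trans[of 0 "1/t"])
      have "(LBINT u:{0..1/t}. tail u) \<le> (LBINT u:{0..1/t}. 2)"
        by (rule set_integral_mono_le) (auto intro: set_integrable_tails tail_le_2 borel_integrable_atLeastAtMost')
      also have "\<dots> = 2 * (1/t)" using t by (simp add: set_lebesgue_integral_def)
      also have "\<dots> \<le> 2 * real T" using False by simp
      also have "\<dots> = (2 * real T / drift (real T)) * L (1/t)"
        using False D by (simp add: L_def max_def)
      also have "\<dots> \<le> (2 + 2 * real T / drift (real T)) * L (1/t)"
        using L_pos[of "1/t"] by (intro mult_right_mono) auto
      finally show ?thesis
        using chf_clip_deriv_bound_uniform[OF N0(2), of t] set_integral_split[of 0 "1/t" N tail] N0 t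
          set_integrable_tails(3) by simp
    qed
    also have "\<dots> \<le> (2 + 2 * real T / drift (real T)) * (L (1/t) * ?P) + 4 * tail_const * (L (1/t) * ?P)"
      using LP I D by (intro add_mono mult_left_mono) auto
    finally show ?thesis by (simp add: algebra_simps)
  qed
  moreover have "0 < ?K" using D tail_const_pos by (auto intro!: add_pos_pos add_pos_nonneg)
  ultimately show ?thesis by blast
qed

text \<open>
  Beyond the scale \<open>B/N\<close> the oscillation of \<open>cis (N t)\<close> is exploited by one integration by parts.
  The function \<open>1/(1 - chf)\<close> need not be differentiable, so it is first replaced by the one that
  belongs to the step clipped at \<open>N\<close>: this costs \<open>tail N\<close>, which is affordable, and the derivative
  of the clipped characteristic function is bounded by clipped first moments. The bound is of the
  order \<open>1/drift N\<close> of the main term, but decays in \<open>B\<close>.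
\<close>

lemma oscillating_integral_bound:
  "\<exists>K>0. \<exists>X\<ge>1. \<forall>N B s. X \<le> N \<and> 1 \<le> B \<and> B \<le> N \<and> \<bar>s\<bar> = 1 \<longrightarrow>
     norm (LBINT t:{B/N..pi}. cis (s * N * t) / (1 - chf t)) \<le> K * B powr (-1/2) / L N"
proof -
  obtain c X where c: "0 < c" "1 \<le> X"
    and lo: "\<And>t. 0 < t \<Longrightarrow> t \<le> pi \<Longrightarrow> c * (t * L (1/t)) \<le> norm (1 - chf t)"
    and loN: "\<And>N t. X \<le> N \<Longrightarrow> 1/N \<le> t \<Longrightarrow> t \<le> pi \<Longrightarrow> c * (t * L (1/t)) \<le> norm (1 - chf_clip N t)"
    using chf_lower_bounds by blast
  obtain K where K: "0 < K"
    "\<And>N t. 0 < t \<Longrightarrow> 1/t \<le> N \<Longrightarrow> norm (chf_clip_deriv N t) \<le> K * (L (1/t) * (N * t) powr (1/4))"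
    using chf_clip_deriv_upper by blast
  let ?K = "4 * tail_const / c\<^sup>2 + 2 / c + 2 * K / c\<^sup>2"
  have "norm (LBINT t:{B/N..pi}. cis (s * N * t) / (1 - chf t)) \<le> ?K * B powr (-1/2) / L N"
    if NB: "X \<le> N" "1 \<le> B" "B \<le> N" "\<bar>s\<bar> = 1" for N B s
  proof -
    let ?b = "B / N"
    have N: "1 \<le> N" "0 < N" "0 < B" using NB c by auto
    have b: "1/N \<le> ?b" "0 < ?b" "?b \<le> pi"
    proof -
      have "?b \<le> 1" using NB N by simp
      then show "?b \<le> pi" using pi_gt3 by linarith
    qed (use NB N in \<open>auto simp: divide_right_mono\<close>)
    have t: "0 < t" "1/N \<le> t" "t \<le> pi" "1/t \<le> N" "B \<le> N * t" if "t \<in> {?b..pi}" for t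
    proof -
      show "0 < t" "1/N \<le> t" "t \<le> pi" using that b by auto
      then show "1/t \<le> N" "B \<le> N * t" using that N by (auto simp: field_simps)
    qed
    define h where "h = (\<lambda>t. 1 / (1 - chf t))"
    define g where "g = (\<lambda>t. 1 / (1 - chf_clip N t))"
    define g' where "g' = (\<lambda>t. chf_clip_deriv N t / (1 - chf_clip N t)\<^sup>2)"
    have inv: "1 / (c * (t * L (1/t))) \<le> (N * t) powr (1/4) / (c * t * L N)" "0 < c * (t * L (1/t))"
      if "t \<in> {?b..pi}" for t
    proof -
      note t = t[OF that]
      show *: "0 < c * (t * L (1/t))" using c t L_pos by simp
      have "L N \<le> L (1/t) * (N / (1/t)) powr (1/4)" by (rule L_Potter(1)) (use t in auto)
      then have "c * t * L N \<le> c * t * (L (1/t) * (N * t) powr (1/4))"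
        using c t by (intro mult_left_mono) auto
      then show "1 / (c * (t * L (1/t))) \<le> (N * t) powr (1/4) / (c * t * L N)"
        using c t L_pos[of N] L_pos[of "1/t"] by (simp add: divide_simps mult.commute mult.left_commute)
    qed
    have sq: "(1 / (c * (t * L (1/t))))\<^sup>2 \<le> N powr (1/2) * t powr (-3/2) / (c\<^sup>2 * (L N)\<^sup>2)" if "t \<in> {?b..pi}" for t
    proof -
      note t' = t[OF that]
      have "(1 / (c * (t * L (1/t))))\<^sup>2 \<le> ((N * t) powr (1/4) / (c * t * L N))\<^sup>2"
        using inv[OF that] by (intro power_mono) auto
      also have "\<dots> = ((N * t) powr (1/4))\<^sup>2 / t\<^sup>2 / (c\<^sup>2 * (L N)\<^sup>2)"
        by (simp add: power_divide power_mult_distrib)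
      also have "((N * t) powr (1/4))\<^sup>2 / t\<^sup>2 = N powr (1/2) * t powr (-3/2)"
      proof -
        have "((N * t) powr (1/4))\<^sup>2 = N powr (1/2) * t powr (1/2)"
          using N t' by (simp add: power2_eq_square powr_mult powr_add[symmetric] mult.commute mult.left_commute)
        moreover have "t powr (1/2) / t\<^sup>2 = t powr (-3/2)"
          using t' powr_diff[of t "1/2" 2] by (simp add: powr_numeral)
        ultimately show ?thesis by (metis times_divide_eq_right)
      qed
      finally show ?thesis .
    qed
    have nz: "1 - chf t \<noteq> 0" "1 - chf_clip N t \<noteq> 0" if "t \<in> {?b..pi}" for t
      using inv(2)[OF that] lo[of t] loN[OF NB(1), of t] t[OF that] by auto
    have nh: "norm (h t) \<le> 1 / (c * (t * L (1/t)))" "norm (g t) \<le> 1 / (c * (t * L (1/t)))" if "t \<in> {?b..pi}" for t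
      using inv(2)[OF that] lo[of t] loN[OF NB(1), of t] t[OF that]
      by (auto simp: h_def g_def norm_divide intro!: divide_left_mono mult_pos_pos)
    have cc: "continuous_on {?b..pi} (chf_clip N)"
      using chf_clip_has_derivative[of N] N
      by (intro continuous_at_imp_continuous_on) (auto intro: has_vector_derivative_continuous)
    have contg: "continuous_on {?b..pi} g" "continuous_on {?b..pi} h" "continuous_on {?b..pi} g'"
      unfolding g_def h_def g'_def using nz N
      by (auto intro!: continuous_intros cc chf_continuous_on chf_clip_deriv_continuous_on)
    have conte: "continuous_on {?b..pi} (\<lambda>t. cis (s * N * t))"
      by (intro continuous_intros)
    have int: "set_integrable lborel {?b..pi} (\<lambda>t. cis (s * N * t) * f t)" if "continuous_on {?b..pi} f" for f
      by (intro borel_integrable_atLeastAtMost' continuous_on_mult conte that)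
    \<comment> \<open>The integrands below are bounded by constant multiples of \<open>t powr (-3/2)\<close>, whose mass beyond \<open>B/N\<close> is of order \<open>(N/B) powr (1/2)\<close>.\<close>
    let ?J = "LBINT t:{?b..pi}. t powr (-3/2)"
    have J: "?J \<le> 2 * (B powr (-1/2) * N powr (1/2))"
    proof -
      have "?J = 2 * ?b powr (-1/2) - 2 * pi powr (-1/2)"
        using set_integral_powr(1)[of ?b pi "-3/2"] b by simp
      moreover have "?b powr (-1/2) = B powr (-1/2) * N powr (1/2)"
        using N by (simp add: powr_divide powr_minus_divide)
      ultimately show ?thesis by simp
    qed
    have intJ: "set_integrable lborel {?b..pi} (\<lambda>t. C * t powr (-3/2))" for C
      using set_integral_powr(2)[of ?b pi "-3/2"] b by (intro set_integrable_mult_right) auto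
    have scale: "(LBINT t:{?b..pi}. C * t powr (-3/2)) \<le> C * (2 * (B powr (-1/2) * N powr (1/2)))" if "0 \<le> C" for C
      using J that by (simp add: mult_left_mono)
    have NN: "N powr (1/2) * N powr (1/2) = N" using N by (simp add: powr_add[symmetric])
    \<comment> \<open>Replacing the characteristic function by the clipped one costs \<open>2 tail N\<close>, and \<open>N tail N\<close> is at most a multiple of \<open>L N\<close>.\<close>
    have 1: "norm (LBINT t:{?b..pi}. cis (s * N * t) * (h t - g t)) \<le> 4 * tail_const / c\<^sup>2 * B powr (-1/2) / L N"
    proof -
      let ?C = "2 * tail N * N powr (1/2) / (c\<^sup>2 * (L N)\<^sup>2)"
      have "norm (LBINT t:{?b..pi}. cis (s * N * t) * (h t - g t)) \<le> (LBINT t:{?b..pi}. ?C * t powr (-3/2))"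
      proof (rule norm_set_integral_le[OF int intJ])
        show "continuous_on {?b..pi} (\<lambda>t. h t - g t)" by (intro continuous_intros contg)
        fix t assume tb: "t \<in> {?b..pi}"
        have "h t - g t = (chf t - chf_clip N t) * (h t * g t)"
          using nz[OF tb] by (simp add: h_def g_def field_simps)
        then have "norm (cis (s * N * t) * (h t - g t)) = norm (chf t - chf_clip N t) * (norm (h t) * norm (g t))"
          by (simp add: norm_mult)
        also have "\<dots> \<le> (2 * tail N) * ((1 / (c * (t * L (1/t)))) * (1 / (c * (t * L (1/t)))))"
          using nh[OF tb] chf_minus_clip[of N t] N tails_nonneg(3)[of N] inv(2)[OF tb] by (intro mult_mono) auto
        also have "\<dots> \<le> (2 * tail N) * (N powr (1/2) * t powr (-3/2) / (c\<^sup>2 * (L N)\<^sup>2))"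
          using sq[OF tb] tails_nonneg(3)[of N] by (intro mult_left_mono) (auto simp: power2_eq_square)
        finally show "norm (cis (s * N * t) * (h t - g t)) \<le> ?C * t powr (-3/2)" by simp
      qed
      also have "\<dots> \<le> ?C * (2 * (B powr (-1/2) * N powr (1/2)))"
        by (rule scale) (use tails_nonneg in auto)
      also have "\<dots> = 4 * (N powr (1/2) * N powr (1/2) * tail N) / (c\<^sup>2 * (L N)\<^sup>2) * B powr (-1/2)"
        by simp
      also have "\<dots> \<le> 4 * (tail_const * L N) / (c\<^sup>2 * (L N)\<^sup>2) * B powr (-1/2)"
        unfolding NN using tail_le_L[of N] N by (intro mult_right_mono divide_right_mono) auto
      also have "\<dots> = 4 * tail_const / c\<^sup>2 * B powr (-1/2) / L N"
        using L_pos[of N] by (simp add: power2_eq_square)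
      finally show ?thesis .
    qed
    \<comment> \<open>A primitive of the clipped integrand, up to the term with \<open>g'\<close>.\<close>
    define G where "G = (\<lambda>t. cis (s * N * t) * g t / (\<i> * complex_of_real (s * N)))"
    have sN: "complex_of_real (s * N) \<noteq> 0" "norm (complex_of_real (s * N)) = N"
      using NB N by (auto simp: abs_mult norm_mult)
    have "(LBINT t:{?b..pi}. cis (s * N * t) * g t + cis (s * N * t) * g' t / (\<i> * complex_of_real (s * N))) = G pi - G ?b"
    proof (rule set_integral_FTC[where S="{}"])
      fix t assume "t \<in> {?b<..<pi} - {}"
      then have tb: "t \<in> {?b..pi}" by auto
      have d1: "((\<lambda>t. cis (s * N * t)) has_vector_derivative \<i> * complex_of_real (s * N) * cis (s * N * t)) (at t)"
      proof -
        have "((\<lambda>t. complex_of_real (s * N * t)) has_vector_derivative complex_of_real (s * N)) (at t)"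
          by (rule has_vector_derivative_of_real) (auto intro!: derivative_eq_intros)
        then have "((\<lambda>t. \<i> * complex_of_real (s * N * t)) has_vector_derivative \<i> * complex_of_real (s * N)) (at t)"
          by (rule has_vector_derivative_mult_right)
        from field_vector_diff_chain_at[OF this DERIV_exp]
        show ?thesis by (simp add: o_def cis_conv_exp)
      qed
      have d2: "(g has_vector_derivative g' t) (at t)"
      proof -
        have "((\<lambda>z. 1 / (1 - z)) has_field_derivative 1 / (1 - chf_clip N t)\<^sup>2) (at (chf_clip N t))"
          using nz(2)[OF tb] by (auto intro!: derivative_eq_intros simp: power2_eq_square)
        from field_vector_diff_chain_at[OF chf_clip_has_derivative this] N
        show ?thesis by (simp add: o_def g_def g'_def)
      qed
      show "(G has_vector_derivative cis (s * N * t) * g t + cis (s * N * t) * g' t / (\<i> * complex_of_real (s * N))) (at t)"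
        unfolding G_def
        using has_vector_derivative_divide[OF has_vector_derivative_mult[OF d1 d2], of "\<i> * complex_of_real (s * N)"] sN
        by (simp add: field_simps)
    next
      show "continuous_on {?b..pi} G" unfolding G_def
        using sN by (intro continuous_intros conte contg) auto
      show "set_integrable lborel {?b..pi} (\<lambda>t. cis (s * N * t) * g t + cis (s * N * t) * g' t / (\<i> * complex_of_real (s * N)))"
        by (intro borel_integrable_atLeastAtMost' continuous_intros conte contg) (use sN in auto)
    qed (use b in auto)
    then have parts: "(LBINT t:{?b..pi}. cis (s * N * t) * g t)
       = G pi - G ?b - (LBINT t:{?b..pi}. cis (s * N * t) * g' t) / (\<i> * complex_of_real (s * N))"
      using set_integral_add(2)[OF int[OF contg(1)], of "\<lambda>t. cis (s * N * t) * g' t / (\<i> * complex_of_real (s * N))"]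
        int[OF contg(3)] by simp
    have Gb: "norm (G t) \<le> 1 / c * B powr (-1/2) / L N" if "t \<in> {?b..pi}" for t
    proof -
      note t' = t[OF that]
      have "norm (G t) = norm (g t) / N" unfolding G_def using sN(2) by (simp only: norm_divide norm_mult norm_cis) simp
      also have "\<dots> \<le> (N * t) powr (1/4) / (c * t * L N) / N"
        using nh(2)[OF that] inv(1)[OF that] N by (intro divide_right_mono) auto
      also have "\<dots> = (N * t) powr (1/4) / (N * t) / (c * L N)" by simp
      also have "(N * t) powr (1/4) / (N * t) = (N * t) powr (-3/4)"
        using N t' powr_diff[of "N * t" "1/4" 1] by simp
      also have "(N * t) powr (-3/4) \<le> B powr (-1/2)"
      proof -
        have "(N * t) powr (-3/4) \<le> (N * t) powr (-1/2)" using t' NB by (intro powr_mono) auto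
        also have "\<dots> \<le> B powr (-1/2)" using t' N by (intro powr_mono2') auto
        finally show ?thesis .
      qed
      finally show ?thesis using c L_pos[of N] by (simp add: divide_right_mono)
    qed
    have 2: "norm (LBINT t:{?b..pi}. cis (s * N * t) * g' t) \<le> N * (2 * K / c\<^sup>2 * B powr (-1/2) / L N)"
    proof -
      let ?C = "K * N powr (1/2) / (c\<^sup>2 * L N)"
      have "norm (LBINT t:{?b..pi}. cis (s * N * t) * g' t) \<le> (LBINT t:{?b..pi}. ?C * t powr (-3/2))"
      proof (rule norm_set_integral_le[OF int[OF contg(3)] intJ])
        fix t assume tb: "t \<in> {?b..pi}"
        note t' = t[OF tb]
        have "norm (cis (s * N * t) * g' t) = norm (chf_clip_deriv N t) * (norm (g t))\<^sup>2"
          by (simp add: g'_def g_def norm_mult norm_divide norm_power power_divide)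
        also have "\<dots> \<le> (K * (L (1/t) * (N * t) powr (1/4))) * (1 / (c * (t * L (1/t))))\<^sup>2"
          using K(2)[of t N] nh(2)[OF tb] t' K(1) L_pos[of "1/t"] by (intro mult_mono power_mono) auto
        also have "\<dots> = K * (N * t) powr (1/4) / (c * t) * (1 / (c * (t * L (1/t))))"
          using L_pos[of "1/t"] c t' by (simp add: power2_eq_square)
        also have "\<dots> \<le> K * (N * t) powr (1/4) / (c * t) * ((N * t) powr (1/4) / (c * t * L N))"
          using inv(1)[OF tb] K(1) c t' by (intro mult_left_mono) auto
        also have "\<dots> = K * (((N * t) powr (1/4) * (N * t) powr (1/4)) / t\<^sup>2) / (c\<^sup>2 * L N)"
          by (simp add: power2_eq_square mult_ac)
        also have "((N * t) powr (1/4) * (N * t) powr (1/4)) / t\<^sup>2 = N powr (1/2) * t powr (-3/2)"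
        proof -
          have "(N * t) powr (1/4) * (N * t) powr (1/4) = N powr (1/2) * t powr (1/2)"
            using N t' by (simp add: powr_add[symmetric] powr_mult[symmetric])
          moreover have "t powr (1/2) / t\<^sup>2 = t powr (-3/2)"
            using t' powr_diff[of t "1/2" 2] by (simp add: powr_numeral)
          ultimately show ?thesis by (metis times_divide_eq_right)
        qed
        finally show "norm (cis (s * N * t) * g' t) \<le> ?C * t powr (-3/2)" by simp
      qed
      also have "\<dots> \<le> ?C * (2 * (B powr (-1/2) * N powr (1/2)))"
        by (rule scale) (use K L_pos[of N] in auto)
      also have "\<dots> = (N powr (1/2) * N powr (1/2)) * (2 * K / c\<^sup>2 * B powr (-1/2) / L N)"
        by simp
      finally show ?thesis unfolding NN .
    qed
    have 3: "norm (LBINT t:{?b..pi}. cis (s * N * t) * g t) \<le> (2 / c + 2 * K / c\<^sup>2) * B powr (-1/2) / L N"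
    proof -
      have "norm (LBINT t:{?b..pi}. cis (s * N * t) * g t)
        \<le> norm (G pi) + norm (G ?b) + norm ((LBINT t:{?b..pi}. cis (s * N * t) * g' t) / (\<i> * complex_of_real (s * N)))"
        unfolding parts by (intro order.trans[OF norm_triangle_ineq4] add_mono order_refl)
      also have "norm ((LBINT t:{?b..pi}. cis (s * N * t) * g' t) / (\<i> * complex_of_real (s * N)))
         = norm (LBINT t:{?b..pi}. cis (s * N * t) * g' t) / N"
        using sN(2) by (simp only: norm_divide norm_mult) simp
      also have "\<dots> \<le> 2 * K / c\<^sup>2 * B powr (-1/2) / L N"
        using 2 N by (simp add: divide_le_eq mult.commute)
      also have "norm (G pi) + norm (G ?b) \<le> 1 / c * B powr (-1/2) / L N + 1 / c * B powr (-1/2) / L N"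
        using b by (intro add_mono Gb) auto
      finally show ?thesis by (simp add: algebra_simps add_divide_distrib)
    qed
    have "(LBINT t:{?b..pi}. cis (s * N * t) / (1 - chf t))
        = (LBINT t:{?b..pi}. cis (s * N * t) * (h t - g t) + cis (s * N * t) * g t)"
      by (simp add: h_def algebra_simps)
    also have "\<dots> = (LBINT t:{?b..pi}. cis (s * N * t) * (h t - g t)) + (LBINT t:{?b..pi}. cis (s * N * t) * g t)"
      by (rule set_integral_add(2)) (auto intro!: int continuous_intros contg)
    finally show ?thesis using norm_triangle_le[OF add_mono[OF 1 3]] by (simp add: algebra_simps add_divide_distrib)
  qed
  moreover have "0 < ?K" using c K tail_const_pos by (auto intro!: add_pos_pos)
  ultimately show ?thesis using c by blast
qed

end

section \<open>The Fourier integral at the scale of the oscillation\<close>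

lemma set_integrable_powr_0:
  fixes a b :: real
  assumes "a > -1" "b \<ge> 0"
  shows "set_integrable lborel {0..b} (\<lambda>t. t powr a)"
proof -
  have "(\<lambda>t. t powr a) integrable_on {0..b}" using assms by (rule integrable_on_powr_from_0)
  then have "(\<lambda>t. t powr a) absolutely_integrable_on {0..b}"
    by (rule nonnegative_absolutely_integrable_1) auto
  then show ?thesis unfolding set_integrable_def
    by (subst (asm) integrable_completion) auto
qed

lemma set_integral_rescale:
  fixes f :: "real \<Rightarrow> real"
  assumes "0 < N"
  shows "(LBINT t:{0..B/N}. f t) = (LBINT y:{0..B}. f (y / N)) / N"
proof -
  have "(LBINT t:{0..B/N}. f t) = \<bar>1/N\<bar> *\<^sub>R (LBINT y. indicator {0..B/N} (0 + 1/N * y) *\<^sub>R f (0 + 1/N * y))"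
    unfolding set_lebesgue_integral_def
    by (rule lborel_integral_real_affine) (use assms in auto)
  also have "(\<lambda>y. indicator {0..B/N} (0 + 1/N * y) *\<^sub>R f (0 + 1/N * y))
      = (\<lambda>y. indicator {0..B} y *\<^sub>R f (y / N))"
    using assms by (auto simp: indicator_def divide_le_cancel fun_eq_iff zero_le_divide_iff)
  finally show ?thesis using assms by (simp add: set_lebesgue_integral_def)
qed

lemma set_integrable_Re:
  fixes f :: "real \<Rightarrow> complex"
  assumes "set_integrable M S f"
  shows "set_integrable M S (\<lambda>x. Re (f x))" "(LINT x:S|M. Re (f x)) = Re (LINT x:S|M. f x)"
proof -
  have i: "integrable M (\<lambda>x. indicator S x *\<^sub>R f x)" using assms by (simp add: set_integrable_def)
  show "set_integrable M S (\<lambda>x. Re (f x))"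
    using integrable_Re[OF i] by (simp add: set_integrable_def)
  show "(LINT x:S|M. Re (f x)) = Re (LINT x:S|M. f x)"
    using integral_Re[OF i] by (simp add: set_lebesgue_integral_def)
qed

context dominated_walk begin

definition resolvent :: "real \<Rightarrow> complex" where "resolvent t = 1 / (1 - chf t)"

lemma resolvent_measurable [measurable]: "resolvent \<in> borel_measurable borel"
  unfolding resolvent_def by measurable

lemma resolvent_continuous_on: "0 < a \<Longrightarrow> b \<le> pi \<Longrightarrow> continuous_on {a..b} resolvent"
  unfolding resolvent_def using chf_neq_1
  by (intro continuous_intros chf_continuous_on) force

lemma resolvent_bound:
  "\<exists>C>0. (\<forall>t. 0 < t \<and> t \<le> pi \<longrightarrow> norm (resolvent t) \<le> C / (t * L (1/t)))"
proof -
  obtain c where c: "c > 0" "\<And>t. 0 < t \<Longrightarrow> t \<le> pi \<Longrightarrow> c * (t * L (1/t)) \<le> norm (1 - chf t)"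
    using chf_lower_bounds by blast
  have "norm (resolvent t) \<le> (1 / c) / (t * L (1/t))" if "0 < t" "t \<le> pi" for t
  proof -
    have "0 < c * (t * L (1/t))" using that c L_pos by simp
    then have "1 / norm (1 - chf t) \<le> 1 / (c * (t * L (1/t)))"
      using c(2)[OF that] by (intro frac_le) auto
    then show ?thesis by (simp add: resolvent_def norm_divide)
  qed
  then show ?thesis using c(1) by (intro exI[of _ "1/c"]) auto
qed

text \<open>
  Near zero the numerator is \<open>O(t)\<close> and the resolvent at most a multiple of \<open>1/(t L(1/t))\<close>; by the growth
  bound their product is at most a multiple of the integrable \<open>t\<^bsup>-1/4\<^esup>\<close>.
\<close>

lemma potential_integrable:
  "set_integrable lborel {0..pi} (\<lambda>t. (1 - cis (x * t)) * resolvent t)"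
proof -
  obtain C where C: "C > 0" "\<And>t. 0 < t \<Longrightarrow> t \<le> pi \<Longrightarrow> norm (resolvent t) \<le> C / (t * L (1/t))"
    using resolvent_bound by blast
  let ?D = "\<bar>x\<bar> * C * pi powr (1/4) / L (1/pi)"
  have bound: "norm ((1 - cis (x * t)) * resolvent t) \<le> ?D * t powr (-1/4)" if t: "t \<in> {0..pi}" for t
  proof (cases "t = 0")
    case False
    then have t: "0 < t" "t \<le> pi" using t by auto
    have "L (1/pi) \<le> L (1/t) * ((1/t) / (1/pi)) powr (1/4)"
      by (rule L_Potter(2)) (use t in \<open>auto simp: frac_le\<close>)
    also have "((1/t) / (1/pi)) powr (1/4) = pi powr (1/4) * t powr (-1/4)"
      using t by (simp add: powr_divide powr_minus_divide)
    finally have "1 / L (1/t) \<le> pi powr (1/4) * t powr (-1/4) / L (1/pi)"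
      using L_pos[of "1/t"] L_pos[of "1/pi"] by (simp add: divide_simps mult.commute)
    then have "\<bar>x\<bar> * C * (1 / L (1/t)) \<le> \<bar>x\<bar> * C * (pi powr (1/4) * t powr (-1/4) / L (1/pi))"
      using C(1) by (intro mult_left_mono) auto
    moreover have "norm ((1 - cis (x * t)) * resolvent t) \<le> \<bar>x * t\<bar> * (C / (t * L (1/t)))"
      unfolding norm_mult using norm_cis_minus_1[of "x * t"] C(2)[OF t]
      by (intro mult_mono) (auto simp: norm_minus_commute)
    moreover have "\<bar>x * t\<bar> * (C / (t * L (1/t))) = \<bar>x\<bar> * C * (1 / L (1/t))"
      using t by (simp add: abs_mult)
    ultimately show ?thesis by simp
  qed simp
  have "set_integrable lborel {0..pi} (\<lambda>t. ?D * t powr (-1/4))"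
    by (intro set_integrable_mult_right set_integrable_powr_0) auto
  then show ?thesis unfolding set_integrable_def
  proof (rule Bochner_Integration.integrable_bound)
    show "(\<lambda>t. indicat_real {0..pi} t *\<^sub>R ((1 - cis (x * t)) * resolvent t)) \<in> borel_measurable lborel"
      by (simp add: cis_conv_exp)
    show "AE t in lborel. norm (indicat_real {0..pi} t *\<^sub>R ((1 - cis (x * t)) * resolvent t))
        \<le> norm (indicat_real {0..pi} t *\<^sub>R (?D * t powr (-1/4)))"
    proof (rule AE_I2)
      fix t
      show "norm (indicat_real {0..pi} t *\<^sub>R ((1 - cis (x * t)) * resolvent t))
        \<le> norm (indicat_real {0..pi} t *\<^sub>R (?D * t powr (-1/4)))"
      proof (cases "t \<in> {0..pi}")
        case True
        then show ?thesis
          using order.trans[OF bound[OF True] abs_ge_self]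
          by (simp only: indicator_simps scaleR_one real_norm_def)
      qed simp
    qed
  qed
qed

text \<open>
  At the frequency \<open>y/N\<close> the expansion reads \<open>1 - chf (y/N) = -i (y/N) drift (N/y) + o(...)\<close>, and
  \<open>drift (N/y)\<close> may be replaced by \<open>drift N\<close>.
\<close>

lemma resolvent_scaling_limit:
  assumes y: "0 < y"
  shows "((\<lambda>N. complex_of_real (drift N / N) * resolvent (y / N)) \<longlongrightarrow> \<i> / complex_of_real y) at_top"
proof -
  have lim: "filterlim (\<lambda>N. N / y) at_top at_top"
    using filterlim_tendsto_pos_mult_at_top[OF tendsto_const[of "inverse y"] _ filterlim_ident] y
    by (simp add: field_simps)
  have r: "((\<lambda>N. drift (N / y) / drift N) \<longlongrightarrow> 1) at_top"
    using drift_slowly_varying[of "1/y"] y by simp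
  have v: "((\<lambda>N. clip_moment2 (N / y) / ((N / y) * drift (N / y))) \<longlongrightarrow> 0) at_top"
    by (rule filterlim_compose[OF clip_moment2_little lim])
  have e: "((\<lambda>N. complex_of_real (N / drift N) * (1 - chf (y / N))
      + \<i> * complex_of_real (y * (drift (N / y) / drift N))) \<longlongrightarrow> 0) at_top"
  proof (rule Lim_null_comparison)
    show "\<forall>\<^sub>F N in at_top. norm (complex_of_real (N / drift N) * (1 - chf (y / N))
        + \<i> * complex_of_real (y * (drift (N / y) / drift N)))
      \<le> 3 * y * (drift (N / y) / drift N) * (clip_moment2 (N / y) / ((N / y) * drift (N / y)))"
      using eventually_ge_at_top[of "real T"] eventually_ge_at_top[of "real T * y"]
    proof eventually_elim
      case (elim N)
      have N: "0 < N" "0 < drift N" using elim T_pos' drift_pos by auto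
      have "real T \<le> N / y" using elim y by (simp add: pos_le_divide_eq)
      then have D: "0 < drift (N / y)" by (rule drift_pos)
      have "complex_of_real (N / drift N) * (1 - chf (y / N)) + \<i> * complex_of_real (y * (drift (N / y) / drift N))
         = complex_of_real (N / drift N) * (1 - chf (y / N) + \<i> * complex_of_real (y / N * drift (1 / (y / N))))"
        using N y by (simp add: field_simps)
      then have "norm (complex_of_real (N / drift N) * (1 - chf (y / N)) + \<i> * complex_of_real (y * (drift (N / y) / drift N)))
         = (N / drift N) * norm (1 - chf (y / N) + \<i> * complex_of_real (y / N * drift (1 / (y / N))))"
        using N by (simp only: norm_mult norm_of_real) simp
      also have "\<dots> \<le> (N / drift N) * (3 * (y / N)\<^sup>2 * clip_moment2 (1 / (y / N)))"
        by (rule mult_left_mono[OF chf_drift]) (use N y in auto)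
      also have "\<dots> = 3 * y * (drift (N / y) / drift N) * (clip_moment2 (N / y) / ((N / y) * drift (N / y)))"
        using N y D by (simp add: power2_eq_square)
      finally show ?case .
    qed
    show "((\<lambda>N. 3 * y * (drift (N / y) / drift N) * (clip_moment2 (N / y) / ((N / y) * drift (N / y)))) \<longlongrightarrow> 0) at_top"
      using tendsto_mult[OF tendsto_mult[OF tendsto_const r] v, of "3 * y"] by simp
  qed
  have "((\<lambda>N. (complex_of_real (N / drift N) * (1 - chf (y / N))
      + \<i> * complex_of_real (y * (drift (N / y) / drift N))) - \<i> * complex_of_real (y * (drift (N / y) / drift N)))
     \<longlongrightarrow> 0 - \<i> * complex_of_real (y * 1)) at_top"
    by (intro tendsto_intros e r)
  then have "((\<lambda>N. complex_of_real (N / drift N) * (1 - chf (y / N))) \<longlongrightarrow> - (\<i> * complex_of_real y)) at_top"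
    by simp
  then have "((\<lambda>N. inverse (complex_of_real (N / drift N) * (1 - chf (y / N)))) \<longlongrightarrow> inverse (- (\<i> * complex_of_real y))) at_top"
    using y by (intro tendsto_inverse) auto
  moreover have "inverse (- (\<i> * complex_of_real y)) = \<i> / complex_of_real y"
    by (simp add: divide_inverse)
  moreover have "inverse (complex_of_real (N / drift N) * (1 - chf (y / N)))
       = complex_of_real (drift N / N) * resolvent (y / N)" for N
    by (simp add: resolvent_def divide_inverse)
  ultimately show ?thesis by simp
qed

text \<open>
  After the substitution \<open>t = y/N\<close> this is dominated convergence. The indicator removes the real part
  of the resolvent above \<open>1/N\<close>, which is treated separately; its presence also keeps the factor in
  front of the resolvent bounded by one for \<open>y > 1\<close>. The growth bounds for \<open>L\<close> dominate the integrand
  by a multiple of \<open>y\<^bsup>-1/4\<^esup>\<close>, and in the limit the resolvent becomes \<open>i/y\<close>, which leaves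
  \<open>sin (s y) / y\<close>.
\<close>

lemma near_part_limit:
  assumes B: "1 \<le> B" and s: "\<bar>s\<bar> = 1"
  shows "((\<lambda>N. drift N * (LBINT t:{0..B/N}. Re ((1 - cis (s * N * t) - of_bool (1/N < t)) * resolvent t)))
            \<longlongrightarrow> s * Si B) at_top"
proof -
  obtain C where C: "C > 0" "\<And>t. 0 < t \<Longrightarrow> t \<le> pi \<Longrightarrow> norm (resolvent t) \<le> C / (t * L (1/t))"
    using resolvent_bound by blast
  let ?z = "\<lambda>y. 1 - cis (s * y) - of_bool (1 < y)"
  let ?f = "\<lambda>N y. indicator {0..B} y *\<^sub>R Re (?z y * (complex_of_real (drift N / N) * resolvent (y / N)))"
  have "((\<lambda>N. LBINT y. ?f N y) \<longlongrightarrow> (LBINT y. indicator {0..B} y *\<^sub>R (s * sinc y))) at_top"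
  proof (rule integral_dominated_convergence_at_top)
    show "integrable lborel (\<lambda>y. indicator {0..B} y *\<^sub>R (C * y powr (-1/4)))"
      using set_integrable_mult_right[OF set_integrable_powr_0[of "-1/4" B], of C] B
      by (simp add: set_integrable_def)
    show "AE y in lborel. ((\<lambda>N. ?f N y) \<longlongrightarrow> indicator {0..B} y *\<^sub>R (s * sinc y)) at_top"
      using AE_lborel_singleton[of 0]
    proof eventually_elim
      case (elim y)
      show ?case
      proof (cases "y \<in> {0..B}")
        case True
        then have y: "0 < y" using elim by auto
        have "((\<lambda>N. Re (?z y * (complex_of_real (drift N / N) * resolvent (y / N))))
            \<longlongrightarrow> Re (?z y * (\<i> / complex_of_real y))) at_top"
          by (intro tendsto_intros resolvent_scaling_limit y)
        moreover have "Re (?z y * (\<i> / complex_of_real y)) = sin (s * y) / y"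
          using y by (auto simp: Re_divide power2_eq_square field_simps of_bool_def)
        moreover have "sin (s * y) / y = s * sinc y"
          using s elim by (cases "s = 1") (auto simp: abs_if split: if_splits)
        ultimately show ?thesis using True by simp
      qed simp
    qed
    show "\<forall>\<^sub>F N in at_top. AE y in lborel. norm (?f N y) \<le> indicator {0..B} y *\<^sub>R (C * y powr (-1/4))"
      using eventually_ge_at_top[of "real T"] eventually_ge_at_top[of B]
    proof eventually_elim
      case (elim N)
      have N: "0 < N" "0 < drift N" "L N = drift N" using elim T_pos' drift_pos L_eq by auto
      show ?case
        using AE_lborel_singleton[of 0]
      proof eventually_elim
        case (elim y)
        show ?case
        proof (cases "y \<in> {0..B}")
          case True
          then have y: "0 < y" "y \<le> B" using elim by auto
          have "y / N \<le> 1" using y \<open>B \<le> N\<close> N by simp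
          then have yN: "0 < y / N" "y / N \<le> pi" using y N pi_gt3 by (simp, linarith)
          have z: "norm (?z y) \<le> (if y \<le> 1 then y else 1)"
            using norm_cis_minus_1[of "s * y"] s y by (auto simp: norm_minus_commute abs_mult)
          have "norm (?z y) * L N \<le> y powr (3/4) * L (N / y)"
          proof (cases "y \<le> 1")
            case True
            have "L N \<le> L (N / y) * ((N / y) / N) powr (1/4)"
              by (rule L_Potter(2)) (use N y True in \<open>auto simp: pos_le_divide_eq\<close>)
            also have "\<dots> = L (N / y) * y powr (-1/4)"
              using N y by (simp add: powr_divide powr_minus_divide)
            finally have "norm (?z y) * L N \<le> y * (L (N / y) * y powr (-1/4))"
              using z True y L_pos by (intro mult_mono) (auto simp: less_imp_le)
            also have "\<dots> = (y powr 1 * y powr (-1/4)) * L (N / y)" using y by simp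
            finally show ?thesis by (simp only: powr_add[symmetric]) simp
          next
            case False
            have "L N \<le> L (N / y) * (N / (N / y)) powr (1/4)"
              by (rule L_Potter(1)) (use N y False in \<open>auto simp: divide_le_eq\<close>)
            also have "\<dots> = y powr (1/4) * L (N / y)" using N y by simp
            also have "\<dots> \<le> y powr (3/4) * L (N / y)"
              using y False L_pos[of "N / y"] by (intro mult_right_mono powr_mono) auto
            finally show ?thesis using z False L_pos[of N] mult_right_mono[of "norm (?z y)" 1 "L N"] by auto
          qed
          then have "norm (?z y) * L N * (C / (y * L (N / y))) \<le> y powr (3/4) * L (N / y) * (C / (y * L (N / y)))"
            using y C(1) L_pos[of "N / y"] by (intro mult_right_mono) auto
          also have "\<dots> = C * (y powr (3/4) / y)" using L_pos[of "N / y"] by simp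
          also have "y powr (3/4) / y = y powr (-1/4)" using y powr_diff[of y "3/4" 1] by simp
          finally have *: "norm (?z y) * L N * (C / (y * L (N / y))) \<le> C * y powr (-1/4)" .
          have "norm (?f N y) = \<bar>Re (?z y * (complex_of_real (drift N / N) * resolvent (y / N)))\<bar>"
            using True by (simp only: indicator_simps scaleR_one real_norm_def)
          also have "\<dots> \<le> norm (?z y * (complex_of_real (drift N / N) * resolvent (y / N)))"
            by (rule abs_Re_le_cmod)
          also have "\<dots> = norm (?z y) * (drift N / N * norm (resolvent (y / N)))"
            using N by (simp only: norm_mult norm_of_real) simp
          also have "\<dots> \<le> norm (?z y) * (drift N / N * (C / (y / N * L (1 / (y / N)))))"
            using N by (intro mult_left_mono C(2) yN) auto
          also have "\<dots> = norm (?z y) * L N * (C / (y * L (N / y)))"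
            using N y by (simp add: field_simps)
          also note *
          finally show ?thesis using True by simp
        qed simp
      qed
    qed
  qed (auto simp: cis_conv_exp)
  moreover have "(LBINT y. indicator {0..B} y *\<^sub>R (s * sinc y)) = s * Si B"
  proof -
    have "(LBINT y. indicator {0..B} y *\<^sub>R (s * sinc y)) = (LBINT y:{0..B}. s * sinc y)"
      by (simp only: set_lebesgue_integral_def)
    also have "\<dots> = s * (LBINT y:{0..B}. sinc y)" by (rule set_integral_mult_right)
    also have "(LBINT y:{0..B}. sinc y) = Si B"
      using B interval_integral_Icc[of 0 B sinc] by (simp add: Si_alt_def zero_ereal_def)
    finally show ?thesis .
  qed
  moreover have "\<forall>\<^sub>F N in at_top. (LBINT y. ?f N y)
      = drift N * (LBINT t:{0..B/N}. Re ((1 - cis (s * N * t) - of_bool (1/N < t)) * resolvent t))"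
    using eventually_gt_at_top[of 0]
  proof eventually_elim
    case (elim N)
    have R: "Re (z * (complex_of_real a * r)) = a * Re (z * r)" for z a r
      by (simp add: algebra_simps)
    have "(LBINT t:{0..B/N}. Re ((1 - cis (s * N * t) - of_bool (1/N < t)) * resolvent t))
        = (LBINT y:{0..B}. Re ((1 - cis (s * N * (y / N)) - of_bool (1/N < y / N)) * resolvent (y / N))) / N"
      using elim by (rule set_integral_rescale)
    also have "\<dots> = (LBINT y:{0..B}. Re (?z y * resolvent (y / N))) / N"
      using elim by (simp add: divide_less_cancel)
    finally have "drift N * (LBINT t:{0..B/N}. Re ((1 - cis (s * N * t) - of_bool (1/N < t)) * resolvent t))
        = (drift N / N) * (LBINT y:{0..B}. Re (?z y * resolvent (y / N)))" by simp
    also have "\<dots> = (LBINT y:{0..B}. (drift N / N) * Re (?z y * resolvent (y / N)))"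
      by (rule set_integral_mult_right[symmetric])
    also have "\<dots> = (LBINT y. ?f N y)"
      unfolding set_lebesgue_integral_def
      by (intro Bochner_Integration.integral_cong refl) (simp only: R)
    finally show ?case by simp
  qed
  ultimately show ?thesis by (simp add: filterlim_cong[OF refl refl])
qed

text \<open>
  Up to \<open>o(1/drift N)\<close> the Fourier integral for the potential at \<open>\<plusminus>N\<close> is the even quantity
  \<open>\<integral>\<^bsub>1/N\<^esub> Re resolvent\<close> plus the odd quantity \<open>\<plusminus>(\<pi>/2)/drift N\<close>, the constant being the Dirichlet
  integral.
\<close>

lemma potential_integral_asymptotics:
  assumes s: "\<bar>s\<bar> = 1"
  shows "((\<lambda>N. drift N * ((LBINT t:{0..pi}. Re ((1 - cis (s * N * t)) * resolvent t))
                        - (LBINT t:{1/N..pi}. Re (resolvent t)))) \<longlongrightarrow> s * (pi / 2)) at_top"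
proof (rule tendstoI)
  fix e :: real assume e: "e > 0"
  obtain K X where K: "K > 0" and osc: "\<And>N B s. X \<le> N \<Longrightarrow> 1 \<le> B \<Longrightarrow> B \<le> N \<Longrightarrow> \<bar>s\<bar> = 1 \<Longrightarrow>
     norm (LBINT t:{B/N..pi}. cis (s * N * t) / (1 - chf t)) \<le> K * B powr (-1/2) / L N"
    using oscillating_integral_bound by blast
  have "\<forall>\<^sub>F B in at_top. \<bar>Si B - pi / 2\<bar> < e / 3"
    using tendstoD[OF Si_at_top, of "e/3"] e by (simp add: dist_real_def)
  moreover have "((\<lambda>B::real. K * B powr (-1/2)) \<longlongrightarrow> 0) at_top"
    by (intro tendsto_mult_right_zero tendsto_neg_powr filterlim_ident) auto
  then have "\<forall>\<^sub>F B in at_top. K * B powr (-1/2) < e / 3"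
    by (rule order_tendstoD) (use e in auto)
  ultimately have "\<forall>\<^sub>F B in at_top. \<bar>Si B - pi / 2\<bar> < e / 3 \<and> K * B powr (-1/2) < e / 3 \<and> 1 \<le> B"
    using eventually_ge_at_top[of 1] by eventually_elim auto
  then obtain B where B: "\<bar>Si B - pi / 2\<bar> < e / 3" "K * B powr (-1/2) < e / 3" "1 \<le> B"
    by (auto simp: eventually_at_top_linorder)
  let ?P = "\<lambda>N. LBINT t:{0..B/N}. Re ((1 - cis (s * N * t) - of_bool (1/N < t)) * resolvent t)"
  have "\<forall>\<^sub>F N in at_top. dist (drift N * ?P N) (s * Si B) < e / 3"
    by (rule tendstoD[OF near_part_limit]) (use B s e in auto)
  then show "\<forall>\<^sub>F N in at_top. dist (drift N * ((LBINT t:{0..pi}. Re ((1 - cis (s * N * t)) * resolvent t))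
      - (LBINT t:{1/N..pi}. Re (resolvent t)))) (s * (pi / 2)) < e"
    using eventually_ge_at_top[of "real T"] eventually_ge_at_top[of B] eventually_ge_at_top[of X]
  proof eventually_elim
    case (elim N)
    have N: "0 < N" "0 < drift N" "L N = drift N" using elim T_pos' drift_pos L_eq by auto
    let ?b = "B / N"
    have b: "0 < 1/N" "0 < ?b" "1/N \<le> ?b" "?b \<le> pi"
    proof -
      have "?b \<le> 1" using elim N by simp
      then show "?b \<le> pi" using pi_gt3 by linarith
    qed (use B N in \<open>auto simp: divide_right_mono\<close>)
    let ?z = "\<lambda>t. (1 - cis (s * N * t)) * resolvent t"
    have cR: "set_integrable lborel {u..pi} (\<lambda>t. Re (resolvent t))" if "0 < u" for u
      by (intro borel_integrable_atLeastAtMost' continuous_intros resolvent_continuous_on that) auto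
    have iz: "set_integrable lborel {0..pi} (\<lambda>t. Re (?z t))"
      using set_integrable_Re(1)[OF potential_integrable] .
    have iz': "set_integrable lborel {0..?b} (\<lambda>t. Re (?z t))"
      by (rule set_integrable_subset[OF iz]) (use b in auto)
    have co: "set_integrable lborel {?b..pi} (\<lambda>t. cis (s * N * t) * resolvent t)"
      by (intro borel_integrable_atLeastAtMost' continuous_intros resolvent_continuous_on) (use b in auto)
    let ?i = "\<lambda>t. of_bool (1/N < t) * Re (resolvent t)"
    have i: "set_integrable lborel {0..?b} ?i"
      unfolding set_integrable_def
    proof (rule Bochner_Integration.integrable_bound)
      show "integrable lborel (\<lambda>t. indicat_real {1/N..?b} t *\<^sub>R Re (resolvent t))"
        using set_integrable_subset[OF cR[OF b(1)], of "{1/N..?b}"] b by (auto simp: set_integrable_def)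
    qed (auto simp: indicator_def)
    have ii: "(LBINT t:{0..?b}. ?i t) = (LBINT t:{1/N..?b}. Re (resolvent t))"
      unfolding set_lebesgue_integral_def
    proof (rule integral_cong_AE)
      have nn: "0 \<le> t" if "1/N \<le> t" for t using that b(1) by linarith
      show "AE t in lborel. indicat_real {0..?b} t *\<^sub>R ?i t = indicat_real {1/N..?b} t *\<^sub>R Re (resolvent t)"
        using AE_lborel_singleton[of "1/N"] by eventually_elim (use b nn in \<open>auto simp: indicator_def\<close>)
    qed auto
    have "?P N = (LBINT t:{0..?b}. Re (?z t) - ?i t)"
      by (rule set_lebesgue_integral_cong) (auto simp: algebra_simps)
    also have "\<dots> = (LBINT t:{0..?b}. Re (?z t)) - (LBINT t:{1/N..?b}. Re (resolvent t))"
      using set_integral_diff(2)[OF iz' i] ii by simp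
    finally have P: "?P N = (LBINT t:{0..?b}. Re (?z t)) - (LBINT t:{1/N..?b}. Re (resolvent t))" .
    have "(LBINT t:{?b..pi}. Re (?z t)) = (LBINT t:{?b..pi}. Re (resolvent t) - Re (cis (s * N * t) * resolvent t))"
      by (rule set_lebesgue_integral_cong) (auto simp: algebra_simps)
    also have "\<dots> = (LBINT t:{?b..pi}. Re (resolvent t)) - (LBINT t:{?b..pi}. Re (cis (s * N * t) * resolvent t))"
      using b by (intro set_integral_diff(2) cR set_integrable_Re(1) co) auto
    also have "(LBINT t:{?b..pi}. Re (cis (s * N * t) * resolvent t))
        = Re (LBINT t:{?b..pi}. cis (s * N * t) * resolvent t)"
      by (rule set_integrable_Re(2)[OF co])
    finally have Q: "(LBINT t:{?b..pi}. Re (?z t)) = (LBINT t:{?b..pi}. Re (resolvent t))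
        - Re (LBINT t:{?b..pi}. cis (s * N * t) * resolvent t)" .
    have D: "(LBINT t:{0..pi}. Re (?z t)) - (LBINT t:{1/N..pi}. Re (resolvent t))
        = ?P N - Re (LBINT t:{?b..pi}. cis (s * N * t) * resolvent t)"
      using set_integral_split[of 0 ?b pi, OF _ _ iz] set_integral_split[of "1/N" ?b pi, OF _ _ cR[OF b(1)]] b P Q
      by simp
    have eq: "drift N * ((LBINT t:{0..pi}. Re (?z t)) - (LBINT t:{1/N..pi}. Re (resolvent t)))
        = drift N * ?P N - drift N * Re (LBINT t:{?b..pi}. cis (s * N * t) * resolvent t)"
      by (simp only: D right_diff_distrib)
    have "\<bar>Re (LBINT t:{?b..pi}. cis (s * N * t) * resolvent t)\<bar> \<le> K * B powr (-1/2) / L N"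
      using order.trans[OF abs_Re_le_cmod osc[of N B s]] elim B s by (simp add: resolvent_def)
    then have "\<bar>drift N * Re (LBINT t:{?b..pi}. cis (s * N * t) * resolvent t)\<bar>
        \<le> drift N * (K * B powr (-1/2) / L N)"
      unfolding abs_mult using N by (intro mult_mono) auto
    also have "\<dots> < e / 3" using B N by simp
    finally have o: "\<bar>drift N * Re (LBINT t:{?b..pi}. cis (s * N * t) * resolvent t)\<bar> < e / 3" .
    have "s * Si B - s * (pi / 2) = s * (Si B - pi / 2)" by (simp add: right_diff_distrib)
    then have "\<bar>s * Si B - s * (pi / 2)\<bar> = \<bar>Si B - pi / 2\<bar>"
      using s by (simp only: abs_mult mult_1)
    then have "\<bar>s * Si B - s * (pi / 2)\<bar> < e / 3" using B by simp
    then show ?case using elim(1) o unfolding eq dist_real_def by linarith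
  qed
qed

end

section \<open>The real part of the resolvent and the tail integral\<close>

lemma Si_bounds:
  assumes "0 \<le> q" "q \<le> 1"
  shows "0 \<le> Si q" "Si q \<le> q"
proof -
  have s: "0 \<le> sinc y \<and> sinc y \<le> 1" if "y \<in> {0..q}" for y
  proof (cases "y = 0")
    case False
    then have y: "0 < y" "y \<le> 1" using that assms by auto
    then have "y \<le> pi" using pi_gt3 by linarith
    then show ?thesis using y sin_ge_zero[of y] sin_x_le_x[of y] by (auto simp: divide_le_eq)
  qed simp
  have e: "Si q = (LBINT y:{0..q}. sinc y)"
    using assms interval_integral_Icc[of 0 q sinc] by (simp add: Si_alt_def zero_ereal_def)
  show "0 \<le> Si q" unfolding e by (rule set_integral_nonneg_interval) (use s in blast)
  have "Si q \<le> (LBINT y:{0..q}. 1)"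
    unfolding e by (rule set_integral_mono_le)
      (use s in \<open>auto intro!: borel_integrable_atLeastAtMost' continuous_on_sinc continuous_on_id\<close>)
  then show "Si q \<le> q" using assms by (simp add: set_lebesgue_integral_def)
qed

text \<open>
  The right-hand side is the explicit primitive, continued by zero to \<open>u = 0\<close>: the boundary value there
  vanishes because \<open>Si\<close> tends to \<open>pi/2\<close> at infinity. Letting \<open>u\<close> grow shows that the kernel
  \<open>1 - cos (z/v)\<close> has total mass \<open>z pi/2\<close>.
\<close>

lemma integral_one_minus_cos:
  assumes z: "0 < z" and u: "0 < u"
  shows "(LBINT v:{0..u}. 1 - cos (z / v)) = u * (1 - cos (z / u)) + z * (pi / 2 - Si (z / u))"
proof -
  define F where "F = (\<lambda>v. if v \<le> 0 then 0 else v * (1 - cos (z / v)) + z * (pi / 2 - Si (z / v)))"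
  have der: "(F has_real_derivative 1 - cos (z / v)) (at v)" if v: "0 < v" for v
  proof -
    have "((\<lambda>v. v * (1 - cos (z / v)) + z * (pi / 2 - Si (z / v))) has_real_derivative
       1 * (1 - cos (z / v)) + (- (- sin (z / v) * (- z / v\<^sup>2))) * v + z * (0 - sinc (z / v) * (- z / v\<^sup>2))) (at v)"
      using v by (auto intro!: derivative_eq_intros DERIV_chain2[OF DERIV_Si] simp: power2_eq_square)
    moreover have "1 * (1 - cos (z / v)) + (- (- sin (z / v) * (- z / v\<^sup>2))) * v + z * (0 - sinc (z / v) * (- z / v\<^sup>2))
        = 1 - cos (z / v)"
      using v z by (simp add: power2_eq_square)
    ultimately have "((\<lambda>v. v * (1 - cos (z / v)) + z * (pi / 2 - Si (z / v))) has_real_derivative 1 - cos (z / v)) (at v)"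
      by (simp only:)
    moreover have "\<forall>\<^sub>F x in nhds v. x \<in> {0<..}"
      using v by (intro eventually_nhds_in_open) auto
    then have ev: "\<forall>\<^sub>F x in nhds v. F x = x * (1 - cos (z / x)) + z * (pi / 2 - Si (z / x))"
      by eventually_elim (simp add: F_def)
    ultimately show ?thesis by (simp only: DERIV_cong_ev[OF refl ev refl])
  qed
  have lim0: "(F \<longlongrightarrow> F 0) (at 0 within {0..u})"
  proof -
    have inf: "filterlim (\<lambda>v. z / v) at_top (at_right 0)"
      using filterlim_tendsto_pos_mult_at_top[OF tendsto_const z filterlim_inverse_at_top_right]
      by (simp add: divide_inverse)
    have "((\<lambda>v. v * (1 - cos (z / v))) \<longlongrightarrow> 0) (at_right 0)"
    proof (rule Lim_null_comparison)
      show "\<forall>\<^sub>F v in at_right 0. norm (v * (1 - cos (z / v))) \<le> 2 * \<bar>v\<bar>"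
      proof (rule always_eventually, rule allI)
        fix v
        have "\<bar>1 - cos (z / v)\<bar> \<le> 2" using cos_ge_minus_one[of "z/v"] cos_le_one[of "z/v"] by linarith
        then have "\<bar>v\<bar> * \<bar>1 - cos (z / v)\<bar> \<le> \<bar>v\<bar> * 2" by (intro mult_left_mono) auto
        then show "norm (v * (1 - cos (z / v))) \<le> 2 * \<bar>v\<bar>" by (simp add: abs_mult)
      qed
      show "((\<lambda>v::real. 2 * \<bar>v\<bar>) \<longlongrightarrow> 0) (at_right 0)"
        by (rule tendsto_eq_intros refl | simp)+
    qed
    moreover have "((\<lambda>v. Si (z / v)) \<longlongrightarrow> pi / 2) (at_right 0)"
      by (rule filterlim_compose[OF Si_at_top inf])
    ultimately have "((\<lambda>v. v * (1 - cos (z / v)) + z * (pi / 2 - Si (z / v))) \<longlongrightarrow> 0 + z * (pi / 2 - pi / 2)) (at_right 0)"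
      by (intro tendsto_intros)
    moreover have "\<forall>\<^sub>F v in at_right 0. v * (1 - cos (z / v)) + z * (pi / 2 - Si (z / v)) = F v"
      using eventually_at_right_less[of "0::real"] by eventually_elim (simp add: F_def)
    ultimately have "(F \<longlongrightarrow> 0) (at_right 0)"
      by (rule_tac Lim_transform_eventually) simp_all
    then show ?thesis using u by (simp add: F_def at_within_Icc_at_right)
  qed
  have "(LBINT v:{0..u}. 1 - cos (z / v)) = F u - F 0"
  proof (rule set_integral_FTC[where S="{}"])
    show "continuous_on {0..u} F"
      unfolding continuous_on_eq_continuous_within
    proof
      fix v assume "v \<in> {0..u}"
      then show "continuous (at v within {0..u}) F"
        using lim0 DERIV_isCont[OF der[of v]] continuous_at_imp_continuous_at_within
        by (cases "v = 0") (auto simp: continuous_within)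
    qed
    show "set_integrable lborel {0..u} (\<lambda>v. 1 - cos (z / v))"
    proof (rule set_integrable_bounded_interval[where B=2])
      fix v show "norm (1 - cos (z / v)) \<le> 2"
        using cos_ge_minus_one[of "z/v"] cos_le_one[of "z/v"] unfolding real_norm_def by linarith
    qed auto
  qed (use u der in \<open>auto simp: has_real_derivative_iff_has_vector_derivative[symmetric]\<close>)
  then show ?thesis using u by (simp add: F_def)
qed

lemma one_minus_cos_bound: "\<bar>1 - cos x - pi / 2 * of_bool b\<bar> \<le> (2::real)"
proof -
  have "\<bar>1 - cos x - pi / 2\<bar> \<le> 2" "\<bar>1 - cos x\<bar> \<le> 2"
    using cos_ge_minus_one[of x] cos_le_one[of x] pi_less_4 pi_gt_zero by linarith+
  then show ?thesis by (cases b) auto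
qed

text \<open>
  For \<open>u < z\<close> both parts are bounded. For \<open>u \<ge> z\<close> the difference is minus the mass of the kernel beyond
  \<open>u\<close>, which is of order \<open>z\<^sup>2/u\<close>. The bound has the shape of a clipped second moment.
\<close>

lemma cos_kernel_bound:
  assumes z: "0 \<le> z" and u: "0 < u"
  shows "\<bar>LBINT v:{0..u}. 1 - cos (z / v) - pi / 2 * of_bool (v < z)\<bar> \<le> 2 * (min z u)\<^sup>2 / u"
proof -
  note c2 = one_minus_cos_bound
  have i1: "set_integrable lborel {0..u} (\<lambda>v. 1 - cos (z / v))"
    by (rule set_integrable_bounded_interval[where B=2]) (use c2[of _ False] in auto)
  have i2: "set_integrable lborel {0..u} (\<lambda>v. pi / 2 * of_bool (v < z))"
    by (rule set_integrable_bounded_interval[where B="pi/2"]) auto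
  consider "z = 0" | "u < z" | "0 < z" "z \<le> u" using z by linarith
  then show ?thesis
  proof cases
    case 1
    have "(LBINT v:{0..u}. 1 - cos (z / v) - pi / 2 * of_bool (v < z)) = (LBINT v:{0..u}. 0)"
      by (rule set_lebesgue_integral_cong) (use 1 in auto)
    then show ?thesis using 1 u by (simp add: set_lebesgue_integral_def)
  next
    case 2
    have "norm (LBINT v:{0..u}. 1 - cos (z / v) - pi / 2 * of_bool (v < z)) \<le> (LBINT v:{0..u}. 2)"
    proof (rule norm_set_integral_le[OF set_integral_diff(1)[OF i1 i2]])
      show "set_integrable lborel {0..u} (\<lambda>_. 2 :: real)"
        by (intro borel_integrable_atLeastAtMost' continuous_on_const)
    qed (use c2 in auto)
    also have "\<dots> = 2 * (min z u)\<^sup>2 / u"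
      using 2 u by (simp add: set_lebesgue_integral_def power2_eq_square)
    finally show ?thesis by simp
  next
    case 3
    have "(LBINT v:{0..u}. pi / 2 * of_bool (v < z)) = pi / 2 * z"
    proof -
      have "(LBINT v:{0..u}. pi / 2 * of_bool (v < z)) = pi / 2 * (LBINT v:{0..u}. of_bool (v < \<bar>z\<bar>))"
        using 3 by (simp add: set_integral_mult_right)
      then show ?thesis using layer_cake_min[of u z] 3 u by simp
    qed
    then have e: "(LBINT v:{0..u}. 1 - cos (z / v) - pi / 2 * of_bool (v < z))
        = u * (1 - cos (z / u)) - z * Si (z / u)"
      using set_integral_diff(2)[OF i1 i2] integral_one_minus_cos[OF 3(1) u] by (simp add: algebra_simps)
    have q: "0 \<le> z / u" "z / u \<le> 1" using 3 u by auto
    have "1 - cos (z / u) \<le> (z / u)\<^sup>2 / 2"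
      using order.trans[OF abs_Re_le_cmod norm_cis_minus_linear[of "z / u"]] by simp
    then have "u * (1 - cos (z / u)) \<le> u * ((z / u)\<^sup>2 / 2)" using u by (intro mult_left_mono) auto
    also have "\<dots> = z\<^sup>2 / u / 2" using u by (simp add: power2_eq_square)
    finally have a: "u * (1 - cos (z / u)) \<le> z\<^sup>2 / u / 2" .
    have a': "0 \<le> u * (1 - cos (z / u))" using u by simp
    have "z * Si (z / u) \<le> z * (z / u)" using Si_bounds[OF q] 3 by (intro mult_left_mono) auto
    then have b: "z * Si (z / u) \<le> z\<^sup>2 / u" by (simp add: power2_eq_square)
    have b': "0 \<le> z * Si (z / u)" using Si_bounds[OF q] 3 by simp
    have "0 \<le> z\<^sup>2 / u" using u by simp
    moreover have "\<bar>P - Q\<bar> \<le> 2 * R" if "P \<le> R / 2" "0 \<le> P" "Q \<le> R" "0 \<le> Q" "0 \<le> R" for P Q R :: real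
      using that by linarith
    ultimately have "\<bar>u * (1 - cos (z / u)) - z * Si (z / u)\<bar> \<le> 2 * (z\<^sup>2 / u)"
      using a a' b b' by blast
    then show ?thesis unfolding e using 3 by (simp add: min_def)
  qed
qed

lemma set_integrable_bounded_times_continuous:
  fixes f g :: "real \<Rightarrow> real"
  assumes "f \<in> borel_measurable borel" "\<And>x. \<bar>f x\<bar> \<le> B" "continuous_on {a..b} g"
  shows "set_integrable lborel {a..b} (\<lambda>x. f x * g x)"
proof -
  have g: "set_integrable lborel {a..b} g"
    using assms(3) by (rule borel_integrable_atLeastAtMost')
  have B: "0 \<le> B" using assms(2)[of 0] by linarith
  show ?thesis
    unfolding set_integrable_def
  proof (rule Bochner_Integration.integrable_bound)
    show "integrable lborel (\<lambda>x. B * (indicator {a..b} x *\<^sub>R g x))"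
      using g by (simp add: set_integrable_def)
    have m: "(\<lambda>x. indicator {a..b} x *\<^sub>R g x) \<in> borel_measurable lborel"
      using g by (auto simp: set_integrable_def)
    have "(\<lambda>x. f x * (indicator {a..b} x *\<^sub>R g x)) \<in> borel_measurable lborel"
      using assms(1) m by (intro borel_measurable_times) auto
    then show "(\<lambda>x. indicator {a..b} x *\<^sub>R (f x * g x)) \<in> borel_measurable lborel"
      by (simp add: mult.left_commute)
    show "AE x in lborel. norm (indicator {a..b} x *\<^sub>R (f x * g x)) \<le> norm (B * (indicator {a..b} x *\<^sub>R g x))"
    proof (rule AE_I2)
      fix x
      show "norm (indicator {a..b} x *\<^sub>R (f x * g x)) \<le> norm (B * (indicator {a..b} x *\<^sub>R g x))"
        using assms(2)[of x] B by (cases "x \<in> {a..b}") (auto simp: abs_mult intro!: mult_right_mono)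
    qed
  qed
qed

text \<open>
  Beyond the point where \<open>e\<close> drops below \<open>eps\<close> the integrand \<open>g\<close> is at most \<open>eps * f\<close>; the part before that
  point contributes the constant.
\<close>

lemma integral_relative_error:
  fixes f g e :: "real \<Rightarrow> real"
  assumes f: "\<And>x. set_integrable lborel {a..x} f" "\<And>u. a \<le> u \<Longrightarrow> 0 \<le> f u"
    and g: "\<And>x. set_integrable lborel {a..x} g" "\<And>u. a \<le> u \<Longrightarrow> \<bar>g u\<bar> \<le> e u * f u"
    and e: "(e \<longlongrightarrow> 0) at_top" "\<And>u. a \<le> u \<Longrightarrow> e u \<le> E" "0 \<le> E"
    and eps: "0 < eps"
  shows "\<exists>C\<ge>0. \<forall>x\<ge>a. \<bar>LBINT u:{a..x}. g u\<bar> \<le> eps * (LBINT u:{a..x}. f u) + C"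
proof -
  obtain S0 where S0: "\<And>u. u \<ge> S0 \<Longrightarrow> e u < eps"
    using order_tendstoD(2)[OF e(1) eps] by (auto simp: eventually_at_top_linorder)
  define S where "S = max a S0"
  have S: "a \<le> S" "\<And>u. u \<ge> S \<Longrightarrow> e u < eps" using S0 by (auto simp: S_def)
  let ?C = "E * (LBINT u:{a..S}. f u)"
  have fn: "0 \<le> (LBINT u:{b..c}. f u)" if "a \<le> b" for b c
    by (rule set_integral_nonneg_interval) (use f that in auto)
  have sub: "set_integrable lborel {b..x} f" "set_integrable lborel {b..x} g" if "a \<le> b" for b x
    by (rule set_integrable_subset[OF f(1)[of x]] set_integrable_subset[OF g(1)[of x]]; use that in auto)+
  have gE: "\<bar>LBINT u:{a..x}. g u\<bar> \<le> E * (LBINT u:{a..x}. f u)" for x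
  proof -
    have "norm (LBINT u:{a..x}. g u) \<le> (LBINT u:{a..x}. E * f u)"
    proof (rule norm_set_integral_le)
      fix u assume "u \<in> {a..x}"
      then show "norm (g u) \<le> E * f u"
        using g(2)[of u] f(2)[of u] e(2)[of u] mult_right_mono[of "e u" E "f u"] by auto
    qed (use f g in auto)
    then show ?thesis by simp
  qed
  have "\<bar>LBINT u:{a..x}. g u\<bar> \<le> eps * (LBINT u:{a..x}. f u) + ?C" if x: "a \<le> x" for x
  proof (cases "x \<le> S")
    case True
    have "(LBINT u:{a..x}. f u) \<le> (LBINT u:{a..S}. f u)"
      using set_integral_split[OF x True f(1)] fn[OF x, of S] by simp
    then have "E * (LBINT u:{a..x}. f u) \<le> ?C" using e by (intro mult_left_mono) auto
    moreover have "0 \<le> eps * (LBINT u:{a..x}. f u)" using fn[of a x] eps by simp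
    ultimately show ?thesis using gE[of x] by linarith
  next
    case False
    then have Sx: "S \<le> x" by simp
    have "norm (LBINT u:{S..x}. g u) \<le> (LBINT u:{S..x}. eps * f u)"
    proof (rule norm_set_integral_le)
      fix u assume "u \<in> {S..x}"
      then show "norm (g u) \<le> eps * f u"
        using g(2)[of u] f(2)[of u] S mult_right_mono[of "e u" eps "f u"] less_imp_le[OF S(2)[of u]] by auto
    qed (use sub[OF S(1)] in auto)
    then have "\<bar>LBINT u:{S..x}. g u\<bar> \<le> eps * (LBINT u:{S..x}. f u)" by simp
    moreover have "eps * (LBINT u:{a..x}. f u) = eps * (LBINT u:{a..S}. f u) + eps * (LBINT u:{S..x}. f u)"
      using set_integral_split[OF S(1) Sx f(1)] by (simp add: algebra_simps)
    moreover have "0 \<le> eps * (LBINT u:{a..S}. f u)" using fn[of a S] eps by simp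
    ultimately show ?thesis
      using set_integral_split[OF S(1) Sx g(1)] gE[of S] by linarith
  qed
  moreover have "0 \<le> ?C" using fn[of a S] e by simp
  ultimately show ?thesis by blast
qed

context step_law begin

lemma chf_Re: "Re (chf t) = E (\<lambda>k. cos (t * real_of_int k))"
proof -
  have "integrable (measure_pmf p) (\<lambda>k. cis (t * real_of_int k))"
    by (rule integrable_E_bounded[where B=1]) simp
  then show ?thesis unfolding chf_def by (subst integral_Re[symmetric]) auto
qed

text \<open>
  A primitive of the difference between the two integrands that have to be compared.
\<close>

definition cos_excess :: "real \<Rightarrow> real" where
  "cos_excess u = (LBINT v:{0..u}. (1 - Re (chf (1 / v))) - pi / 2 * tail v)"

lemma set_integrable_cos_excess:
  "set_integrable lborel {0..b} (\<lambda>v. (1 - Re (chf (1 / v))) - pi / 2 * tail v)"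
proof -
  have "\<bar>1 - Re (chf t)\<bar> \<le> 2" for t
    using norm_chf_le_1[of t] abs_Re_le_cmod[of "chf t"] by linarith
  then have A: "set_integrable lborel {0..b} (\<lambda>v. 1 - Re (chf (1 / v)))"
    by (intro set_integrable_bounded_interval[where B=2]) auto
  have B: "set_integrable lborel {0..b} (\<lambda>v. pi / 2 * tail v)"
    by (intro set_integrable_mult_right set_integrable_tails)
  show ?thesis using set_integral_diff(1)[OF A B] .
qed

lemma cos_excess_bound:
  assumes u: "0 < u"
  shows "\<bar>cos_excess u\<bar> \<le> 2 * clip_moment2 u / u"
proof -
  let ?f = "\<lambda>k v. 1 - cos (\<bar>real_of_int k\<bar> / v) - pi / 2 * of_bool (v < \<bar>real_of_int k\<bar>)"
  have b: "\<bar>?f k v\<bar> \<le> 2" for k v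
    by (rule one_minus_cos_bound)
  have "cos_excess u = (LBINT v:{0..u}. E (\<lambda>k. ?f k v))"
    unfolding cos_excess_def
  proof (rule set_lebesgue_integral_cong)
    show "\<forall>v. v \<in> {0..u} \<longrightarrow> 1 - Re (chf (1 / v)) - pi / 2 * tail v = E (\<lambda>k. ?f k v)"
    proof (intro allI impI)
      fix v assume v: "v \<in> {0..u}"
      have "cos (\<bar>x\<bar> / v) = cos (1 / v * x)" for x :: real
        by (cases "x \<ge> 0") (auto simp: field_simps)
      then have "E (\<lambda>k. ?f k v) = E (\<lambda>k. (1 - cos (1 / v * real_of_int k)) - pi / 2 * of_bool (v < \<bar>real_of_int k\<bar>))"
        by simp
      also have "\<dots> = E (\<lambda>k. 1 - cos (1 / v * real_of_int k)) - E (\<lambda>k. pi / 2 * of_bool (v < \<bar>real_of_int k\<bar>))"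
        using one_minus_cos_bound[of _ False] pi_less_4
        by (intro Bochner_Integration.integral_diff integrable_E_bounded[where B=2]) auto
      also have "E (\<lambda>k. 1 - cos (1 / v * real_of_int k)) = 1 - Re (chf (1 / v))"
        unfolding chf_Re by (subst Bochner_Integration.integral_diff) (auto intro!: integrable_E_bounded[where B=1])
      also have "E (\<lambda>k. pi / 2 * of_bool (v < \<bar>real_of_int k\<bar>)) = pi / 2 * tail v"
        using v tail_eq[of v] by (subst integral_mult_right_zero) auto
      finally show "1 - Re (chf (1 / v)) - pi / 2 * tail v = E (\<lambda>k. ?f k v)" by simp
    qed
  qed auto
  also have "\<dots> = E (\<lambda>k. LBINT v:{0..u}. ?f k v)"
    by (rule pmf_Fubini(1)[where B=2]) (use b in auto)
  finally have "cos_excess u = E (\<lambda>k. LBINT v:{0..u}. ?f k v)" .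
  moreover have "norm (E (\<lambda>k. LBINT v:{0..u}. ?f k v)) \<le> E (\<lambda>k. 2 * (min \<bar>real_of_int k\<bar> u)\<^sup>2 / u)"
  proof (rule norm_E_le[where B="2 * u\<^sup>2 / u"])
    fix k
    show "norm (LBINT v:{0..u}. ?f k v) \<le> 2 * (min \<bar>real_of_int k\<bar> u)\<^sup>2 / u"
      using cos_kernel_bound[of "\<bar>real_of_int k\<bar>" u] u by simp
    show "2 * (min \<bar>real_of_int k\<bar> u)\<^sup>2 / u \<le> 2 * u\<^sup>2 / u"
      using u by (intro divide_right_mono mult_left_mono power_mono) auto
  qed
  moreover have "E (\<lambda>k. 2 * (min \<bar>real_of_int k\<bar> u)\<^sup>2 / u) = 2 * clip_moment2 u / u"
    by (simp add: clip_moment2_def)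
  ultimately show ?thesis by (simp only: real_norm_def)
qed

lemma cos_excess_regular:
  shows "continuous_on {0..b} cos_excess"
    and "0 < u \<Longrightarrow> u \<notin> \<int> \<Longrightarrow>
      (cos_excess has_real_derivative (1 - Re (chf (1 / u))) - pi / 2 * tail u) (at u)"
proof -
  let ?f = "\<lambda>v. (1 - Re (chf (1 / v))) - pi / 2 * tail v"
  note i = set_borel_integral_eq_integral[OF set_integrable_cos_excess]
  have e: "cos_excess = (\<lambda>u. integral {0..u} ?f)"
    unfolding cos_excess_def using i(2) by auto
  show "continuous_on {0..b} cos_excess"
    unfolding e by (rule indefinite_integral_continuous_1[OF i(1)])
  assume u: "0 < u" "u \<notin> \<int>"
  have "((\<lambda>u. integral {0..u} ?f) has_vector_derivative ?f u) (at u within ({0..u+1} - {}))"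
  proof (rule integral_has_vector_derivative_continuous_at[OF i(1)])
    have "isCont (\<lambda>v. chf (1 / v)) u"
      using u by (intro isCont_o2[OF _ chf_continuous] continuous_intros) auto
    then have "isCont (\<lambda>v. Re (chf (1 / v))) u" by (rule isCont_Re)
    then have "isCont ?f u"
      unfolding tail_def using tails_continuous_off_Ints[OF u(2)] by (intro continuous_intros)
    then show "continuous (at u within {0..u + 1} - {}) ?f"
      by (rule continuous_at_imp_continuous_at_within)
  qed (use u in auto)
  then have "((\<lambda>u. integral {0..u} ?f) has_vector_derivative ?f u) (at u within {0..u+1})" by simp
  then show "(cos_excess has_real_derivative ?f u) (at u)"
    using u unfolding e by (simp add: has_real_derivative_iff_has_vector_derivative at_within_Icc_at)
qed

text \<open>
  The derivative of \<open>1/drift\<close> is \<open>(lo_tail - up_tail)/drift\<^sup>2\<close> between integers.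
\<close>

lemma inverse_drift_diff:
  assumes a: "0 < a" "a \<le> x" and pos: "\<And>u. a \<le> u \<Longrightarrow> u \<le> x \<Longrightarrow> 0 < drift u"
  shows "(LBINT u:{a..x}. lo_tail u / (drift u)\<^sup>2) - (LBINT u:{a..x}. up_tail u / (drift u)\<^sup>2)
     = 1 / drift x - 1 / drift a"
    and "set_integrable lborel {a..x} (\<lambda>u. lo_tail u / (drift u)\<^sup>2)"
    and "set_integrable lborel {a..x} (\<lambda>u. up_tail u / (drift u)\<^sup>2)"
proof -
  have cont: "continuous_on {a..x} drift"
    using continuous_on_subset[OF drift_continuous_on, of "{a..x}"] a by auto
  have nz: "drift u \<noteq> 0" if "u \<in> {a..x}" for u using pos[of u] that by auto
  have c2: "continuous_on {a..x} (\<lambda>u. 1 / (drift u)\<^sup>2)"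
    using nz by (intro continuous_intros cont) auto
  show i: "set_integrable lborel {a..x} (\<lambda>u. lo_tail u / (drift u)\<^sup>2)"
    "set_integrable lborel {a..x} (\<lambda>u. up_tail u / (drift u)\<^sup>2)"
    using set_integrable_bounded_times_continuous[OF _ _ c2, of lo_tail 1]
      set_integrable_bounded_times_continuous[OF _ _ c2, of up_tail 1] tails_nonneg tails_le_1
    by auto
  have "(LBINT u:{a..x}. lo_tail u / (drift u)\<^sup>2 - up_tail u / (drift u)\<^sup>2) = 1 / drift x - 1 / drift a"
  proof (rule set_integral_FTC[where S="\<int> \<inter> {a..x}"])
    fix u assume u: "u \<in> {a<..<x} - \<int> \<inter> {a..x}"
    then have u': "0 < u" "u \<notin> \<int>" "drift u \<noteq> 0" using a nz[of u] by auto
    have "((\<lambda>u. inverse (drift u)) has_real_derivative - ((up_tail u - lo_tail u) * inverse ((drift u)\<^sup>2))) (at u)"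
      using DERIV_inverse_fun[OF drift_has_derivative[OF u'(1,2)] u'(3)] by (simp add: power2_eq_square mult_ac)
    then have "((\<lambda>u. 1 / drift u) has_real_derivative - ((up_tail u - lo_tail u) / (drift u)\<^sup>2)) (at u)"
      by (simp add: divide_inverse)
    then show "((\<lambda>u. 1 / drift u) has_vector_derivative lo_tail u / (drift u)\<^sup>2 - up_tail u / (drift u)\<^sup>2) (at u)"
      by (simp add: has_real_derivative_iff_has_vector_derivative[symmetric] diff_divide_distrib)
  qed (use a finite_Ints_interval i nz in \<open>auto intro!: continuous_intros cont set_integral_diff(1)\<close>)
  then show "(LBINT u:{a..x}. lo_tail u / (drift u)\<^sup>2) - (LBINT u:{a..x}. up_tail u / (drift u)\<^sup>2)
     = 1 / drift x - 1 / drift a"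
    using set_integral_diff(2)[OF i] by simp
qed

end

context dominated_walk begin

definition tail_integral :: "real \<Rightarrow> real" where
  "tail_integral x = (LBINT u:{real T..x}. tail u / (drift u)\<^sup>2)"

definition cos_integral :: "real \<Rightarrow> real" where
  "cos_integral x = (LBINT u:{real T..x}. (1 - Re (chf (1 / u))) / (drift u)\<^sup>2)"

lemma drift_cont: "real T \<le> a \<Longrightarrow> continuous_on {a..b} drift"
  using continuous_on_subset[OF drift_continuous_on, of "{a..b}"] T_pos' by auto

lemma drift_nz: "real T \<le> u \<Longrightarrow> drift u \<noteq> 0"
  using drift_pos[of u] by simp

lemma inverse_square_cont: "continuous_on {real T..x} (\<lambda>u. 1 / (drift u)\<^sup>2)"
  using drift_nz by (intro continuous_intros drift_cont) auto

lemma set_integrable_tail_integrand: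
  assumes a: "real T \<le> a"
  shows "set_integrable lborel {a..x} (\<lambda>u. tail u / (drift u)\<^sup>2)"
proof -
  have "set_integrable lborel {real T..x} (\<lambda>u. tail u * (1 / (drift u)\<^sup>2))"
    by (rule set_integrable_bounded_times_continuous[OF _ _ inverse_square_cont, where B=2])
       (use tails_nonneg tail_le_2 in auto)
  then have "set_integrable lborel {real T..x} (\<lambda>u. tail u / (drift u)\<^sup>2)" by simp
  then show ?thesis by (rule set_integrable_subset) (use a in auto)
qed

lemma tail_integral_mono: "real T \<le> x \<Longrightarrow> x \<le> y \<Longrightarrow> tail_integral x \<le> tail_integral y"
  unfolding tail_integral_def
  using set_integral_split[OF _ _ set_integrable_tail_integrand[OF order_refl], of x y]
    set_integral_nonneg_interval[of x y "\<lambda>u. tail u / (drift u)\<^sup>2"] tails_nonneg by simp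

lemma tail_integral_nonneg: "0 \<le> tail_integral x"
  unfolding tail_integral_def by (rule set_integral_nonneg_interval) (use tails_nonneg in auto)

lemma inverse_drift_le: "real T \<le> x \<Longrightarrow> x \<le> S \<Longrightarrow> 1 / drift x \<le> (S / real T) powr (1/4) / drift (real T)"
proof -
  assume x: "real T \<le> x" "x \<le> S"
  have "drift (real T) \<le> drift x * (x / real T) powr (1/4)" by (rule drift_Potter(2)) (use x in auto)
  also have "\<dots> \<le> drift x * (S / real T) powr (1/4)"
    using x T_pos' drift_pos[of x] by (intro mult_left_mono powr_mono2 divide_right_mono) auto
  finally show ?thesis
    using drift_pos[of x] drift_pos[of "real T"] x by (simp add: divide_simps mult.commute)
qed

lemma set_integrable_cos_integrand:
  "set_integrable lborel {real T..x} (\<lambda>u. (1 - Re (chf (1 / u))) / (drift u)\<^sup>2)"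
proof -
  have "\<bar>1 - Re (chf t)\<bar> \<le> 2" for t
    using norm_chf_le_1[of t] abs_Re_le_cmod[of "chf t"] by linarith
  then have "set_integrable lborel {real T..x} (\<lambda>u. (1 - Re (chf (1 / u))) * (1 / (drift u)\<^sup>2))"
    by (intro set_integrable_bounded_times_continuous[OF _ _ inverse_square_cont, where B=2]) auto
  then show ?thesis by simp
qed

text \<open>
  Integration by parts against \<open>1/drift^2\<close>: the primitive \<open>cos_excess\<close> of the difference of the two
  integrands is of smaller order than the drift, so neither the boundary term nor the term with
  the derivative of \<open>1/drift^2\<close> (which is at most \<open>2 tail/drift^3\<close>) matters.
\<close>

lemma cos_integral_asymptotics:
  assumes eps: "0 < eps"
  shows "\<exists>C\<ge>0. \<forall>x\<ge>real T. \<bar>cos_integral x - pi / 2 * tail_integral x\<bar>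
     \<le> eps * (tail_integral x + 1 / drift x) + C"
proof -
  let ?e = "\<lambda>u. 4 * (clip_moment2 u / (u * drift u))"
  have e0: "(?e \<longlongrightarrow> 0) at_top" using tendsto_mult[OF tendsto_const clip_moment2_little, of 4] by simp
  have e1: "?e u \<le> 1" "0 \<le> ?e u" if "real T \<le> u" for u
    using moment_small[OF that] drift_pos[OF that] T_pos' that clip_moment2_nonneg[of u] by (auto simp: divide_le_eq)
  have ce: "\<bar>cos_excess u\<bar> \<le> ?e u / 2 * drift u" if "real T \<le> u" for u
    using cos_excess_bound[of u] drift_pos[OF that] T_pos' that by simp
  let ?g = "\<lambda>u. 2 * cos_excess u * (up_tail u - lo_tail u) / drift u ^ 3"
  let ?f = "\<lambda>u. tail u / (drift u)\<^sup>2"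
  have cc: "continuous_on {real T..x} cos_excess" for x
    using continuous_on_subset[OF cos_excess_regular(1), of "{real T..x}"] by auto
  have gi: "set_integrable lborel {real T..x} ?g" for x
  proof -
    have "continuous_on {real T..x} (\<lambda>u. 2 * cos_excess u / drift u ^ 3)"
      using drift_nz by (intro continuous_intros cc drift_cont) auto
    then have "set_integrable lborel {real T..x} (\<lambda>u. (up_tail u - lo_tail u) * (2 * cos_excess u / drift u ^ 3))"
      by (rule set_integrable_bounded_times_continuous[where B=2, rotated 2])
         (use abs_drift_deriv_le tail_le_2 order.trans in \<open>auto\<close>, blast)
    then show ?thesis by (simp add: mult.commute mult.left_commute)
  qed
  have gb: "\<bar>?g u\<bar> \<le> ?e u * ?f u" if u: "real T \<le> u" for u
  proof -
    have d: "0 < drift u" using drift_pos[OF u] .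
    have "\<bar>?g u\<bar> = 2 * \<bar>cos_excess u\<bar> * \<bar>up_tail u - lo_tail u\<bar> / drift u ^ 3"
      using d by (simp add: abs_mult)
    also have "\<dots> \<le> 2 * (?e u / 2 * drift u) * tail u / drift u ^ 3"
      using ce[OF u] abs_drift_deriv_le[of u] d e1(2)[OF u]
      by (intro divide_right_mono mult_mono mult_left_mono) auto
    also have "\<dots> = ?e u * ?f u" using d by (simp add: power2_eq_square power3_eq_cube)
    finally show ?thesis .
  qed
  obtain C1 where C1: "C1 \<ge> 0" "\<And>x. real T \<le> x \<Longrightarrow> \<bar>LBINT u:{real T..x}. ?g u\<bar> \<le> eps * tail_integral x + C1"
    using integral_relative_error[of "real T" ?f ?g ?e 1 eps] gi gb e0 e1(1) eps
      set_integrable_tail_integrand tails_nonneg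
    unfolding tail_integral_def by (auto simp: zero_le_divide_iff)
  obtain S0 where S0: "\<And>u. u \<ge> S0 \<Longrightarrow> ?e u < eps"
    using order_tendstoD(2)[OF e0 eps] by (auto simp: eventually_at_top_linorder)
  let ?K = "(S0 / real T) powr (1/4) / drift (real T)"
  let ?G = "\<lambda>u. cos_excess u / (drift u)\<^sup>2"
  have Gx: "\<bar>?G x\<bar> \<le> eps * (1 / drift x) + ?K" if x: "real T \<le> x" for x
  proof -
    have d: "0 < drift x" using drift_pos[OF x] .
    have K0: "0 \<le> ?K" using drift_pos[of "real T"] by simp
    have "\<bar>?G x\<bar> = \<bar>cos_excess x\<bar> / (drift x)\<^sup>2" by simp
    also have "\<dots> \<le> (?e x / 2 * drift x) / (drift x)\<^sup>2"
      using ce[OF x] by (intro divide_right_mono) auto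
    also have "\<dots> = ?e x / 2 * (1 / drift x)" using d by (simp add: power2_eq_square)
    finally have *: "\<bar>?G x\<bar> \<le> ?e x / 2 * (1 / drift x)" .
    show ?thesis
    proof (cases "S0 \<le> x")
      case True
      have "y / 2 \<le> eps" if "y < eps" "0 \<le> y" for y :: real using that by linarith
      then have "?e x / 2 \<le> eps" using S0[OF True] e1(2)[OF x] by blast
      then have "?e x / 2 * (1 / drift x) \<le> eps * (1 / drift x)"
        using d by (intro mult_right_mono) auto
      then show ?thesis using * K0 by linarith
    next
      case False
      have "?e x / 2 * (1 / drift x) \<le> 1 * (1 / drift x)"
        using e1[OF x] d by (intro mult_right_mono) auto
      also have "\<dots> \<le> ?K" using inverse_drift_le[OF x, of S0] False by simp
      finally have "\<bar>?G x\<bar> \<le> ?K" using * by linarith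
      moreover have "0 \<le> eps * (1 / drift x)" using d eps by simp
      ultimately show ?thesis by linarith
    qed
  qed
  let ?C = "C1 + ?K + \<bar>?G (real T)\<bar>"
  have "\<bar>cos_integral x - pi / 2 * tail_integral x\<bar> \<le> eps * (tail_integral x + 1 / drift x) + ?C"
    if x: "real T \<le> x" for x
  proof -
    let ?c = "\<lambda>u. (1 - Re (chf (1 / u))) / (drift u)\<^sup>2"
    note ci = set_integrable_cos_integrand
    have ti: "set_integrable lborel {real T..x} (\<lambda>u. pi / 2 * ?f u)" for x
      by (intro set_integrable_mult_right set_integrable_tail_integrand order_refl)
    have "(LBINT u:{real T..x}. (?c u - pi / 2 * ?f u) - ?g u) = ?G x - ?G (real T)"
    proof (rule set_integral_FTC[where S="\<int> \<inter> {real T..x}"])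
      fix u assume u: "u \<in> {real T<..<x} - \<int> \<inter> {real T..x}"
      then have u': "real T \<le> u" "0 < u" "u \<notin> \<int>" "drift u \<noteq> 0" using T_pos' drift_nz[of u] by auto
      have "(?G has_real_derivative
         (((1 - Re (chf (1 / u))) - pi / 2 * tail u) * (drift u)\<^sup>2
           - cos_excess u * (2 * (up_tail u - lo_tail u) * drift u)) / ((drift u)\<^sup>2 * (drift u)\<^sup>2)) (at u)"
        by (rule DERIV_divide[OF cos_excess_regular(2)])
           (use u' in \<open>auto intro!: derivative_eq_intros drift_has_derivative\<close>)
      moreover have "(((1 - Re (chf (1 / u))) - pi / 2 * tail u) * (drift u)\<^sup>2
           - cos_excess u * (2 * (up_tail u - lo_tail u) * drift u)) / ((drift u)\<^sup>2 * (drift u)\<^sup>2)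
         = (?c u - pi / 2 * ?f u) - ?g u"
        using u' by (simp add: divide_simps power2_eq_square power3_eq_cube) (simp add: algebra_simps)
      ultimately show "(?G has_vector_derivative (?c u - pi / 2 * ?f u) - ?g u) (at u)"
        by (simp only: has_real_derivative_iff_has_vector_derivative)
    next
      show "continuous_on {real T..x} ?G"
        using drift_nz by (intro continuous_intros cc drift_cont) auto
      show "set_integrable lborel {real T..x} (\<lambda>u. (?c u - pi / 2 * ?f u) - ?g u)"
        by (rule set_integral_diff(1)[OF set_integral_diff(1)[OF ci ti] gi])
    qed (use x finite_Ints_interval in auto)
    then have "cos_integral x - pi / 2 * tail_integral x - (LBINT u:{real T..x}. ?g u) = ?G x - ?G (real T)"
      unfolding cos_integral_def tail_integral_def
        set_integral_diff(2)[OF set_integral_diff(1)[OF ci ti] gi] set_integral_diff(2)[OF ci ti]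
        set_integral_mult_right .
    moreover have "\<bar>a - b\<bar> \<le> eps * (w + i) + (C1 + k + \<bar>g0\<bar>)"
      if "a - b - g = gx - g0" "\<bar>g\<bar> \<le> eps * w + C1" "\<bar>gx\<bar> \<le> eps * i + k" for a b g gx g0 w i k :: real
      using that by (simp add: distrib_left)
    ultimately show ?thesis using C1(2)[OF x] Gx[OF x] by blast
  qed
  moreover have "0 \<le> ?C" using C1(1) drift_pos[of "real T"] by simp
  ultimately show ?thesis by blast
qed

text \<open>
  The numerators agree exactly; only \<open>u |1 - chf (1/u)|\<close> has to be compared with the drift, and the
  expansion of \<open>chf\<close> does that with relative error \<open>3 V(u)/(u drift u)\<close>, \<open>V\<close> being the clipped second
  moment.
\<close>

lemma real_part_relative_error:
  assumes u: "real T \<le> u"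
  shows "\<bar>Re (resolvent (1 / u)) / u\<^sup>2 - (1 - Re (chf (1 / u))) / (drift u)\<^sup>2\<bar>
     \<le> 24 * (clip_moment2 u / (u * drift u)) * ((1 - Re (chf (1 / u))) / (drift u)\<^sup>2)"
proof -
  have up: "0 < u" "0 < drift u" using u T_pos' drift_pos by auto
  define d where "d = 3 * (clip_moment2 u / (u * drift u))"
  have d: "0 \<le> d" "d \<le> 1/2"
    using moment_small[OF u] up clip_moment2_nonneg[of u] by (auto simp: d_def divide_le_eq)
  define a where "a = u * norm (1 - chf (1 / u)) / drift u"
  have "norm (1 - chf (1 / u) + \<i> * complex_of_real (1 / u * drift u)) \<le> 3 * (1 / u)\<^sup>2 * clip_moment2 u"
    using chf_drift[of "1 / u"] up by simp
  moreover have "\<bar>norm (1 - chf (1 / u)) - norm (\<i> * complex_of_real (1 / u * drift u))\<bar>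
     \<le> norm (1 - chf (1 / u) + \<i> * complex_of_real (1 / u * drift u))"
    using norm_triangle_ineq3[of "1 - chf (1 / u)" "- (\<i> * complex_of_real (1 / u * drift u))"] by simp
  moreover have "norm (\<i> * complex_of_real (1 / u * drift u)) = drift u / u"
    using up by (simp only: norm_mult norm_of_real) simp
  ultimately have "\<bar>norm (1 - chf (1 / u)) - drift u / u\<bar> \<le> 3 * (1 / u)\<^sup>2 * clip_moment2 u" by linarith
  then have "u / drift u * \<bar>norm (1 - chf (1 / u)) - drift u / u\<bar> \<le> u / drift u * (3 * (1 / u)\<^sup>2 * clip_moment2 u)"
    using up by (intro mult_left_mono) auto
  moreover have "u / drift u * (3 * (1 / u)\<^sup>2 * clip_moment2 u) = d"
    using up by (simp add: d_def power2_eq_square)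
  moreover have "u / drift u * \<bar>norm (1 - chf (1 / u)) - drift u / u\<bar> = \<bar>a - 1\<bar>"
  proof -
    have "u / drift u * \<bar>norm (1 - chf (1 / u)) - drift u / u\<bar>
        = \<bar>u / drift u * (norm (1 - chf (1 / u)) - drift u / u)\<bar>"
      using up by (simp add: abs_mult)
    also have "u / drift u * (norm (1 - chf (1 / u)) - drift u / u) = a - 1"
      using up by (simp add: a_def field_simps)
    finally show ?thesis .
  qed
  ultimately have a: "\<bar>a - 1\<bar> \<le> d" by simp
  then have a2: "1/2 \<le> a" "a \<le> 3/2" using d by linarith+
  have q: "\<bar>1 / a\<^sup>2 - 1\<bar> \<le> 8 * d"
  proof -
    have "1 / a\<^sup>2 - 1 = (1 - a) * (1 + a) / a\<^sup>2"
      using a2 by (simp add: field_simps power2_eq_square)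
    then have "\<bar>1 / a\<^sup>2 - 1\<bar> = \<bar>a - 1\<bar> * ((1 + a) / a\<^sup>2)"
      using a2 by (simp add: abs_mult abs_minus_commute)
    also have "\<dots> \<le> d * 8"
    proof (rule mult_mono)
      have "1 + a \<le> 8 * a\<^sup>2"
      proof -
        have "a * (1/2) \<le> a * a" using a2 by (intro mult_left_mono) auto
        then show ?thesis using a2 unfolding power2_eq_square by linarith
      qed
      then show "(1 + a) / a\<^sup>2 \<le> 8" using a2 by (simp add: divide_le_eq)
    qed (use a d a2 in auto)
    finally show ?thesis by simp
  qed
  let ?c = "(1 - Re (chf (1 / u))) / (drift u)\<^sup>2"
  have c: "0 \<le> ?c" using Re_chf_le_1[of "1/u"] by simp
  have "Re (resolvent (1 / u)) = (1 - Re (chf (1 / u))) / (norm (1 - chf (1 / u)))\<^sup>2"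
    by (simp add: resolvent_def Re_divide cmod_power2)
  then have "Re (resolvent (1 / u)) / u\<^sup>2 = ?c * (1 / a\<^sup>2)"
    using up by (simp add: a_def power_divide power_mult_distrib)
  then have "Re (resolvent (1 / u)) / u\<^sup>2 - ?c = ?c * (1 / a\<^sup>2 - 1)" by (simp add: right_diff_distrib)
  then have "\<bar>Re (resolvent (1 / u)) / u\<^sup>2 - ?c\<bar> = ?c * \<bar>1 / a\<^sup>2 - 1\<bar>"
    using c by (simp only: abs_mult abs_of_nonneg)
  also have "\<dots> \<le> ?c * (8 * d)" by (rule mult_left_mono[OF q c])
  finally show ?thesis by (simp add: d_def mult.commute)
qed

lemma real_part_substitution:
  assumes x: "real T \<le> x"
  shows "(LBINT t:{1/x..1/real T}. Re (resolvent t)) = (LBINT u:{real T..x}. Re (resolvent (1 / u)) / u\<^sup>2)"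
    and "set_integrable lborel {real T..x} (\<lambda>u. Re (resolvent (1 / u)) / u\<^sup>2)"
proof -
  have T: "0 < 1 / x" "1 / real T \<le> pi"
  proof -
    have "1 / real T \<le> 1" using T_pos' by simp
    then show "1 / real T \<le> pi" using pi_gt3 by linarith
  qed (use x T_pos' in auto)
  have cR: "continuous_on {1/x..1/real T} (\<lambda>t. Re (resolvent t))"
    by (intro continuous_intros resolvent_continuous_on T)
  have sub: "(\<lambda>u. 1 / u) ` {real T..x} \<subseteq> {1/x..1/real T}"
    using x T_pos' by (auto simp: frac_le)
  have cc: "continuous_on {real T..x} (\<lambda>u. Re (resolvent (1 / u)) / u\<^sup>2)"
    using T_pos' by (intro continuous_intros continuous_on_compose2[OF cR _ sub]) auto
  then show i: "set_integrable lborel {real T..x} (\<lambda>u. Re (resolvent (1 / u)) / u\<^sup>2)"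
    by (rule borel_integrable_atLeastAtMost')
  have "((\<lambda>u. (- (1 / u\<^sup>2)) *\<^sub>R Re (resolvent (1 / u))) has_integral
      (integral {1/real T..1/x} (\<lambda>t. Re (resolvent t)) - integral {1/x..1/real T} (\<lambda>t. Re (resolvent t)))) {real T..x}"
    by (rule has_integral_substitution_general[where s="{}", OF _ x sub cR])
       (use T_pos' in \<open>auto intro!: continuous_intros derivative_eq_intros simp: power2_eq_square\<close>)
  moreover have "integral {1/real T..1/x} (\<lambda>t. Re (resolvent t)) = 0"
  proof (cases "x = real T")
    case False
    then have "{1/real T..1/x} = {}" using x T_pos' by (auto simp: divide_le_cancel frac_le field_simps)
    then show ?thesis by simp
  qed simp
  ultimately have "((\<lambda>u. - (Re (resolvent (1 / u)) / u\<^sup>2)) has_integral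
       - integral {1/x..1/real T} (\<lambda>t. Re (resolvent t))) {real T..x}" by simp
  then have "integral {real T..x} (\<lambda>u. Re (resolvent (1 / u)) / u\<^sup>2) = integral {1/x..1/real T} (\<lambda>t. Re (resolvent t))"
    using has_integral_neg by (metis (no_types, lifting) ext integral_unique minus_minus has_integral_neg_iff)
  then show "(LBINT t:{1/x..1/real T}. Re (resolvent t)) = (LBINT u:{real T..x}. Re (resolvent (1 / u)) / u\<^sup>2)"
    using set_borel_integral_eq_integral(2)[OF i]
      set_borel_integral_eq_integral(2)[OF borel_integrable_atLeastAtMost'[OF cR]] by simp
qed

text \<open>
  The additive constant makes the estimate usable both before and after the divergence of the tail
  integral is known.
\<close>

lemma real_part_asymptotics:
  assumes eps: "0 < eps"
  shows "\<exists>C\<ge>0. \<forall>x\<ge>real T. \<bar>(LBINT t:{1/x..pi}. Re (resolvent t)) - pi / 2 * tail_integral x\<bar>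
     \<le> eps * (tail_integral x + 1 / drift x) + C"
proof -
  let ?R = "\<lambda>u. Re (resolvent (1 / u)) / u\<^sup>2" and ?c = "\<lambda>u. (1 - Re (chf (1 / u))) / (drift u)\<^sup>2"
  let ?e = "\<lambda>u. 24 * (clip_moment2 u / (u * drift u))"
  have e0: "(?e \<longlongrightarrow> 0) at_top" using tendsto_mult[OF tendsto_const clip_moment2_little, of 24] by simp
  have e1: "?e u \<le> 4" if "real T \<le> u" for u
    using moment_small[OF that] drift_pos[OF that] T_pos' that by (auto simp: divide_le_eq)
  have Ri: "set_integrable lborel {real T..x} ?R" for x
  proof (cases "real T \<le> x")
    case True then show ?thesis by (rule real_part_substitution(2))
  next
    case False then have "{real T..x} = {}" by auto
    then show ?thesis by (simp add: set_integrable_def)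
  qed
  note ci = set_integrable_cos_integrand
  have e3: "0 < eps / 8" "0 < min 1 (eps / 2)" using eps by auto
  obtain C1 where C1: "C1 \<ge> 0" "\<And>x. real T \<le> x \<Longrightarrow>
     \<bar>LBINT u:{real T..x}. ?R u - ?c u\<bar> \<le> eps / 8 * cos_integral x + C1"
    using integral_relative_error[of "real T" ?c "\<lambda>u. ?R u - ?c u" ?e 4 "eps/8"]
      set_integral_diff(1)[OF Ri ci] ci e0 e1 e3(1) real_part_relative_error Re_chf_le_1
    unfolding cos_integral_def by (auto simp: zero_le_divide_iff)
  obtain C2 where C2: "C2 \<ge> 0" "\<And>x. real T \<le> x \<Longrightarrow>
     \<bar>cos_integral x - pi / 2 * tail_integral x\<bar> \<le> min 1 (eps / 2) * (tail_integral x + 1 / drift x) + C2"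
    using cos_integral_asymptotics[OF e3(2)] by blast
  let ?F = "LBINT t:{1/real T..pi}. Re (resolvent t)"
  let ?C = "C1 + C2 + eps / 8 * C2 + \<bar>?F\<bar>"
  have "\<bar>(LBINT t:{1/x..pi}. Re (resolvent t)) - pi / 2 * tail_integral x\<bar>
     \<le> eps * (tail_integral x + 1 / drift x) + ?C" if x: "real T \<le> x" for x
  proof -
    have T: "0 < 1 / x" "1 / x \<le> 1 / real T" "1 / real T \<le> pi"
    proof -
      have "1 / real T \<le> 1" using T_pos' by simp
      then show "1 / real T \<le> pi" using pi_gt3 by linarith
    qed (use x T_pos' in \<open>auto simp: frac_le\<close>)
    define W where "W = tail_integral x + 1 / drift x"
    have W: "0 \<le> W" "tail_integral x \<le> W" using tail_integral_nonneg[of x] drift_pos[OF x] by (auto simp: W_def)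
    have si: "set_integrable lborel {1/x..pi} (\<lambda>t. Re (resolvent t))"
      by (intro borel_integrable_atLeastAtMost' continuous_intros resolvent_continuous_on T) auto
    have split: "(LBINT t:{1/x..pi}. Re (resolvent t)) = (LBINT u:{real T..x}. ?R u) + ?F"
      using set_integral_split[OF T(2,3) si] real_part_substitution(1)[OF x] by simp
    have RC: "(LBINT u:{real T..x}. ?R u) - cos_integral x = (LBINT u:{real T..x}. ?R u - ?c u)"
      unfolding cos_integral_def using set_integral_diff(2)[OF Ri ci] by simp
    have "min 1 (eps / 2) * W \<le> 1 * W" "min 1 (eps / 2) * W \<le> eps / 2 * W"
      using W by (intro mult_right_mono; simp)+
    then have c1: "\<bar>cos_integral x - pi / 2 * tail_integral x\<bar> \<le> W + C2"
      and c2: "\<bar>cos_integral x - pi / 2 * tail_integral x\<bar> \<le> eps / 2 * W + C2"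
      using C2(2)[OF x] unfolding W_def[symmetric] by linarith+
    have "pi / 2 * tail_integral x \<le> 2 * W" using W tail_integral_nonneg[of x] pi_less_4 pi_gt_zero by (intro mult_mono) auto
    then have "cos_integral x \<le> 3 * W + C2" using c1 by linarith
    then have "eps / 8 * cos_integral x \<le> eps / 8 * (3 * W + C2)" using eps by (intro mult_left_mono) auto
    then have "\<bar>(LBINT u:{real T..x}. ?R u) - cos_integral x\<bar> \<le> eps / 8 * (3 * W + C2) + C1"
      unfolding RC using C1(2)[OF x] by linarith
    then have "\<bar>(LBINT t:{1/x..pi}. Re (resolvent t)) - pi / 2 * tail_integral x\<bar>
        \<le> eps / 8 * (3 * W + C2) + C1 + (eps / 2 * W + C2) + \<bar>?F\<bar>"
      unfolding split using c2 by linarith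
    also have "\<dots> = 7 / 8 * (eps * W) + ?C" by (simp add: field_simps)
    also have "\<dots> \<le> eps * W + ?C" using W eps by simp
    finally show ?thesis unfolding W_def .
  qed
  moreover have "0 \<le> ?C" using C1 C2 eps by simp
  ultimately show ?thesis by blast
qed

end

section \<open>Divergence of the tail integral\<close>

lemma set_integral_finite_sum:
  fixes f :: "'i \<Rightarrow> 'a \<Rightarrow> real"
  assumes "\<And>i. i \<in> I \<Longrightarrow> set_integrable M A (f i)"
  shows "(LINT x:A|M. (\<Sum>i\<in>I. f i x)) = (\<Sum>i\<in>I. LINT x:A|M. f i x)"
  unfolding set_lebesgue_integral_def scaleR_sum_right
  by (rule Bochner_Integration.integral_sum) (use assms in \<open>auto simp: set_integrable_def\<close>)

text \<open>
  The integrals are \<open>pi\<close> times the return probabilities of a walk with step law \<open>p\<close>.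
\<close>

locale recurrent_dominated_walk = dominated_walk +
  assumes returns_nonneg: "\<And>n. 0 \<le> (LBINT t:{0..pi}. Re (chf t ^ n))"
    and returns_diverge: "\<not> summable (\<lambda>n. LBINT t:{0..pi}. Re (chf t ^ n))"
begin

lemma inverse_drift_le_tail_integral:
  assumes x: "real T \<le> x"
  shows "1 / drift x \<le> 1 / drift (real T) + tail_integral x"
proof -
  note d = inverse_drift_diff[OF T_pos'(2) x drift_pos]
  have "0 \<le> (LBINT u:{real T..x}. up_tail u / (drift u)\<^sup>2)"
    by (rule set_integral_nonneg_interval) (use tails_nonneg in auto)
  moreover have "(LBINT u:{real T..x}. lo_tail u / (drift u)\<^sup>2) \<le> tail_integral x"
    unfolding tail_integral_def
    by (rule set_integral_mono_le[OF d(2) set_integrable_tail_integrand])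
       (use tails_nonneg in \<open>auto simp: tail_def intro!: divide_right_mono\<close>)
  ultimately show ?thesis using d(1) by linarith
qed

text \<open>
  Both \<open>|1 - chf t| \<le> 2 |1 - r chf t|\<close> and \<open>1 - r \<le> |1 - r chf t|\<close> hold since \<open>|chf t| \<le> 1\<close>. The numerator
  \<open>1 - r Re (chf t)\<close> splits into \<open>r (1 - Re (chf t))\<close>, which yields the resolvent, and \<open>1 - r\<close>, which yields
  a Poisson-type kernel.
\<close>

lemma Abel_kernel_bound:
  assumes r: "0 < r" "r < 1" and k: "0 < k" and t: "0 < t" "t \<le> pi"
    and lo: "2 * k * t \<le> norm (1 - chf t)"
  shows "Re (1 / (1 - r *\<^sub>R chf t)) \<le> 4 * Re (resolvent t) + 2 * (1 - r) / ((1 - r)\<^sup>2 + (k * t)\<^sup>2)"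
proof -
  define z where "z = chf t"
  define n where "n = norm (1 - r *\<^sub>R z)"
  have z1: "norm z \<le> 1" "z \<noteq> 1" "Re z \<le> 1" using norm_chf_le_1 chf_neq_1 t Re_chf_le_1 by (auto simp: z_def)
  have "norm (r *\<^sub>R z) \<le> r" using z1 r by (simp add: mult_left_le)
  then have n1: "1 - r \<le> n"
    unfolding n_def using norm_triangle_ineq2[of 1 "r *\<^sub>R z"] by simp
  have "norm (1 - z) \<le> n + norm ((1 - r) *\<^sub>R z)"
    unfolding n_def using norm_triangle_ineq4[of "1 - r *\<^sub>R z" "(1 - r) *\<^sub>R z"] by (simp add: algebra_simps)
  also have "norm ((1 - r) *\<^sub>R z) \<le> 1 - r" using z1 r by (simp add: mult_left_le)
  finally have n2: "norm (1 - z) \<le> 2 * n" using n1 by linarith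
  have n0: "0 < n" using n1 r by linarith
  have m0: "0 < norm (1 - z)" using z1 by simp
  have "Re (1 / (1 - r *\<^sub>R z)) = (1 - r * Re z) / n\<^sup>2"
    by (simp add: n_def Re_divide cmod_power2)
  also have "\<dots> = r * (1 - Re z) / n\<^sup>2 + (1 - r) / n\<^sup>2" by (simp add: add_divide_distrib[symmetric] algebra_simps)
  also have "r * (1 - Re z) / n\<^sup>2 \<le> (1 - Re z) / (norm (1 - z) / 2)\<^sup>2"
  proof (rule frac_le)
    show "r * (1 - Re z) \<le> 1 - Re z" using r z1 by (simp add: mult_left_le_one_le)
    show "(norm (1 - z) / 2)\<^sup>2 \<le> n\<^sup>2" using n2 by (intro power_mono) auto
  qed (use z1 m0 in auto)
  also have "(1 - Re z) / (norm (1 - z) / 2)\<^sup>2 = 4 * Re (resolvent t)"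
    by (simp add: resolvent_def z_def Re_divide cmod_power2 power_divide)
  also have "(1 - r) / n\<^sup>2 \<le> (1 - r) / (((1 - r)\<^sup>2 + (k * t)\<^sup>2) / 2)"
  proof (rule divide_left_mono)
    have "(1 - r)\<^sup>2 \<le> n\<^sup>2" using n1 r by (intro power_mono) auto
    moreover have "(k * t)\<^sup>2 \<le> n\<^sup>2" using n2 lo k t by (intro power_mono) (auto simp: z_def)
    ultimately show "((1 - r)\<^sup>2 + (k * t)\<^sup>2) / 2 \<le> n\<^sup>2" by simp
    have "0 < (1 - r)\<^sup>2 + (k * t)\<^sup>2" using r by (simp add: add_pos_nonneg)
    then show "0 < n\<^sup>2 * (((1 - r)\<^sup>2 + (k * t)\<^sup>2) / 2)" using n0 by simp
  qed (use r in auto)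
  finally show ?thesis by (simp add: z_def mult.commute)
qed

lemma Poisson_kernel_mass:
  fixes k r b :: real
  assumes "r < 1" "0 < k" "0 \<le> a" "a \<le> b"
  shows "(LBINT t:{a..b}. 2 * (1 - r) / ((1 - r)\<^sup>2 + (k * t)\<^sup>2)) \<le> pi / k"
    and "set_integrable lborel {a..b} (\<lambda>t. 2 * (1 - r) / ((1 - r)\<^sup>2 + (k * t)\<^sup>2))"
proof -
  have nz: "(1 - r)\<^sup>2 + (k * t)\<^sup>2 \<noteq> 0" for t
    using assms by (metis add_pos_nonneg diff_gt_0_iff_gt less_irrefl zero_le_power2 zero_less_power)
  show i: "set_integrable lborel {a..b} (\<lambda>t. 2 * (1 - r) / ((1 - r)\<^sup>2 + (k * t)\<^sup>2))"
    using nz by (intro borel_integrable_atLeastAtMost' continuous_intros) auto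
  let ?F = "\<lambda>t. 2 / k * arctan (k * t / (1 - r))"
  have "(LBINT t:{a..b}. 2 * (1 - r) / ((1 - r)\<^sup>2 + (k * t)\<^sup>2)) = ?F b - ?F a"
  proof (rule set_integral_FTC[where S="{}"])
    fix t assume "t \<in> {a<..<b} - {}"
    have "(?F has_real_derivative 2 / k * (inverse (1 + (k * t / (1 - r))\<^sup>2) * (k / (1 - r)))) (at t)"
      using assms by (auto intro!: derivative_eq_intros simp: divide_inverse)
    moreover have "2 / k * (inverse (1 + (k * t / (1 - r))\<^sup>2) * (k / (1 - r))) = 2 * (1 - r) / ((1 - r)\<^sup>2 + (k * t)\<^sup>2)"
    proof -
      have "1 + (k * t / (1 - r))\<^sup>2 = ((1 - r)\<^sup>2 + (k * t)\<^sup>2) / (1 - r)\<^sup>2"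
        using assms by (simp add: power_divide add_divide_distrib)
      then show ?thesis using assms nz[of t] by (simp add: power2_eq_square)
    qed
    ultimately show "(?F has_vector_derivative 2 * (1 - r) / ((1 - r)\<^sup>2 + (k * t)\<^sup>2)) (at t)"
      by (simp only: has_real_derivative_iff_has_vector_derivative)
  qed (use assms i in \<open>auto intro!: continuous_intros\<close>)
  also have "\<dots> \<le> 2 / k * (pi / 2)"
  proof -
    have "0 \<le> ?F a" using assms by simp
    moreover have "?F b \<le> 2 / k * (pi / 2)"
      using assms arctan_ubound[of "k * b / (1 - r)"] by (intro mult_left_mono) auto
    ultimately show ?thesis by linarith
  qed
  finally show "(LBINT t:{a..b}. 2 * (1 - r) / ((1 - r)\<^sup>2 + (k * t)\<^sup>2)) \<le> pi / k" by simp
qed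

text \<open>
  The integral of \<open>Re (1/(1 - r chf))\<close> is, up to the geometric remainder, the Abel sum of the
  nonnegative return integrals; a bound uniform in \<open>r < 1\<close> passes to the plain partial sums.
\<close>

lemma Abel_sums_unbounded:
  assumes M: "\<And>r. 0 < r \<Longrightarrow> r < 1 \<Longrightarrow> (LBINT t:{0..pi}. Re (1 / (1 - r *\<^sub>R chf t))) \<le> M"
  shows False
proof -
  define v where "v = (\<lambda>n. LBINT t:{0..pi}. Re (chf t ^ n))"
  have vn: "0 \<le> v n" for n using returns_nonneg by (simp add: v_def)
  have "(\<Sum>n<m. v n) \<le> M" for m
  proof -
    have Abel: "(\<Sum>n<m. r ^ n * v n) \<le> M" if r: "0 < r" "r < 1" for r
    proof -
      have rz: "norm (r *\<^sub>R chf t) \<le> r" for t using norm_chf_le_1 r by (simp add: mult_left_le)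
      have n0: "1 - r \<le> norm (1 - r *\<^sub>R chf t)" for t
        using norm_triangle_ineq2[of 1 "r *\<^sub>R chf t"] rz[of t] by simp
      then have nz: "1 - r *\<^sub>R chf t \<noteq> 0" for t using r by (metis diff_gt_0_iff_gt norm_zero not_le)
      have ci: "set_integrable lborel {0..pi} (\<lambda>t. Re (1 / (1 - r *\<^sub>R chf t)))"
        using nz by (intro borel_integrable_atLeastAtMost' continuous_intros chf_continuous_on) auto
      have cn: "set_integrable lborel {0..pi} (\<lambda>t. Re (chf t ^ n))" for n
        by (intro borel_integrable_atLeastAtMost' continuous_intros chf_continuous_on)
      have "(\<Sum>n<m. r ^ n * v n) \<le> M + pi * (r ^ N / (1 - r))" if N: "m \<le> N" for N
      proof -
        have "(\<Sum>n<m. r ^ n * v n) \<le> (\<Sum>n<N. r ^ n * v n)"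
          using N vn r by (intro sum_mono2) auto
        also have "\<dots> = (LBINT t:{0..pi}. (\<Sum>n<N. r ^ n * Re (chf t ^ n)))"
          unfolding v_def using cn by (subst set_integral_finite_sum) auto
        also have "\<dots> \<le> (LBINT t:{0..pi}. Re (1 / (1 - r *\<^sub>R chf t)) + r ^ N / (1 - r))"
        proof (rule set_integral_mono_le)
          fix t assume "t \<in> {0..pi}"
          let ?w = "r *\<^sub>R chf t"
          have "(\<Sum>n<N. r ^ n * Re (chf t ^ n)) = Re (\<Sum>n<N. ?w ^ n)"
            by (simp add: scaleR_power)
          also have "(\<Sum>n<N. ?w ^ n) = 1 / (1 - ?w) - ?w ^ N / (1 - ?w)"
            using sum_gp_strict[of ?w N] nz[of t] by (auto simp: diff_divide_distrib)
          also have "Re \<dots> \<le> Re (1 / (1 - ?w)) + norm (?w ^ N / (1 - ?w))"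
            using abs_Re_le_cmod[of "?w ^ N / (1 - ?w)"] by simp
          also have "norm (?w ^ N / (1 - ?w)) \<le> r ^ N / (1 - r)"
            unfolding norm_divide norm_power
            using rz[of t] n0[of t] r by (intro frac_le power_mono) auto
          finally show "(\<Sum>n<N. r ^ n * Re (chf t ^ n)) \<le> Re (1 / (1 - ?w)) + r ^ N / (1 - r)" by simp
        next
          show "set_integrable lborel {0..pi} (\<lambda>t. \<Sum>n<N. r ^ n * Re (chf t ^ n))"
            by (intro borel_integrable_atLeastAtMost' continuous_intros chf_continuous_on)
          show "set_integrable lborel {0..pi} (\<lambda>t. Re (1 / (1 - r *\<^sub>R chf t)) + r ^ N / (1 - r))"
            by (intro set_integral_add(1) ci borel_integrable_atLeastAtMost' continuous_on_const)
        qed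
        also have "\<dots> = (LBINT t:{0..pi}. Re (1 / (1 - r *\<^sub>R chf t))) + (LBINT t:{0..pi}. r ^ N / (1 - r))"
          by (intro set_integral_add(2) ci borel_integrable_atLeastAtMost' continuous_on_const)
        also have "(LBINT t:{0..pi}. r ^ N / (1 - r)) = pi * (r ^ N / (1 - r))"
          by (simp add: set_lebesgue_integral_def)
        finally show ?thesis using M[OF r] by linarith
      qed
      moreover have "(\<lambda>N. M + pi * (r ^ N / (1 - r))) \<longlonglongrightarrow> M + pi * (0 / (1 - r))"
        using r by (intro tendsto_intros LIMSEQ_realpow_zero) auto
      ultimately show ?thesis
        by (intro LIMSEQ_le_const[where X="\<lambda>N. M + pi * (r ^ N / (1 - r))"]) auto
    qed
    have "((\<lambda>r. \<Sum>n<m. r ^ n * v n) \<longlongrightarrow> (\<Sum>n<m. 1 ^ n * v n)) (at_left 1)"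
      by (intro tendsto_intros)
    moreover have "\<forall>\<^sub>F r in at_left (1::real). 0 < r \<and> r < 1"
      by (auto simp: eventually_at_left_field intro!: exI[of _ 0])
    then have "\<forall>\<^sub>F r in at_left 1. (\<Sum>n<m. r ^ n * v n) \<le> M"
      by eventually_elim (use Abel in auto)
    ultimately have "(\<Sum>n<m. 1 ^ n * v n) \<le> M"
      by (rule tendsto_upperbound) simp
    then show ?thesis by simp
  qed
  then have "summable v" by (intro summableI_nonneg_bounded[OF vn])
  then show False using returns_diverge by (simp add: v_def)
qed

text \<open>
  If the tail integral stayed bounded, so would \<open>1/drift\<close>, hence \<open>|1 - chf t|\<close> would be at least a multiple
  of \<open>t\<close>, and the integral of the real part of the resolvent would be bounded too. The preceding
  kernel bound then bounds the Abel sums of the return integrals, which diverge.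
\<close>

lemma tail_integral_unbounded: "\<exists>x\<ge>real T. b < tail_integral x"
proof (rule ccontr)
  assume "\<not> ?thesis"
  then have b: "\<And>x. real T \<le> x \<Longrightarrow> tail_integral x \<le> b" by (auto simp: not_less)
  have b0: "0 \<le> b" using b[of "real T"] tail_integral_nonneg[of "real T"] by simp
  define c1 where "c1 = 1 / (1 / drift (real T) + b)"
  have c1: "0 < c1" using drift_pos[of "real T"] b0 by (simp add: c1_def add_pos_nonneg)
  have inv: "1 / drift x \<le> 1 / c1" if "real T \<le> x" for x
    using inverse_drift_le_tail_integral[OF that] b[OF that] by (simp add: c1_def)
  have L1: "c1 \<le> L u" for u
  proof -
    have "1 / L u \<le> 1 / c1" unfolding L_def by (rule inv) simp
    then show ?thesis using c1 L_pos[of u] by (simp add: divide_simps)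
  qed
  obtain c where c: "c > 0" "\<And>t. 0 < t \<Longrightarrow> t \<le> pi \<Longrightarrow> c * (t * L (1/t)) \<le> norm (1 - chf t)"
    using chf_lower_bounds by blast
  define k where "k = c * c1 / 2"
  have k: "0 < k" using c c1 by (simp add: k_def)
  have lo: "2 * k * t \<le> norm (1 - chf t)" if t: "0 < t" "t \<le> pi" for t
  proof -
    have "2 * k * t = c * (t * c1)" by (simp add: k_def)
    also have "\<dots> \<le> c * (t * L (1/t))" using c t L1 by (intro mult_left_mono) auto
    finally show ?thesis using c(2)[OF t] by linarith
  qed
  obtain C where C: "\<And>x. real T \<le> x \<Longrightarrow> \<bar>(LBINT t:{1/x..pi}. Re (resolvent t)) - pi / 2 * tail_integral x\<bar>
     \<le> 1 * (tail_integral x + 1 / drift x) + C"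
    using real_part_asymptotics[of 1] by auto
  define M where "M = pi / 2 * b + (b + 1 / c1) + C"
  have R: "(LBINT t:{1/x..pi}. Re (resolvent t)) \<le> M" if x: "real T \<le> x" for x
  proof -
    have "pi / 2 * tail_integral x \<le> pi / 2 * b" using b[OF x] by (intro mult_left_mono) auto
    moreover have "R \<le> p' + (b + i') + C"
      if "\<bar>R - q\<bar> \<le> 1 * (w + i) + C" "q \<le> p'" "w \<le> b" "i \<le> i'" for R q p' w i i' :: real
      using that(2-4) abs_le_D1[OF that(1)] by simp
    ultimately show ?thesis using C[OF x] b[OF x] inv[OF x] unfolding M_def by blast
  qed
  show False
  proof (rule Abel_sums_unbounded)
    fix r :: real assume r: "0 < r" "r < 1"
    let ?G = "\<lambda>t. Re (1 / (1 - r *\<^sub>R chf t))"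
    have n0: "1 - r \<le> norm (1 - r *\<^sub>R chf t)" for t
    proof -
      have "norm (r *\<^sub>R chf t) \<le> r" using norm_chf_le_1 r by (simp add: mult_left_le)
      then show ?thesis using norm_triangle_ineq2[of 1 "r *\<^sub>R chf t"] by simp
    qed
    then have nz: "1 - r *\<^sub>R chf t \<noteq> 0" for t using r by (metis diff_gt_0_iff_gt norm_zero not_le)
    have gi: "set_integrable lborel {a..b'} ?G" for a b'
      using nz by (intro borel_integrable_atLeastAtMost' continuous_intros chf_continuous_on) auto
    have "(LBINT t:{0..pi}. ?G t) \<le> 4 * M + pi / k + 1 / (1 - r) * (1 / x)" if x: "real T \<le> x" for x
    proof -
      have x0: "0 < 1 / x" "1 / x \<le> pi"
      proof -
        have "1 / x \<le> 1" using x T_pos' by simp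
        then show "1 / x \<le> pi" using pi_gt3 by linarith
      qed (use x T_pos' in auto)
      have Ri: "set_integrable lborel {1/x..pi} (\<lambda>t. Re (resolvent t))"
        by (intro borel_integrable_atLeastAtMost' continuous_intros resolvent_continuous_on x0) auto
      note P = Poisson_kernel_mass[OF r(2) k less_imp_le[OF x0(1)] x0(2)]
      have Ri4: "set_integrable lborel {1/x..pi} (\<lambda>t. 4 * Re (resolvent t))"
        by (intro set_integrable_mult_right Ri)
      have "(LBINT t:{0..1/x}. ?G t) \<le> (LBINT t:{0..1/x}. 1 / (1 - r))"
      proof (rule set_integral_mono_le[OF gi])
        fix t
        have "?G t \<le> norm (1 / (1 - r *\<^sub>R chf t))" by (rule complex_Re_le_cmod)
        also have "\<dots> \<le> 1 / (1 - r)" unfolding norm_divide norm_one using n0[of t] r by (intro frac_le) auto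
        finally show "?G t \<le> 1 / (1 - r)" .
      qed (intro borel_integrable_atLeastAtMost' continuous_on_const)
      also have "\<dots> = 1 / (1 - r) * (1 / x)" using x0 by (simp add: set_lebesgue_integral_def)
      finally have 1: "(LBINT t:{0..1/x}. ?G t) \<le> 1 / (1 - r) * (1 / x)" .
      have "(LBINT t:{1/x..pi}. ?G t)
        \<le> (LBINT t:{1/x..pi}. 4 * Re (resolvent t) + 2 * (1 - r) / ((1 - r)\<^sup>2 + (k * t)\<^sup>2))"
      proof (rule set_integral_mono_le[OF gi set_integral_add(1)[OF Ri4 P(2)]])
        fix t assume "t \<in> {1/x..pi}"
        then have "0 < t" "t \<le> pi" using less_le_trans[OF x0(1)] by auto
        then show "?G t \<le> 4 * Re (resolvent t) + 2 * (1 - r) / ((1 - r)\<^sup>2 + (k * t)\<^sup>2)"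
          using Abel_kernel_bound[OF r k] lo by blast
      qed
      also have "\<dots> = 4 * (LBINT t:{1/x..pi}. Re (resolvent t))
          + (LBINT t:{1/x..pi}. 2 * (1 - r) / ((1 - r)\<^sup>2 + (k * t)\<^sup>2))"
        unfolding set_integral_add(2)[OF Ri4 P(2)] set_integral_mult_right ..
      also have "\<dots> \<le> 4 * M + pi / k" using P(1) R[OF x] by linarith
      finally show ?thesis
        using 1 set_integral_split[of 0 "1/x" pi ?G, OF _ _ gi] x0 by simp
    qed
    moreover have "((\<lambda>x. 4 * M + pi / k + 1 / (1 - r) * (1 / x)) \<longlongrightarrow> 4 * M + pi / k + 1 / (1 - r) * 0) at_top"
      by (intro tendsto_intros tendsto_divide_0[OF tendsto_const] filterlim_at_top_imp_at_infinity filterlim_ident)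
    ultimately show "(LBINT t:{0..pi}. ?G t) \<le> 4 * M + pi / k"
      by (intro tendsto_lowerbound[where f="\<lambda>x. 4 * M + pi / k + 1 / (1 - r) * (1 / x)" and F=at_top])
         (auto intro!: eventually_mono[OF eventually_ge_at_top[of "real T"]])
  qed
qed

lemma tail_integral_at_top: "filterlim tail_integral at_top at_top"
  unfolding filterlim_at_top
proof
  fix b
  obtain x where x: "real T \<le> x" "b < tail_integral x" using tail_integral_unbounded by blast
  show "\<forall>\<^sub>F y in at_top. b \<le> tail_integral y"
    using eventually_ge_at_top[of x]
  proof eventually_elim
    case (elim y)
    then show ?case using tail_integral_mono[OF x(1) elim] x(2) by linarith
  qed
qed

end

section \<open>Asymptotics of the potential\<close>

lemma tendsto_eventually_eq:
  "(f \<longlongrightarrow> l') F \<Longrightarrow> \<forall>\<^sub>F x in F. f x = g x \<Longrightarrow> l' = l \<Longrightarrow> (g \<longlongrightarrow> l) F"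
  using Lim_transform_eventually by blast

context recurrent_dominated_walk begin

text \<open>
  For integers \<open>n\<close> the values \<open>pot 1 n\<close> and \<open>pot (- 1) n\<close> are those of the potential at \<open>n\<close> and \<open>- n\<close>. Errors
  are measured against \<open>potential_scale\<close>, the order of magnitude of the potential at \<open>n\<close>.
\<close>

definition pot :: "real \<Rightarrow> real \<Rightarrow> real" where
  "pot s N = 1 / pi * (LBINT t:{0..pi}. Re ((1 - cis (s * N * t)) * resolvent t))"

definition potential_scale :: "real \<Rightarrow> real" where "potential_scale x = tail_integral x + 1 / drift x"

lemma potential_scale_at_top: "filterlim potential_scale at_top at_top"
proof (rule filterlim_at_top_mono[OF tail_integral_at_top])
  show "\<forall>\<^sub>F x in at_top. tail_integral x \<le> potential_scale x"
    using eventually_ge_at_top[of "real T"]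
  proof eventually_elim
    case (elim x)
    then show ?case using drift_pos[of x] by (simp add: potential_scale_def)
  qed
qed

lemma potential_scale_pos: "real T \<le> x \<Longrightarrow> 0 < potential_scale x"
  using drift_pos[of x] tail_integral_nonneg[of x] by (simp add: potential_scale_def add_nonneg_pos)

lemma inverse_potential_scale_0: "((\<lambda>x. c / potential_scale x) \<longlongrightarrow> 0) at_top"
  by (rule tendsto_divide_0[OF tendsto_const filterlim_at_top_imp_at_infinity[OF potential_scale_at_top]])

lemma real_part_little:
  "((\<lambda>x. ((LBINT t:{1/x..pi}. Re (resolvent t)) - pi / 2 * tail_integral x) / potential_scale x) \<longlongrightarrow> 0) at_top"
proof (rule tendstoI)
  fix e :: real assume e: "e > 0"
  obtain C where C: "\<And>x. real T \<le> x \<Longrightarrow> \<bar>(LBINT t:{1/x..pi}. Re (resolvent t)) - pi / 2 * tail_integral x\<bar>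
     \<le> e / 2 * potential_scale x + C"
    using real_part_asymptotics[of "e/2"] e unfolding potential_scale_def by auto
  have "\<forall>\<^sub>F x in at_top. C / potential_scale x < e / 2"
    using order_tendstoD(2)[OF inverse_potential_scale_0[of C], of "e/2"] e by simp
  then show "\<forall>\<^sub>F x in at_top. dist (((LBINT t:{1/x..pi}. Re (resolvent t)) - pi / 2 * tail_integral x) / potential_scale x) 0 < e"
    using eventually_ge_at_top[of "real T"]
  proof eventually_elim
    case (elim x)
    have s: "0 < potential_scale x" using potential_scale_pos elim by simp
    have "dist (((LBINT t:{1/x..pi}. Re (resolvent t)) - pi / 2 * tail_integral x) / potential_scale x) 0
        = \<bar>(LBINT t:{1/x..pi}. Re (resolvent t)) - pi / 2 * tail_integral x\<bar> / potential_scale x"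
      using s by (simp add: dist_real_def)
    also have "\<dots> \<le> (e / 2 * potential_scale x + C) / potential_scale x"
      using s C[OF elim(2)] by (intro divide_right_mono) auto
    also have "\<dots> = e / 2 + C / potential_scale x" using s by (simp add: add_divide_distrib)
    finally show ?case using elim(1) by linarith
  qed
qed

lemma inverse_drift_over_scale_le: "real T \<le> x \<Longrightarrow> 1 / drift x / potential_scale x \<le> 1"
proof -
  assume "real T \<le> x"
  moreover have "1 / drift x \<le> potential_scale x" using tail_integral_nonneg[of x] by (simp add: potential_scale_def)
  ultimately show ?thesis using potential_scale_pos[of x] by (simp only: divide_le_eq_1_pos)
qed

lemma little_over_drift_imp_little_over_scale:
  assumes "((\<lambda>x. drift x * f x) \<longlongrightarrow> 0) at_top"
  shows "((\<lambda>x. f x / potential_scale x) \<longlongrightarrow> 0) at_top"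
proof (rule Lim_null_comparison)
  show "\<forall>\<^sub>F x in at_top. norm (f x / potential_scale x) \<le> \<bar>drift x * f x\<bar>"
    using eventually_ge_at_top[of "real T"]
  proof eventually_elim
    case (elim x)
    have d: "0 < drift x" "0 < potential_scale x" using drift_pos potential_scale_pos elim by auto
    have "norm (f x / potential_scale x) = \<bar>drift x * f x\<bar> * (1 / drift x / potential_scale x)"
      using d by (simp add: abs_mult)
    also have "\<dots> \<le> \<bar>drift x * f x\<bar> * 1"
      by (intro mult_left_mono inverse_drift_over_scale_le elim) auto
    finally show ?case by simp
  qed
  show "((\<lambda>x. \<bar>drift x * f x\<bar>) \<longlongrightarrow> 0) at_top" using tendsto_rabs[OF assms] by simp
qed

lemma pot_asymptotics:
  assumes s: "\<bar>s\<bar> = 1"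
  shows "((\<lambda>x. (pot s x - (tail_integral x / 2 + s / 2 * (1 / drift x))) / potential_scale x) \<longlongrightarrow> 0) at_top"
proof -
  let ?I = "\<lambda>x. LBINT t:{0..pi}. Re ((1 - cis (s * x * t)) * resolvent t)"
  let ?R = "\<lambda>x. LBINT t:{1/x..pi}. Re (resolvent t)"
  have "((\<lambda>x. drift x * (?I x - ?R x) - s * (pi / 2)) \<longlongrightarrow> s * (pi / 2) - s * (pi / 2)) at_top"
    by (intro tendsto_intros potential_integral_asymptotics s)
  moreover have "\<forall>\<^sub>F x in at_top. drift x * (?I x - ?R x) - s * (pi / 2)
      = drift x * ((?I x - ?R x) - s * (pi / 2) * (1 / drift x))"
    using eventually_ge_at_top[of "real T"]
  proof eventually_elim
    case (elim x)
    then show ?case using drift_pos[of x] by (simp add: algebra_simps)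
  qed
  ultimately have "((\<lambda>x. drift x * ((?I x - ?R x) - s * (pi / 2) * (1 / drift x))) \<longlongrightarrow> 0) at_top"
    by (rule tendsto_eventually_eq) simp
  from little_over_drift_imp_little_over_scale[OF this]
  have "((\<lambda>x. 1 / pi * (((?I x - ?R x) - s * (pi / 2) * (1 / drift x)) / potential_scale x
      + (?R x - pi / 2 * tail_integral x) / potential_scale x)) \<longlongrightarrow> 1 / pi * (0 + 0)) at_top"
    by (intro tendsto_intros real_part_little)
  moreover have "1 / pi * (((?I x - ?R x) - s * (pi / 2) * (1 / drift x)) / potential_scale x
      + (?R x - pi / 2 * tail_integral x) / potential_scale x)
      = (pot s x - (tail_integral x / 2 + s / 2 * (1 / drift x))) / potential_scale x" for x
    by (simp only: pot_def add_divide_distrib[symmetric]) (simp add: field_simps)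
  ultimately show ?thesis by simp
qed

lemma pot_difference: "((\<lambda>x. drift x * (pot 1 x - pot (- 1) x)) \<longlongrightarrow> 1) at_top"
proof -
  let ?D = "\<lambda>s x. (LBINT t:{0..pi}. Re ((1 - cis (s * x * t)) * resolvent t)) - (LBINT t:{1/x..pi}. Re (resolvent t))"
  have "((\<lambda>x. 1 / pi * (drift x * ?D 1 x - drift x * ?D (- 1) x)) \<longlongrightarrow> 1 / pi * (1 * (pi / 2) - (- 1) * (pi / 2))) at_top"
    by (intro tendsto_intros potential_integral_asymptotics) auto
  moreover have "1 / pi * (drift x * ?D 1 x - drift x * ?D (- 1) x) = drift x * (pot 1 x - pot (- 1) x)" for x
    by (simp only: pot_def) (simp add: algebra_simps)
  moreover have "1 / pi * (1 * (pi / 2) - (- 1) * (pi / 2)) = 1" by simp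
  ultimately show ?thesis by simp
qed

text \<open>
  On \<open>[x, c x]\<close> the integrand is at most a multiple of \<open>tail x/(drift x)\<^sup>2\<close>, so the increment is of the order
  \<open>x tail x/(drift x)\<^sup>2\<close>, which is smaller than \<open>1/drift x\<close>.
\<close>

lemma tail_integral_increment:
  assumes c: "1 \<le> c"
  shows "((\<lambda>x. drift x * (tail_integral (c * x) - tail_integral x)) \<longlongrightarrow> 0) at_top"
proof (rule Lim_null_comparison)
  show "\<forall>\<^sub>F x in at_top. norm (drift x * (tail_integral (c * x) - tail_integral x))
      \<le> (c - 1) * c powr (1/2) * (x * tail x / drift x)"
    using eventually_ge_at_top[of "real T"]
  proof eventually_elim
    case (elim x)
    have x: "0 < x" "0 < drift x" "x \<le> c * x" using elim T_pos' drift_pos c by auto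
    let ?K = "tail x * c powr (1/2) / (drift x)\<^sup>2"
    have inc: "tail_integral (c * x) - tail_integral x = (LBINT u:{x..c*x}. tail u / (drift u)\<^sup>2)"
      unfolding tail_integral_def
      using set_integral_split[OF elim x(3) set_integrable_tail_integrand] by simp
    have "(LBINT u:{x..c*x}. tail u / (drift u)\<^sup>2) \<le> (LBINT u:{x..c*x}. ?K)"
    proof (rule set_integral_mono_le[OF set_integrable_tail_integrand[OF elim]])
      fix u assume u: "u \<in> {x..c*x}"
      have du: "0 < drift u" using drift_pos[of u] u elim by auto
      have "drift x \<le> drift u * (u / x) powr (1/4)" by (rule drift_Potter(2)[OF elim]) (use u in auto)
      also have "\<dots> \<le> drift u * c powr (1/4)"
        using u x du by (intro mult_left_mono powr_mono2) (auto simp: divide_le_eq)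
      finally have "(drift x)\<^sup>2 \<le> (drift u * c powr (1/4))\<^sup>2" using x by (intro power_mono) auto
      also have "\<dots> = (drift u)\<^sup>2 * c powr (1/2)"
        by (simp add: power_mult_distrib power2_eq_square powr_add[symmetric])
      finally have "1 / (drift u)\<^sup>2 \<le> c powr (1/2) / (drift x)\<^sup>2"
        using x du by (simp add: divide_simps mult.commute)
      then have "tail u * (1 / (drift u)\<^sup>2) \<le> tail x * (c powr (1/2) / (drift x)\<^sup>2)"
        using u tail_antimono[of x u] tails_nonneg by (intro mult_mono) auto
      then show "tail u / (drift u)\<^sup>2 \<le> ?K" by simp
    qed (intro borel_integrable_atLeastAtMost' continuous_on_const)
    also have "\<dots> = (c - 1) * x * ?K" using x by (simp add: set_lebesgue_integral_def algebra_simps)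
    finally have "drift x * (tail_integral (c * x) - tail_integral x) \<le> drift x * ((c - 1) * x * ?K)"
      unfolding inc using x by (intro mult_left_mono) auto
    moreover have "drift x * ((c - 1) * x * ?K) = (c - 1) * c powr (1/2) * (x * tail x / drift x)"
      using x by (simp add: power2_eq_square)
    moreover have "0 \<le> drift x * (tail_integral (c * x) - tail_integral x)"
      using tail_integral_mono[OF elim x(3)] x by simp
    ultimately show ?case by (metis abs_of_nonneg real_norm_def)
  qed
  show "((\<lambda>x. (c - 1) * c powr (1/2) * (x * tail x / drift x)) \<longlongrightarrow> 0) at_top"
    using tendsto_mult[OF tendsto_const tail_ratio] by simp
qed

end

lemma filterlim_floor_at_top: "filterlim (\<lambda>x::real. \<lfloor>x\<rfloor>) at_top at_top"
  unfolding filterlim_at_top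
proof
  fix n :: int
  show "\<forall>\<^sub>F x::real in at_top. n \<le> \<lfloor>x\<rfloor>"
    using eventually_ge_at_top[of "real_of_int n"] by eventually_elim (simp add: le_floor_iff)
qed

text \<open>
  Regular behaviour along the integers is inherited from a nondecreasing slowly varying comparison
  function: monotonicity controls the passage from \<open>x\<close> to \<open>\<lfloor>x\<rfloor>\<close>.
\<close>

lemma slowly_varying_int_from_monotone:
  fixes f :: "int \<Rightarrow> real" and F :: "real \<Rightarrow> real"
  assumes mono: "\<And>x y. a \<le> x \<Longrightarrow> x \<le> y \<Longrightarrow> F x \<le> F y"
    and pos: "\<forall>\<^sub>F x in at_top. 0 < F x"
    and sv: "\<And>c. c \<ge> 1 \<Longrightarrow> ((\<lambda>x. F (c * x) / F x) \<longlongrightarrow> 1) at_top"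
    and lim: "((\<lambda>n. f n / F (real_of_int n)) \<longlongrightarrow> l) at_top" and l: "0 < l"
  shows "slowly_varying_int f"
proof -
  have fl: "filterlim (\<lambda>x::real. real_of_int \<lfloor>x\<rfloor>) at_top at_top"
    by (rule filterlim_compose[OF filterlim_real_of_int_at_top filterlim_floor_at_top])
  have pos': "\<forall>\<^sub>F x::real in at_top. 0 < F (real_of_int \<lfloor>x\<rfloor>)"
    by (rule eventually_compose_filterlim[OF pos fl])
  have flF: "((\<lambda>x. F (real_of_int \<lfloor>x\<rfloor>) / F x) \<longlongrightarrow> 1) at_top"
  proof (rule tendsto_sandwich)
    show "((\<lambda>x. F (1/2 * x) / F x) \<longlongrightarrow> 1) at_top" by (rule ratio_limit_scale[OF sv]) auto
    show "\<forall>\<^sub>F x in at_top. F (1/2 * x) / F x \<le> F (real_of_int \<lfloor>x\<rfloor>) / F x"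
      using pos eventually_ge_at_top[of "max 2 (2 * a)"]
    proof eventually_elim
      case (elim x)
      have "1/2 * x \<le> real_of_int \<lfloor>x\<rfloor>" using elim by linarith
      then show ?case using elim by (intro divide_right_mono mono) auto
    qed
    show "\<forall>\<^sub>F x in at_top. F (real_of_int \<lfloor>x\<rfloor>) / F x \<le> 1"
      using pos eventually_ge_at_top[of "a + 1"]
    proof eventually_elim
      case (elim x)
      have "a \<le> real_of_int \<lfloor>x\<rfloor>" "real_of_int \<lfloor>x\<rfloor> \<le> x" using elim by linarith+
      then show ?case using elim mono[of "real_of_int \<lfloor>x\<rfloor>" x] by simp
    qed
  qed simp
  have g: "((\<lambda>x. f \<lfloor>x\<rfloor> / F x) \<longlongrightarrow> l) at_top"
  proof -
    have "((\<lambda>x. f \<lfloor>x\<rfloor> / F (real_of_int \<lfloor>x\<rfloor>) * (F (real_of_int \<lfloor>x\<rfloor>) / F x)) \<longlongrightarrow> l * 1) at_top"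
      by (intro tendsto_mult flF filterlim_compose[OF lim filterlim_floor_at_top])
    moreover have "\<forall>\<^sub>F x in at_top. f \<lfloor>x\<rfloor> / F (real_of_int \<lfloor>x\<rfloor>) * (F (real_of_int \<lfloor>x\<rfloor>) / F x) = f \<lfloor>x\<rfloor> / F x"
      using pos' by eventually_elim simp
    ultimately show ?thesis by (rule tendsto_eventually_eq) simp
  qed
  have gpos: "\<forall>\<^sub>F x::real in at_top. 0 < f \<lfloor>x\<rfloor>"
    using order_tendstoD(1)[OF g l] pos by eventually_elim (simp add: zero_less_divide_iff)
  have "((\<lambda>x. f \<lfloor>c * x\<rfloor> / f \<lfloor>x\<rfloor>) \<longlongrightarrow> 1) at_top" if c: "0 < c" for c :: real
  proof -
    have cx: "filterlim (\<lambda>x. c * x) at_top at_top"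
      using c by (rule filterlim_tendsto_pos_mult_at_top[OF tendsto_const _ filterlim_ident])
    have "((\<lambda>x. (f \<lfloor>c * x\<rfloor> / F (c * x)) * (F (c * x) / F x) / (f \<lfloor>x\<rfloor> / F x)) \<longlongrightarrow> l * 1 / l) at_top"
      by (intro tendsto_divide tendsto_mult filterlim_compose[OF g cx] ratio_limit_scale[OF sv c] g)
         (use l in auto)
    moreover have "\<forall>\<^sub>F x in at_top. (f \<lfloor>c * x\<rfloor> / F (c * x)) * (F (c * x) / F x) / (f \<lfloor>x\<rfloor> / F x)
        = f \<lfloor>c * x\<rfloor> / f \<lfloor>x\<rfloor>"
      using pos eventually_compose_filterlim[OF pos cx] by eventually_elim simp
    ultimately show ?thesis by (rule tendsto_eventually_eq) (use l in simp)
  qed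
  moreover have "(\<lambda>x::real. f \<lfloor>x\<rfloor>) \<in> borel_measurable borel"
    by (rule measurable_compose[of _ _ "count_space UNIV"]) auto
  ultimately show ?thesis using gpos by (simp add: slowly_varying_int_def slowly_varying_def)
qed

context recurrent_dominated_walk begin


context
  fixes a :: real
  assumes a: "0 < a" "a \<le> real T" and a_pos: "\<And>u. a \<le> u \<Longrightarrow> 0 < drift u"
begin

definition lo_int :: "real \<Rightarrow> real" where "lo_int x = (LBINT u:{a..x}. lo_tail u / (drift u)\<^sup>2)"
definition up_int :: "real \<Rightarrow> real" where "up_int x = (LBINT u:{a..x}. up_tail u / (drift u)\<^sup>2)"

lemma one_sided_integrable:
  "set_integrable lborel {a..x} (\<lambda>u. lo_tail u / (drift u)\<^sup>2)"
  "set_integrable lborel {a..x} (\<lambda>u. up_tail u / (drift u)\<^sup>2)"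
proof -
  have "set_integrable lborel {a..x} (\<lambda>u. lo_tail u / (drift u)\<^sup>2) \<and> set_integrable lborel {a..x} (\<lambda>u. up_tail u / (drift u)\<^sup>2)"
  proof (cases "a \<le> x")
    case True
    then show ?thesis using inverse_drift_diff(2,3)[OF a(1) True a_pos] by simp
  next
    case False
    then have "{a..x} = {}" by auto
    then show ?thesis by (simp add: set_integrable_def)
  qed
  then show "set_integrable lborel {a..x} (\<lambda>u. lo_tail u / (drift u)\<^sup>2)"
    "set_integrable lborel {a..x} (\<lambda>u. up_tail u / (drift u)\<^sup>2)" by auto
qed

text \<open>
  From \<open>T\<close> on the sum of the one-sided integrals is the tail integral up to a constant, and their
  difference is \<open>1/drift\<close> up to a constant; the formulas solve these two equations.
\<close>

lemma one_sided_formulas: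
  "\<exists>k. \<forall>x\<ge>real T. lo_int x = potential_scale x / 2 + k \<and> up_int x = tail_integral x / 2 - 1 / 2 * (1 / drift x) + (k + 1 / drift a)"
proof -
  define q where "q = lo_int (real T) + up_int (real T)"
  have base: "lo_int x + up_int x = q + tail_integral x \<and> lo_int x - up_int x = 1 / drift x - 1 / drift a" if x: "real T \<le> x" for x
  proof
    have sub: "set_integrable lborel {real T..x} (\<lambda>u. lo_tail u / (drift u)\<^sup>2)"
      "set_integrable lborel {real T..x} (\<lambda>u. up_tail u / (drift u)\<^sup>2)"
      by (rule set_integrable_subset[OF one_sided_integrable(1)[of x]] set_integrable_subset[OF one_sided_integrable(2)[of x]];
          use a in auto)+
    have "lo_int x = lo_int (real T) + (LBINT u:{real T..x}. lo_tail u / (drift u)\<^sup>2)"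
      "up_int x = up_int (real T) + (LBINT u:{real T..x}. up_tail u / (drift u)\<^sup>2)"
      unfolding lo_int_def up_int_def
      using set_integral_split[OF a(2) x one_sided_integrable(1)] set_integral_split[OF a(2) x one_sided_integrable(2)] by auto
    moreover have "tail_integral x = (LBINT u:{real T..x}. lo_tail u / (drift u)\<^sup>2) + (LBINT u:{real T..x}. up_tail u / (drift u)\<^sup>2)"
      unfolding tail_integral_def set_integral_add(2)[OF sub, symmetric]
      by (simp add: tail_def add_divide_distrib add.commute)
    ultimately show "lo_int x + up_int x = q + tail_integral x" by (simp add: q_def)
    show "lo_int x - up_int x = 1 / drift x - 1 / drift a"
      unfolding lo_int_def up_int_def using a x a_pos by (intro inverse_drift_diff(1)) auto
  qed
  have solve: "l = (w + i) / 2 + (q - j) / 2 \<and> u = w / 2 - 1 / 2 * i + ((q - j) / 2 + j)"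
    if "l + u = q + w \<and> l - u = i - j" for l u w i j :: real
    using that by (simp add: field_simps)
  have "lo_int x = potential_scale x / 2 + (q - 1 / drift a) / 2 \<and>
     up_int x = tail_integral x / 2 - 1 / 2 * (1 / drift x) + ((q - 1 / drift a) / 2 + 1 / drift a)"
    if "real T \<le> x" for x
    unfolding potential_scale_def by (rule solve[OF base[OF that]])
  then show ?thesis by blast
qed

lemma lo_int_over_scale: "((\<lambda>x. lo_int x / potential_scale x) \<longlongrightarrow> 1 / 2) at_top"
proof -
  obtain k where k: "\<And>x. real T \<le> x \<Longrightarrow> lo_int x = potential_scale x / 2 + k" using one_sided_formulas by blast
  have "((\<lambda>x. 1 / 2 + k / potential_scale x) \<longlongrightarrow> 1 / 2 + 0) at_top" by (intro tendsto_intros inverse_potential_scale_0)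
  moreover have "\<forall>\<^sub>F x in at_top. 1 / 2 + k / potential_scale x = lo_int x / potential_scale x"
    using eventually_ge_at_top[of "real T"]
  proof eventually_elim
    case (elim x)
    then show ?case using potential_scale_pos[OF elim] k[OF elim] by (simp add: add_divide_distrib)
  qed
  ultimately show ?thesis by (rule tendsto_eventually_eq) simp
qed

lemma pot_plus_over_scale: "((\<lambda>x. pot 1 x / potential_scale x) \<longlongrightarrow> 1 / 2) at_top"
proof -
  have "((\<lambda>x. (pot 1 x - (tail_integral x / 2 + 1 / 2 * (1 / drift x))) / potential_scale x + 1 / 2) \<longlongrightarrow> 0 + 1 / 2) at_top"
    by (intro tendsto_add tendsto_const pot_asymptotics) auto
  moreover have "\<forall>\<^sub>F x in at_top. (pot 1 x - (tail_integral x / 2 + 1 / 2 * (1 / drift x))) / potential_scale x + 1 / 2 = pot 1 x / potential_scale x"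
    using eventually_ge_at_top[of "real T"]
  proof eventually_elim
    case (elim x)
    have "tail_integral x / 2 + 1 / 2 * (1 / drift x) = potential_scale x / 2" by (simp add: potential_scale_def)
    then show ?case using potential_scale_pos[OF elim] by (simp only: diff_divide_distrib) simp
  qed
  ultimately show ?thesis by (rule tendsto_eventually_eq) simp
qed

lemma pot_plus_asymptotics: "((\<lambda>x. pot 1 x / lo_int x) \<longlongrightarrow> 1) at_top"
proof -
  have "((\<lambda>x. (pot 1 x / potential_scale x) / (lo_int x / potential_scale x)) \<longlongrightarrow> (1/2) / (1/2)) at_top"
    by (intro tendsto_divide pot_plus_over_scale lo_int_over_scale) auto
  moreover have "\<forall>\<^sub>F x in at_top. (pot 1 x / potential_scale x) / (lo_int x / potential_scale x) = pot 1 x / lo_int x"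
    using eventually_ge_at_top[of "real T"]
  proof eventually_elim
    case (elim x)
    then show ?case using potential_scale_pos[OF elim] by simp
  qed
  ultimately show ?thesis by (rule tendsto_eventually_eq) simp
qed

lemma lo_int_pos: "\<forall>\<^sub>F x in at_top. 0 < lo_int x"
proof -
  have "\<forall>\<^sub>F x in at_top. 0 < lo_int x / potential_scale x" by (rule order_tendstoD(1)[OF lo_int_over_scale]) simp
  then show ?thesis using eventually_ge_at_top[of "real T"]
  proof eventually_elim
    case (elim x)
    then show ?case using potential_scale_pos[of x] by (simp add: zero_less_divide_iff)
  qed
qed

lemma pot_plus_pos: "\<forall>\<^sub>F x in at_top. 0 < pot 1 x"
proof -
  have "\<forall>\<^sub>F x in at_top. 0 < pot 1 x / potential_scale x" by (rule order_tendstoD(1)[OF pot_plus_over_scale]) simp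
  then show ?thesis using eventually_ge_at_top[of "real T"]
  proof eventually_elim
    case (elim x)
    then show ?case using potential_scale_pos[of x] by (simp add: zero_less_divide_iff)
  qed
qed

lemma pot_minus_asymptotics: "((\<lambda>x. (pot (- 1) x - up_int x) / pot 1 x) \<longlongrightarrow> 0) at_top"
proof -
  obtain k where k: "\<And>x. real T \<le> x \<Longrightarrow> up_int x = tail_integral x / 2 - 1 / 2 * (1 / drift x) + k"
    using one_sided_formulas by blast
  have "((\<lambda>x. ((pot (- 1) x - (tail_integral x / 2 + (- 1) / 2 * (1 / drift x))) / potential_scale x - k / potential_scale x) / (pot 1 x / potential_scale x))
      \<longlongrightarrow> (0 - 0) / (1 / 2)) at_top"
    by (intro tendsto_divide tendsto_diff pot_asymptotics inverse_potential_scale_0 pot_plus_over_scale) auto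
  moreover have "\<forall>\<^sub>F x in at_top. ((pot (- 1) x - (tail_integral x / 2 + (- 1) / 2 * (1 / drift x))) / potential_scale x - k / potential_scale x) / (pot 1 x / potential_scale x)
      = (pot (- 1) x - up_int x) / pot 1 x"
    using eventually_ge_at_top[of "real T"]
  proof eventually_elim
    case (elim x)
    then show ?case using potential_scale_pos[OF elim] k[OF elim]
      by (simp add: diff_divide_distrib[symmetric])
  qed
  ultimately show ?thesis by (rule tendsto_eventually_eq) simp
qed

lemma tail_integral_pos: "\<forall>\<^sub>F x in at_top. 0 < tail_integral x"
  using tail_integral_at_top by (rule filterlim_at_top_dense[THEN iffD1, rule_format])

text \<open>
  As \<open>1/drift\<close> is at most a constant plus the tail integral, errors that are small against
  \<open>potential_scale\<close> are small against the tail integral, the main term of the even part.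
\<close>

lemma scale_over_tail_integral_bounded: "\<forall>\<^sub>F x in at_top. potential_scale x \<le> 3 * tail_integral x"
proof -
  have "\<forall>\<^sub>F x in at_top. 1 / drift (real T) \<le> tail_integral x"
    using tail_integral_at_top by (simp add: filterlim_at_top)
  then show ?thesis using eventually_ge_at_top[of "real T"]
  proof eventually_elim
    case (elim x)
    then show ?case using inverse_drift_le_tail_integral[of x] by (simp add: potential_scale_def)
  qed
qed

lemma little_over_scale_imp_little_over_tail_integral:
  assumes "((\<lambda>x. f x / potential_scale x) \<longlongrightarrow> 0) at_top"
  shows "((\<lambda>x. f x / tail_integral x) \<longlongrightarrow> 0) at_top"
proof (rule Lim_null_comparison)
  show "\<forall>\<^sub>F x in at_top. norm (f x / tail_integral x) \<le> 3 * \<bar>f x / potential_scale x\<bar>"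
    using scale_over_tail_integral_bounded tail_integral_pos eventually_ge_at_top[of "real T"]
  proof eventually_elim
    case (elim x)
    have s: "0 < potential_scale x" using potential_scale_pos elim by simp
    have "norm (f x / tail_integral x) = \<bar>f x\<bar> / tail_integral x" using elim by simp
    also have "\<dots> \<le> \<bar>f x\<bar> / (potential_scale x / 3)" using elim s by (intro divide_left_mono) auto
    finally show ?case using s by (simp add: abs_divide mult.commute)
  qed
  show "((\<lambda>x. 3 * \<bar>f x / potential_scale x\<bar>) \<longlongrightarrow> 0) at_top"
    using tendsto_mult[OF tendsto_const tendsto_rabs[OF assms], of 3] by simp
qed

lemma sym_pot_asymptotics: "((\<lambda>x. (pot 1 x + pot (- 1) x) / 2 / tail_integral x) \<longlongrightarrow> 1 / 2) at_top"
proof -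
  let ?g = "\<lambda>x. (pot 1 x + pot (- 1) x) / 2 - tail_integral x / 2"
  have "((\<lambda>x. 1 / 2 * ((pot 1 x - (tail_integral x / 2 + 1 / 2 * (1 / drift x))) / potential_scale x
       + (pot (- 1) x - (tail_integral x / 2 + (- 1) / 2 * (1 / drift x))) / potential_scale x)) \<longlongrightarrow> 1 / 2 * (0 + 0)) at_top"
    by (intro tendsto_mult tendsto_add tendsto_const pot_asymptotics) auto
  moreover have "\<forall>\<^sub>F x in at_top. 1 / 2 * ((pot 1 x - (tail_integral x / 2 + 1 / 2 * (1 / drift x))) / potential_scale x
       + (pot (- 1) x - (tail_integral x / 2 + (- 1) / 2 * (1 / drift x))) / potential_scale x) = ?g x / potential_scale x"
  proof (rule always_eventually, rule allI)
    have "1 / 2 * ((p1 - (w / 2 + 1 / 2 * i)) / S + (p2 - (w / 2 + (- 1) / 2 * i)) / S) = ((p1 + p2) / 2 - w / 2) / S"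
      for p1 p2 w i S :: real
      by (cases "S = 0") (auto simp: field_simps)
    then show "1 / 2 * ((pot 1 x - (tail_integral x / 2 + 1 / 2 * (1 / drift x))) / potential_scale x
       + (pot (- 1) x - (tail_integral x / 2 + (- 1) / 2 * (1 / drift x))) / potential_scale x) = ?g x / potential_scale x" for x .
  qed
  ultimately have "((\<lambda>x. ?g x / potential_scale x) \<longlongrightarrow> 0) at_top"
    by (rule tendsto_eventually_eq) simp
  from little_over_scale_imp_little_over_tail_integral[OF this]
  have "((\<lambda>x. ?g x / tail_integral x + 1 / 2) \<longlongrightarrow> 0 + 1 / 2) at_top" by (intro tendsto_intros)
  moreover have "\<forall>\<^sub>F x in at_top. ?g x / tail_integral x + 1 / 2 = (pot 1 x + pot (- 1) x) / 2 / tail_integral x"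
    using tail_integral_pos by eventually_elim (simp add: diff_divide_distrib)
  ultimately show ?thesis by (rule tendsto_eventually_eq) simp
qed

lemma tail_integral_slowly_varying:
  assumes c: "1 \<le> c"
  shows "((\<lambda>x. tail_integral (c * x) / tail_integral x) \<longlongrightarrow> 1) at_top"
proof -
  have "((\<lambda>x. (tail_integral (c * x) - tail_integral x) / tail_integral x + 1) \<longlongrightarrow> 0 + 1) at_top"
    by (intro tendsto_intros little_over_scale_imp_little_over_tail_integral
          little_over_drift_imp_little_over_scale tail_integral_increment c)
  moreover have "\<forall>\<^sub>F x in at_top. (tail_integral (c * x) - tail_integral x) / tail_integral x + 1
      = tail_integral (c * x) / tail_integral x"
    using tail_integral_pos by eventually_elim (simp add: diff_divide_distrib)
  ultimately show ?thesis by (rule tendsto_eventually_eq) simp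
qed

lemma lo_int_mono: "a \<le> x \<Longrightarrow> x \<le> y \<Longrightarrow> lo_int x \<le> lo_int y"
  unfolding lo_int_def
  using set_integral_split[OF _ _ one_sided_integrable(1), of x y]
    set_integral_nonneg_interval[of x y "\<lambda>u. lo_tail u / (drift u)\<^sup>2"] tails_nonneg by simp

lemma lo_int_slowly_varying:
  assumes c: "1 \<le> c"
  shows "((\<lambda>x. lo_int (c * x) / lo_int x) \<longlongrightarrow> 1) at_top"
proof -
  have "((\<lambda>x. (lo_int (c * x) - lo_int x) / potential_scale x) \<longlongrightarrow> 0) at_top"
  proof (rule Lim_null_comparison)
    show "((\<lambda>x. (tail_integral (c * x) - tail_integral x) / potential_scale x) \<longlongrightarrow> 0) at_top"
      by (rule little_over_drift_imp_little_over_scale[OF tail_integral_increment[OF c]])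
    show "\<forall>\<^sub>F x in at_top. norm ((lo_int (c * x) - lo_int x) / potential_scale x) \<le> (tail_integral (c * x) - tail_integral x) / potential_scale x"
      using eventually_ge_at_top[of "real T"]
    proof eventually_elim
      case (elim x)
      have x: "a \<le> x" "x \<le> c * x" using elim a T_pos' c by auto
      have up: "up_int x \<le> up_int (c * x)"
        unfolding up_int_def
        using set_integral_split[OF x one_sided_integrable(2)]
          set_integral_nonneg_interval[of x "c * x" "\<lambda>u. up_tail u / (drift u)\<^sup>2"] tails_nonneg by simp
      obtain k where k: "\<And>x. real T \<le> x \<Longrightarrow> lo_int x = potential_scale x / 2 + k \<and>
          up_int x = tail_integral x / 2 - 1 / 2 * (1 / drift x) + (k + 1 / drift a)"
        using one_sided_formulas by blast
      have "lo_int y + up_int y = tail_integral y + (2 * k + 1 / drift a)" if "real T \<le> y" for y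
        using k[OF that] by (simp add: potential_scale_def field_simps)
      from this[of x] this[of "c * x"]
      have "lo_int (c * x) - lo_int x \<le> tail_integral (c * x) - tail_integral x"
        using up elim x by linarith
      moreover have "0 \<le> lo_int (c * x) - lo_int x" using lo_int_mono[OF x] by simp
      ultimately show ?case using potential_scale_pos[OF elim] by (simp add: abs_divide divide_right_mono)
    qed
  qed
  then have "((\<lambda>x. (lo_int (c * x) - lo_int x) / potential_scale x / (lo_int x / potential_scale x) + 1) \<longlongrightarrow> 0 / (1 / 2) + 1) at_top"
    by (intro tendsto_intros lo_int_over_scale) auto
  moreover have "\<forall>\<^sub>F x in at_top. (lo_int (c * x) - lo_int x) / potential_scale x / (lo_int x / potential_scale x) + 1 = lo_int (c * x) / lo_int x"
    using lo_int_pos eventually_ge_at_top[of "real T"]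
  proof eventually_elim
    case (elim x)
    then show ?case using potential_scale_pos[OF elim(2)] by (simp add: field_simps)
  qed
  ultimately show ?thesis by (rule tendsto_eventually_eq) simp
qed

text \<open>
  The walk enters only through the values of its potential at the integers, hence the statement for a
  function with the right values.
\<close>

lemma potential_conclusions:
  fixes f :: "int \<Rightarrow> real"
  assumes f: "\<And>n. 0 < n \<Longrightarrow> f n = pot 1 (real_of_int n)" "\<And>n. 0 < n \<Longrightarrow> f (- n) = pot (- 1) (real_of_int n)"
  shows "slowly_varying_int f" (is ?A)
    and "slowly_varying_int (\<lambda>n. (f n + f (- n)) / 2)" (is ?B)
    and "(\<lambda>n. f n - f (- n)) \<sim>[at_top] (\<lambda>n. 1 / drift (real_of_int n))" (is ?C)
    and "f \<sim>[at_top] (\<lambda>n. lo_int (real_of_int n))" (is ?D)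
    and "(\<lambda>n. f (- n) - up_int (real_of_int n)) \<in> o[at_top](f)" (is ?E)
proof -
  note int = filterlim_compose[OF _ filterlim_real_of_int_at_top]
  have ev: "\<forall>\<^sub>F n in at_top. (0::int) < n" by (rule eventually_gt_at_top)
  have d: "((\<lambda>n. f n / lo_int (real_of_int n)) \<longlongrightarrow> 1) at_top"
    using int[OF pot_plus_asymptotics]
    by (rule Lim_transform_eventually) (use ev in eventually_elim, simp add: f)
  show ?A
    by (rule slowly_varying_int_from_monotone[OF lo_int_mono lo_int_pos lo_int_slowly_varying d]) auto
  have "((\<lambda>n. (f n + f (- n)) / 2 / tail_integral (real_of_int n)) \<longlongrightarrow> 1 / 2) at_top"
    using int[OF sym_pot_asymptotics]
    by (rule Lim_transform_eventually) (use ev in eventually_elim, simp add: f)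
  from slowly_varying_int_from_monotone[OF tail_integral_mono tail_integral_pos tail_integral_slowly_varying this]
  show ?B by simp
  have c: "((\<lambda>n. drift (real_of_int n) * (f n - f (- n))) \<longlongrightarrow> 1) at_top"
    using int[OF pot_difference]
    by (rule Lim_transform_eventually) (use ev in eventually_elim, simp add: f)
  show ?C
    by (rule asymp_equivI') (use c in \<open>simp add: mult.commute\<close>)
  show ?D by (rule asymp_equivI'[OF d])
  have "((\<lambda>n. (f (- n) - up_int (real_of_int n)) / f n) \<longlongrightarrow> 0) at_top"
    using int[OF pot_minus_asymptotics]
    by (rule Lim_transform_eventually) (use ev in eventually_elim, simp add: f)
  moreover have "\<forall>\<^sub>F n in at_top. f n \<noteq> 0"
    using ev eventually_compose_filterlim[OF pot_plus_pos filterlim_real_of_int_at_top]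
    by eventually_elim (simp add: f)
  ultimately show ?E by (rule smalloI_tendsto)
qed

end

end

section \<open>From the walk to its law\<close>

lemma integral_cos_int:
  "(LBINT t:{0..pi}. cos (t * real_of_int k)) = pi * of_bool (k = 0)"
proof (cases "k = 0")
  case True
  then show ?thesis by (simp add: set_lebesgue_integral_def)
next
  case False
  have "(LBINT t:{0..pi}. cos (t * real_of_int k)) = sin (pi * real_of_int k) / real_of_int k - sin (0 * real_of_int k) / real_of_int k"
  proof (rule set_integral_FTC[where S="{}"])
    fix t :: real
    show "((\<lambda>t. sin (t * real_of_int k) / real_of_int k) has_vector_derivative cos (t * real_of_int k)) (at t)"
      unfolding has_real_derivative_iff_has_vector_derivative[symmetric]
      using False by (auto intro!: derivative_eq_intros)
  qed (use False in \<open>auto intro!: continuous_intros borel_integrable_atLeastAtMost'\<close>)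
  also have "sin (pi * real_of_int k) = 0" unfolding sin_zero_iff_int2 by (auto intro: exI[of _ k])
  finally show ?thesis using False by simp
qed

lemma measurable_int_sum:
  fixes f :: "'i \<Rightarrow> 'a \<Rightarrow> int"
  assumes "finite I" "\<And>i. f i \<in> measurable N (count_space UNIV)"
  shows "(\<lambda>\<omega>. \<Sum>i\<in>I. f i \<omega>) \<in> measurable N (count_space UNIV)"
  using assms(1)
proof induction
  case (insert i I)
  have "(\<lambda>\<omega>. (f i \<omega>, \<Sum>i\<in>I. f i \<omega>)) \<in> measurable N (count_space UNIV \<Otimes>\<^sub>M count_space UNIV)"
    using insert assms(2) by simp
  then have "(\<lambda>\<omega>. (\<lambda>(a, b). a + b) (f i \<omega>, \<Sum>i\<in>I. f i \<omega>)) \<in> measurable N (count_space UNIV)"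
    by (rule measurable_compose) (simp add: pair_measure_countable)
  then show ?case using insert by simp
qed simp

locale int_walk = prob_space M for M :: "'a measure" +
  fixes X :: "nat \<Rightarrow> 'a \<Rightarrow> int"
  assumes indep: "indep_vars (\<lambda>_. count_space UNIV) X UNIV"
    and same_law: "\<And>n. distr M (count_space UNIV) (X n) = distr M (count_space UNIV) (X 0)"
begin

lemma X_measurable [measurable]: "X n \<in> measurable M (count_space UNIV)"
  using indep by (auto simp: indep_vars_def)

definition law :: "int pmf" where "law = Abs_pmf (distr M (count_space UNIV) (X 0))"

lemma measure_law: "measure_pmf law = distr M (count_space UNIV) (X 0)"
proof -
  interpret D: prob_space "distr M (count_space UNIV) (X 0)" by (rule prob_space_distr) simp
  have "AE x in distr M (count_space UNIV) (X 0). measure (distr M (count_space UNIV) (X 0)) {x} \<noteq> 0"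
    by (subst D.AE_support_countable) (auto intro!: exI[of _ UNIV])
  then show ?thesis unfolding law_def
    by (intro Abs_pmf_inverse) (auto simp: D.prob_space_axioms)
qed

lemma distr_X: "distr M (count_space UNIV) (X n) = measure_pmf law"
  using same_law[of n] by (simp add: measure_law)

lemma expectation_X:
  fixes f :: "int \<Rightarrow> 'b :: {banach, second_countable_topology}"
  shows "expectation (\<lambda>\<omega>. f (X n \<omega>)) = measure_pmf.expectation law f"
  unfolding distr_X[of n, symmetric] by (rule integral_distr[symmetric]) auto

lemma prob_X: "prob {\<omega> \<in> space M. X n \<omega> \<in> S} = measure_pmf.prob law S"
  unfolding distr_X[of n, symmetric]
  by (subst measure_distr) (auto simp: vimage_def Int_def conj_commute intro!: arg_cong[where f="measure M"])

sublocale step: step_law law .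

lemma walk_measurable [measurable]: "walk X n \<in> measurable M (count_space UNIV)"
  unfolding walk_def[abs_def] by (rule measurable_int_sum) auto

lemma expectation_cis_walk: "expectation (\<lambda>\<omega>. cis (t * real_of_int (walk X n \<omega>))) = step.chf t ^ n"
proof -
  let ?Y = "\<lambda>i \<omega>. real_of_int (X i \<omega>)"
  have iv: "indep_vars (\<lambda>_. borel) ?Y {1..n}"
    by (rule indep_vars_compose2[OF indep_vars_subset[OF indep], where Y="\<lambda>_. real_of_int"]) auto
  have c: "char (distr M borel (?Y i)) t = step.chf t" for i
  proof -
    have "char (distr M borel (?Y i)) t = expectation (\<lambda>\<omega>. cis (t * ?Y i \<omega>))"
      unfolding char_def by (subst integral_distr) (auto simp: cis_conv_exp)
    also have "\<dots> = step.chf t"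
      unfolding step.chf_def using expectation_X[of "\<lambda>k. cis (t * real_of_int k)" i] by simp
    finally show ?thesis .
  qed
  have "char (distr M borel (\<lambda>\<omega>. \<Sum>i\<in>{1..n}. ?Y i \<omega>)) t = (\<Prod>i\<in>{1..n}. char (distr M borel (?Y i)) t)"
    by (rule char_distr_sum[OF iv])
  also have "\<dots> = step.chf t ^ n" by (simp add: c)
  finally have "char (distr M borel (\<lambda>\<omega>. real_of_int (walk X n \<omega>))) t = step.chf t ^ n"
    by (simp add: walk_def)
  moreover have "char (distr M borel (\<lambda>\<omega>. real_of_int (walk X n \<omega>))) t = expectation (\<lambda>\<omega>. cis (t * real_of_int (walk X n \<omega>)))"
    unfolding char_def by (subst integral_distr) (auto simp: cis_conv_exp)
  ultimately show ?thesis by simp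
qed

text \<open>
  Only real parts occur, so the half period \<open>[0, pi]\<close> suffices.
\<close>

lemma walk_Fourier_inversion:
  "pi * prob {\<omega> \<in> space M. walk X n \<omega> = k} = (LBINT t:{0..pi}. Re (cis (- (t * real_of_int k)) * step.chf t ^ n))"
proof -
  interpret P: prob_space "distr M (count_space UNIV) (walk X n)" by (rule prob_space_distr) simp
  define q where "q = Abs_pmf (distr M (count_space UNIV) (walk X n))"
  have q: "measure_pmf q = distr M (count_space UNIV) (walk X n)"
  proof -
    have "AE x in distr M (count_space UNIV) (walk X n). measure (distr M (count_space UNIV) (walk X n)) {x} \<noteq> 0"
      by (subst P.AE_support_countable) (auto intro!: exI[of _ UNIV])
    then show ?thesis unfolding q_def
      by (intro Abs_pmf_inverse) (auto simp: P.prob_space_axioms)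
  qed
  have qe: "measure_pmf.expectation q f = expectation (\<lambda>\<omega>. f (walk X n \<omega>))"
    for f :: "int \<Rightarrow> 'b :: {banach, second_countable_topology}"
    unfolding q by (rule integral_distr) auto
  have "(LBINT t:{0..pi}. Re (cis (- (t * real_of_int k)) * step.chf t ^ n))
      = (LBINT t:{0..pi}. measure_pmf.expectation q (\<lambda>j. cos (t * real_of_int (j - k))))"
  proof (rule set_lebesgue_integral_cong)
    show "\<forall>t. t \<in> {0..pi} \<longrightarrow> Re (cis (- (t * real_of_int k)) * step.chf t ^ n)
        = measure_pmf.expectation q (\<lambda>j. cos (t * real_of_int (j - k)))"
    proof (intro allI impI)
      fix t :: real
      have i: "integrable (measure_pmf q) (\<lambda>j. cis (- (t * real_of_int k)) * cis (t * real_of_int j))"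
        by (rule measure_pmf.integrable_const_bound[where B=1]) (auto simp: norm_mult)
      have "cis (- (t * real_of_int k)) * step.chf t ^ n
          = cis (- (t * real_of_int k)) * measure_pmf.expectation q (\<lambda>j. cis (t * real_of_int j))"
        by (simp add: expectation_cis_walk[symmetric] qe)
      also have "\<dots> = measure_pmf.expectation q (\<lambda>j. cis (- (t * real_of_int k)) * cis (t * real_of_int j))"
        by simp
      also have "Re \<dots> = measure_pmf.expectation q (\<lambda>j. Re (cis (- (t * real_of_int k)) * cis (t * real_of_int j)))"
        by (rule integral_Re[OF i, symmetric])
      also have "(\<lambda>j. Re (cis (- (t * real_of_int k)) * cis (t * real_of_int j))) = (\<lambda>j. cos (t * real_of_int (j - k)))"
        by (intro ext) (simp add: cis_mult algebra_simps)
      finally show "Re (cis (- (t * real_of_int k)) * step.chf t ^ n)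
        = measure_pmf.expectation q (\<lambda>j. cos (t * real_of_int (j - k)))" .
    qed
  qed auto
  also have "\<dots> = measure_pmf.expectation q (\<lambda>j. LBINT t:{0..pi}. cos (t * real_of_int (j - k)))"
    by (rule pmf_Fubini(1)[where B=1]) auto
  also have "\<dots> = measure_pmf.expectation q (\<lambda>j. pi * indicator {k} j)"
    unfolding integral_cos_int by (simp add: indicator_def of_bool_def)
  also have "\<dots> = pi * measure_pmf.prob q {k}" by simp
  also have "measure_pmf.prob q {k} = prob {\<omega> \<in> space M. walk X n \<omega> = k}"
    unfolding q by (subst measure_distr) (auto simp: vimage_def Int_def conj_commute intro!: arg_cong[where f="measure M"])
  finally show ?thesis by simp
qed

lemma tails_law:
  "mu_minus M X = step.lo_tail" "mu_plus M X = step.up_tail" "mu_both M X = step.tail" "tail_diff_integral M X = step.drift"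
proof -
  show m: "mu_minus M X = step.lo_tail"
    using prob_X[of 0 "{k. real_of_int k < - x}" for x] by (auto simp: mu_minus_def step.lo_tail_def fun_eq_iff)
  show p: "mu_plus M X = step.up_tail"
    using prob_X[of 0 "{k. x < real_of_int k}" for x] by (auto simp: mu_plus_def step.up_tail_def fun_eq_iff)
  show "mu_both M X = step.tail" using m p by (auto simp: mu_both_def step.tail_def fun_eq_iff)
  show "tail_diff_integral M X = step.drift" using m p by (auto simp: tail_diff_integral_def step.drift_def fun_eq_iff)
qed

subsection \<open>Irreducibility and the points where the characteristic function is one\<close>

text \<open>
  Equality in the triangle inequality: \<open>1 - Re (cnj u e\<^bsup>itX\<^esup>)\<close> is nonnegative with mean zero when \<open>u = chf t\<close>.
\<close>

lemma chf_norm_1_support: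
  assumes t: "norm (step.chf t) = 1"
  shows "\<exists>u. norm u = 1 \<and> (\<forall>k\<in>set_pmf law. cis (t * real_of_int k) = u)"
proof -
  define u where "u = step.chf t"
  have u: "norm u = 1" using t by (simp add: u_def)
  let ?g = "\<lambda>k. 1 - Re (cnj u * cis (t * real_of_int k))"
  have le: "Re (cnj u * cis x) \<le> 1" for x
    using complex_Re_le_cmod[of "cnj u * cis x"] u by (simp add: norm_mult)
  have i: "integrable (measure_pmf law) (\<lambda>k. cnj u * cis (t * real_of_int k))"
    by (rule step.integrable_E_bounded[where B=1]) (use u in \<open>auto simp: norm_mult\<close>)
  have "step.E ?g = step.E (\<lambda>k. 1) - step.E (\<lambda>k. Re (cnj u * cis (t * real_of_int k)))"
    by (rule Bochner_Integration.integral_diff[OF _ integrable_Re[OF i]]) simp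
  also have "step.E (\<lambda>k. Re (cnj u * cis (t * real_of_int k))) = Re (step.E (\<lambda>k. cnj u * cis (t * real_of_int k)))"
    by (rule integral_Re[OF i])
  also have "step.E (\<lambda>k. cnj u * cis (t * real_of_int k)) = cnj u * u"
    by (simp add: u_def step.chf_def)
  also have "cnj u * u = 1" using u by (simp add: complex_norm_square[symmetric] mult.commute)
  finally have "step.E ?g = 0" by simp
  moreover have gi: "integrable (measure_pmf law) ?g" using integrable_Re[OF i] by auto
  moreover have "AE k in measure_pmf law. 0 \<le> ?g k" using le by (intro AE_I2) auto
  ultimately have "AE k in measure_pmf law. ?g k = 0"
    using integral_nonneg_eq_0_iff_AE by blast
  then have *: "?g k = 0" if "k \<in> set_pmf law" for k using that by (simp add: AE_measure_pmf_iff)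
  have "cis (t * real_of_int k) = u" if "k \<in> set_pmf law" for k
  proof -
    let ?w = "cnj u * cis (t * real_of_int k)"
    have "Re ?w = 1" using *[OF that] by simp
    moreover have "norm ?w = 1" using u by (simp add: norm_mult)
    ultimately have "Im ?w = 0" using cmod_power2[of ?w] by simp
    then have "?w = 1" using \<open>Re ?w = 1\<close> by (simp add: complex_eq_iff)
    then have "u * cnj u * cis (t * real_of_int k) = u" by (simp add: mult.assoc)
    moreover have "u * cnj u = 1" using u by (simp add: complex_norm_square[symmetric])
    ultimately show ?thesis by simp
  qed
  then show ?thesis using u by blast
qed

lemma cis_eq_1_imp_multiple:
  assumes "cis x = 1" shows "\<exists>k::int. x = 2 * pi * real_of_int k"
  using assms cos_one_2pi_int[of x] by (auto simp: complex_eq_iff mult.commute)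

text \<open>
  Where \<open>chf t = 1\<close>, the exponential \<open>e\<^bsup>itX\<^esup>\<close> is almost surely one, hence so is \<open>e\<^bsup>itS\<^esup>\<close> for every position \<open>S\<close>
  of the walk. Irreducibility puts positive mass on the position 1.
\<close>

lemma chf_neq_1:
  assumes irr: "irreducible_walk M X" and t: "0 < t" "t \<le> pi"
  shows "step.chf t \<noteq> 1"
proof
  assume c: "step.chf t = 1"
  then obtain u where u: "\<And>k. k \<in> set_pmf law \<Longrightarrow> cis (t * real_of_int k) = u"
    using chf_norm_1_support[of t] by auto
  obtain n where n: "prob {\<omega> \<in> space M. walk X n \<omega> = 1} > 0"
    using irr[unfolded irreducible_walk_def, rule_format, of 0 1] by auto
  have "u = step.E (\<lambda>k. u)" by simp
  also have "\<dots> = step.chf t"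
    unfolding step.chf_def by (rule integral_cong_AE) (use u in \<open>auto simp: AE_measure_pmf_iff\<close>)
  finally have u1: "u = 1" using c by simp
  have "AE \<omega> in M. cis (t * real_of_int (X i \<omega>)) = 1" for i
  proof -
    have "AE k in distr M (count_space UNIV) (X i). cis (t * real_of_int k) = 1"
      unfolding distr_X using u u1 by (auto simp: AE_measure_pmf_iff)
    then show ?thesis by (subst (asm) AE_distr_iff) auto
  qed
  then have "AE \<omega> in M. \<forall>i. cis (t * real_of_int (X i \<omega>)) = 1" by (simp add: AE_all_countable)
  then have "AE \<omega> in M. cis (t * real_of_int (walk X n \<omega>)) = 1"
  proof eventually_elim
    case (elim \<omega>)
    have "cis (t * real_of_int (\<Sum>i\<in>I. X i \<omega>)) = 1" if "finite I" for I
      using that by (induction) (use elim in \<open>auto simp: distrib_left cis_mult[symmetric]\<close>)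
    then show ?case by (simp add: walk_def)
  qed
  moreover have "\<not> (AE \<omega> in M. walk X n \<omega> \<noteq> 1)"
    using n by (subst AE_iff_measurable[OF _ refl]) (auto simp: emeasure_eq_measure)
  ultimately have "cis t = 1"
  proof (rule_tac ccontr)
    assume "cis t \<noteq> 1" and A: "AE \<omega> in M. cis (t * real_of_int (walk X n \<omega>)) = 1"
    from A have "AE \<omega> in M. walk X n \<omega> \<noteq> 1"
      by eventually_elim (use \<open>cis t \<noteq> 1\<close> in auto)
    moreover assume "\<not> (AE \<omega> in M. walk X n \<omega> \<noteq> 1)"
    ultimately show False by blast
  qed
  then obtain k :: int where tk: "t = 2 * pi * real_of_int k" using cis_eq_1_imp_multiple by blast
  have "0 < 2 * pi * real_of_int k" using t tk by simp
  then have "0 < k" by (simp add: zero_less_mult_iff)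
  then have "2 * pi * 1 \<le> 2 * pi * real_of_int k" by (intro mult_left_mono) auto
  then show False using t tk pi_gt_zero by linarith
qed

text \<open>
  If \<open>|chf t| = 1\<close> then \<open>e\<^bsup>itk\<^esup>\<close> is constant on the support, which determines \<open>t\<close> up to multiples of
  \<open>2 pi/(k1 - k2)\<close>.
\<close>

lemma AE_norm_chf_less_1:
  assumes k: "k1 \<in> set_pmf law" "k2 \<in> set_pmf law" "k1 \<noteq> k2"
  shows "AE t in lborel. norm (step.chf t) < 1"
proof -
  let ?N = "range (\<lambda>j::int. 2 * pi * real_of_int j / real_of_int (k1 - k2))"
  have "countable ?N" by simp
  then have "AE t in lborel. t \<notin> ?N" by (intro AE_not_in countable_imp_null_set_lborel)
  then show ?thesis
  proof eventually_elim
    case (elim t)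
    show ?case
    proof (rule ccontr)
      assume "\<not> norm (step.chf t) < 1"
      then have "norm (step.chf t) = 1" using step.norm_chf_le_1[of t] by simp
      then obtain u where u: "norm u = 1" "\<And>k. k \<in> set_pmf law \<Longrightarrow> cis (t * real_of_int k) = u"
        using chf_norm_1_support by blast
      have "cis (t * real_of_int k1) = cis (t * real_of_int k2)" using u(2) k by metis
      then have "cis (t * real_of_int k1) * cis (- (t * real_of_int k2)) = 1"
        by (simp add: cis_mult)
      then have "cis (t * real_of_int (k1 - k2)) = 1" by (simp add: cis_mult algebra_simps)
      then obtain j :: int where "t * real_of_int (k1 - k2) = 2 * pi * real_of_int j"
        using cis_eq_1_imp_multiple by blast
      then have "t = 2 * pi * real_of_int j / real_of_int (k1 - k2)" using k(3) by (simp add: field_simps)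
      then show False using elim by blast
    qed
  qed
qed

end

context int_walk begin

subsection \<open>Recurrence makes the return probabilities non-summable\<close>

lemma shifted_law:
  "distr M (\<Pi>\<^sub>M i\<in>UNIV. count_space UNIV) (\<lambda>\<omega> i. X (i + n) \<omega>) = distr M (\<Pi>\<^sub>M i\<in>UNIV. count_space UNIV) (\<lambda>\<omega> i. X i \<omega>)"
proof -
  let ?P = "\<Pi>\<^sub>M i\<in>(UNIV :: nat set). count_space (UNIV :: int set)"
  let ?D = "distr M (count_space UNIV) (X 0)"
  have sP: "sets (\<Pi>\<^sub>M i\<in>(UNIV :: nat set). ?D) = sets ?P" by (rule sets_PiM_cong) auto
  have D: "distr M ?P (\<lambda>\<omega> i. X i \<omega>) = (\<Pi>\<^sub>M i\<in>UNIV. ?D)"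
  proof -
    have "distr M ?P (\<lambda>\<omega>. \<lambda>i\<in>UNIV. X i \<omega>) = (\<Pi>\<^sub>M i\<in>UNIV. distr M (count_space UNIV) (X i))"
      using indep by (rule indep_vars_iff_distr_eq_PiM[THEN iffD1, rotated 2]) auto
    also have "\<dots> = (\<Pi>\<^sub>M i\<in>UNIV. ?D)" by (rule PiM_cong[OF refl same_law])
    finally show ?thesis by (simp only: restrict_def UNIV_I if_True)
  qed
  have "distr M ?P (\<lambda>\<omega> i. X (i + n) \<omega>) = distr (distr M ?P (\<lambda>\<omega> i. X i \<omega>)) ?P (\<lambda>w i. w (i + n))"
    by (subst distr_distr) (auto simp: o_def intro!: measurable_PiM_single')
  also have "\<dots> = distr (\<Pi>\<^sub>M i\<in>UNIV. ?D) (\<Pi>\<^sub>M i\<in>UNIV. ?D) (\<lambda>w. \<lambda>i\<in>UNIV. w (i + n))"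
    unfolding D by (intro distr_cong) (auto simp: sP)
  also have "\<dots> = (\<Pi>\<^sub>M i\<in>UNIV. ?D)"
    by (rule distr_PiM_reindex[where M="\<lambda>_. ?D" and f="\<lambda>i. i + n"]) (auto intro!: prob_space_distr)
  finally show ?thesis using D by simp
qed

text \<open>
  The increments after time \<open>n\<close> have the same joint law as the increments from the start.
\<close>

lemma AE_return_after:
  assumes rec: "recurrent_walk M X"
  shows "AE \<omega> in M. \<exists>m>n. walk X m \<omega> = walk X n \<omega>"
proof -
  let ?P = "\<Pi>\<^sub>M i\<in>(UNIV :: nat set). count_space (UNIV :: int set)"
  let ?Q = "\<lambda>w :: nat \<Rightarrow> int. \<exists>m\<ge>1. (\<Sum>i=1..m. w i) = 0"
  have [measurable]: "(\<lambda>w. \<Sum>i=1..m. w i) \<in> measurable ?P (count_space UNIV)" for m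
    by (rule measurable_int_sum) auto
  have E: "Measurable.pred ?P ?Q" by measurable
  have ms: "(\<lambda>\<omega> i. X (i + k) \<omega>) \<in> measurable M ?P" for k
    by (rule measurable_PiM_single') auto
  have "AE \<omega> in M. \<exists>m\<ge>1. walk X m \<omega> = 0"
    using rec unfolding recurrent_walk_def by (subst (asm) prob_Collect_eq_1) auto
  then have 0: "AE \<omega> in M. ?Q (\<lambda>i. X (i + 0) \<omega>)" by (simp add: walk_def)
  have iff: "(AE w in distr M ?P (\<lambda>\<omega> i. X (i + k) \<omega>). ?Q w) \<longleftrightarrow> (AE \<omega> in M. ?Q (\<lambda>i. X (i + k) \<omega>))" for k
    by (rule AE_distr_iff[OF ms]) (use E in \<open>simp only: pred_def\<close>)
  have "AE w in distr M ?P (\<lambda>\<omega> i. X i \<omega>). ?Q w"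
    using iffD2[OF iff 0] by (simp only: shifted_law)
  then have "AE w in distr M ?P (\<lambda>\<omega> i. X (i + n) \<omega>). ?Q w" by (simp only: shifted_law)
  then have "AE \<omega> in M. ?Q (\<lambda>i. X (i + n) \<omega>)" by (rule iffD1[OF iff])
  then show ?thesis
  proof eventually_elim
    case (elim \<omega>)
    then obtain m where m: "m \<ge> 1" "(\<Sum>i=1..m. X (i + n) \<omega>) = 0" by blast
    have "walk X (n + m) \<omega> = walk X n \<omega> + (\<Sum>i=n+1..n+m. X i \<omega>)"
      unfolding walk_def by (rule sum.ub_add_nat) simp
    also have "(\<Sum>i=n+1..n+m. X i \<omega>) = (\<Sum>i=1..m. X (i + n) \<omega>)"
      using sum.shift_bounds_cl_nat_ivl[of "\<lambda>i. X i \<omega>" 1 n m] by (simp add: add.commute)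
    finally show ?case using m by (intro exI[of _ "n + m"]) auto
  qed
qed

text \<open>
  With summable return probabilities the walk would have a last visit to the origin by the
  Borel-Cantelli lemma, but every position is visited again later.
\<close>

lemma return_probabilities_not_summable:
  assumes rec: "recurrent_walk M X"
  shows "\<not> summable (\<lambda>n. prob {\<omega> \<in> space M. walk X n \<omega> = 0})"
proof
  assume s: "summable (\<lambda>n. prob {\<omega> \<in> space M. walk X n \<omega> = 0})"
  have "AE \<omega> in M. eventually (\<lambda>n. \<omega> \<in> space M - {\<omega> \<in> space M. walk X n \<omega> = 0}) sequentially"
    by (rule borel_cantelli_AE1) (use s in \<open>auto simp: emeasure_eq_measure\<close>)
  moreover have "AE \<omega> in M. \<forall>n. \<exists>m>n. walk X m \<omega> = walk X n \<omega>"
    using AE_return_after[OF rec] by (simp add: AE_all_countable)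
  ultimately have "AE \<omega> in M. False"
  proof eventually_elim
    case (elim \<omega>)
    then obtain N where N: "\<And>n. n \<ge> N \<Longrightarrow> walk X n \<omega> \<noteq> 0" by (auto simp: eventually_sequentially)
    have "\<exists>m\<ge>k. walk X m \<omega> = 0" for k
    proof (induction k)
      case 0
      show ?case by (intro exI[of _ 0]) (simp add: walk_def)
    next
      case (Suc k)
      then obtain m where "m \<ge> k" "walk X m \<omega> = 0" by blast
      moreover obtain m' where "m' > m" "walk X m' \<omega> = walk X m \<omega>" using elim(2) by blast
      ultimately show ?case by (intro exI[of _ m']) auto
    qed
    then show ?case using N by blast
  qed
  then show False by simp
qed

subsection \<open>The potential as a Fourier integral\<close>

text \<open>
  The partial sums of the series are integrals of geometric sums, \<open>(1 - e\<^bsup>ixt\<^esup>) (1 - chf\<^sup>N)/(1 - chf)\<close>. As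
  \<open>|chf| < 1\<close> almost everywhere, dominated convergence applies; it also shows that the series converges.
\<close>

lemma potential_series:
  assumes irr: "irreducible_walk M X"
    and k: "k1 \<in> set_pmf law" "k2 \<in> set_pmf law" "k1 \<noteq> k2"
    and int: "set_integrable lborel {0..pi} (\<lambda>t. (1 - cis (real_of_int x * t)) * (1 / (1 - step.chf t)))"
  shows "potential M X x = 1 / pi * (LBINT t:{0..pi}. Re ((1 - cis (real_of_int x * t)) * (1 / (1 - step.chf t))))"
proof -
  let ?z = "\<lambda>t. (1 - cis (real_of_int x * t)) * (1 / (1 - step.chf t))"
  let ?d = "\<lambda>n. prob {\<omega> \<in> space M. walk X n \<omega> = 0} - prob {\<omega> \<in> space M. walk X n \<omega> = - x}"
  have d: "pi * ?d n = (LBINT t:{0..pi}. Re ((1 - cis (real_of_int x * t)) * step.chf t ^ n))" for n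
  proof -
    have i: "set_integrable lborel {0..pi} (\<lambda>t. Re (cis (- (t * real_of_int j)) * step.chf t ^ n))" for j
      by (intro borel_integrable_atLeastAtMost' continuous_intros step.chf_continuous_on)
    have "pi * ?d n = (LBINT t:{0..pi}. Re (cis (- (t * real_of_int 0)) * step.chf t ^ n))
        - (LBINT t:{0..pi}. Re (cis (- (t * real_of_int (- x))) * step.chf t ^ n))"
      by (simp only: walk_Fourier_inversion[symmetric] right_diff_distrib)
    also have "\<dots> = (LBINT t:{0..pi}. Re (cis (- (t * real_of_int 0)) * step.chf t ^ n) - Re (cis (- (t * real_of_int (- x))) * step.chf t ^ n))"
      by (rule set_integral_diff(2)[OF i i, symmetric])
    also have "\<dots> = (LBINT t:{0..pi}. Re ((1 - cis (real_of_int x * t)) * step.chf t ^ n))"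
      by (rule set_lebesgue_integral_cong) (auto simp: algebra_simps)
    finally show ?thesis .
  qed
  have partial: "pi * (\<Sum>n<N. ?d n) = (LBINT t:{0..pi}. Re (?z t * (1 - step.chf t ^ N)))" for N
  proof -
    have "pi * (\<Sum>n<N. ?d n) = (LBINT t:{0..pi}. (\<Sum>n<N. Re ((1 - cis (real_of_int x * t)) * step.chf t ^ n)))"
      unfolding sum_distrib_left d
      by (rule set_integral_finite_sum[symmetric])
         (intro borel_integrable_atLeastAtMost' continuous_intros step.chf_continuous_on)
    also have "\<dots> = (LBINT t:{0..pi}. Re (?z t * (1 - step.chf t ^ N)))"
    proof (rule set_lebesgue_integral_cong)
      show "\<forall>t. t \<in> {0..pi} \<longrightarrow> (\<Sum>n<N. Re ((1 - cis (real_of_int x * t)) * step.chf t ^ n)) = Re (?z t * (1 - step.chf t ^ N))"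
      proof (intro allI impI)
        fix t :: real assume t: "t \<in> {0..pi}"
        have "(\<Sum>n<N. (1 - cis (real_of_int x * t)) * step.chf t ^ n) = ?z t * (1 - step.chf t ^ N)"
        proof (cases "t = 0")
          case False
          then have "step.chf t \<noteq> 1" using chf_neq_1[OF irr, of t] t by auto
          then show ?thesis
            using sum_gp_strict[of "step.chf t" N] by (simp add: sum_distrib_left[symmetric])
        qed simp
        then show "(\<Sum>n<N. Re ((1 - cis (real_of_int x * t)) * step.chf t ^ n)) = Re (?z t * (1 - step.chf t ^ N))"
          by (metis Re_sum)
      qed
    qed auto
    finally show ?thesis .
  qed
  have "(\<lambda>N. LINT t|lborel. indicator {0..pi} t *\<^sub>R Re (?z t * (1 - step.chf t ^ N)))
      \<longlonglongrightarrow> (LINT t|lborel. indicator {0..pi} t *\<^sub>R Re (?z t))"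
  proof (rule integral_dominated_convergence)
    show "integrable lborel (\<lambda>t. 2 * norm (indicator {0..pi} t *\<^sub>R ?z t))"
      by (intro integrable_mult_right integrable_norm int[unfolded set_integrable_def])
    show "AE t in lborel. (\<lambda>N. indicator {0..pi} t *\<^sub>R Re (?z t * (1 - step.chf t ^ N))) \<longlonglongrightarrow> indicator {0..pi} t *\<^sub>R Re (?z t)"
      using AE_norm_chf_less_1[OF k]
    proof eventually_elim
      case (elim t)
      have "(\<lambda>N. indicator {0..pi} t *\<^sub>R Re (?z t * (1 - step.chf t ^ N))) \<longlonglongrightarrow> indicator {0..pi} t *\<^sub>R Re (?z t * (1 - 0))"
        by (intro tendsto_intros LIMSEQ_power_zero elim)
      then show ?case by simp
    qed
    fix N
    show "AE t in lborel. norm (indicator {0..pi} t *\<^sub>R Re (?z t * (1 - step.chf t ^ N))) \<le> 2 * norm (indicator {0..pi} t *\<^sub>R ?z t)"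
    proof (rule AE_I2)
      fix t
      have "norm (step.chf t ^ N) \<le> 1" using step.norm_chf_le_1[of t] by (simp add: norm_power power_le_one)
      then have "norm (1 - step.chf t ^ N) \<le> 2" using norm_triangle_ineq4[of 1 "step.chf t ^ N"] by simp
      then have "norm (?z t) * norm (1 - step.chf t ^ N) \<le> norm (?z t) * 2" by (intro mult_left_mono) auto
      then have *: "\<bar>Re (?z t * (1 - step.chf t ^ N))\<bar> \<le> 2 * norm (?z t)"
        using abs_Re_le_cmod[of "?z t * (1 - step.chf t ^ N)"] by (simp only: norm_mult)
      show "norm (indicator {0..pi} t *\<^sub>R Re (?z t * (1 - step.chf t ^ N))) \<le> 2 * norm (indicator {0..pi} t *\<^sub>R ?z t)"
      proof (cases "t \<in> {0..pi}")
        case True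
        then show ?thesis using * by (simp only: indicator_simps scaleR_one real_norm_def)
      qed simp
    qed
  qed (auto simp: cis_conv_exp)
  then have "(\<lambda>N. 1 / pi * (pi * (\<Sum>n<N. ?d n))) \<longlonglongrightarrow> 1 / pi * (LBINT t:{0..pi}. Re (?z t))"
    unfolding partial set_lebesgue_integral_def by (intro tendsto_intros)
  then have "?d sums (1 / pi * (LBINT t:{0..pi}. Re (?z t)))" by (simp add: sums_def)
  then show ?thesis unfolding potential_def by (rule sums_unique[symmetric])
qed

end

theorem theorem7:
  fixes M :: "'a measure" and X :: "nat \<Rightarrow> 'a \<Rightarrow> int" and x0 :: nat
  assumes "prob_space M"
    and "prob_space.indep_vars M (\<lambda>_. count_space UNIV) X UNIV"
    and "\<And>n. distr M (count_space UNIV) (X n) = distr M (count_space UNIV) (X 0)"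
    and "irreducible_walk M X"
    and "recurrent_walk M X"
    and "\<And>x::real. x > 0 \<Longrightarrow> \<P>(\<omega> in M. \<bar>real_of_int (X 0 \<omega>)\<bar> > x) > 0"
    and "filterlim (\<lambda>x. tail_diff_integral M X x / (x * mu_both M X x)) at_top at_top"
    and "x0 > 0"
    and "\<And>x::real. x \<ge> real x0 \<Longrightarrow> tail_diff_integral M X x > 0"
  shows "slowly_varying_int (potential M X)
    \<and> slowly_varying_int (sym_potential M X)
    \<and> (\<lambda>x::int. potential M X x - potential M X (- x))
        \<sim>[at_top] (\<lambda>x. 1 / tail_diff_integral M X (real_of_int x))
    \<and> potential M X
        \<sim>[at_top] (\<lambda>x. LBINT y:{real x0..real_of_int x}.
                        mu_minus M X y / (tail_diff_integral M X y)\<^sup>2)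
    \<and> (\<lambda>x. potential M X (- x)
              - (LBINT y:{real x0..real_of_int x}.
                   mu_plus M X y / (tail_diff_integral M X y)\<^sup>2))
        \<in> o[at_top](potential M X)"
proof -
  interpret W: int_walk M X
    using assms(1-3) by (intro int_walk.intro int_walk_axioms.intro)
  note tl = W.tails_law
  have pos: "\<And>u. real x0 \<le> u \<Longrightarrow> 0 < W.step.drift u" using assms(9) by (simp add: tl)
  have ratio: "((\<lambda>u. u * W.step.tail u / W.step.drift u) \<longlongrightarrow> 0) at_top"
    using tendsto_inverse_0_at_top[OF assms(7)] by (simp add: tl)
  have "\<forall>\<^sub>F u in at_top. u * W.step.tail u / W.step.drift u < 1 / 8"
    by (rule order_tendstoD(2)[OF ratio]) simp
  then obtain U where U: "\<And>u. U \<le> u \<Longrightarrow> u * W.step.tail u / W.step.drift u < 1 / 8"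
    by (auto simp: eventually_at_top_linorder)
  \<comment> \<open>The moment condition can only be met after slow variation is available, hence two thresholds.\<close>
  define T0 where "T0 = max x0 (nat \<lceil>U\<rceil>)"
  have small: "small_tails W.law T" if T: "T0 \<le> T" for T
  proof
    show "1 \<le> T" using T assms(8) by (simp add: T0_def)
    fix u assume u: "real T \<le> u"
    have "real x0 \<le> u" "U \<le> u" using u T unfolding T0_def by linarith+
    then show "0 < W.step.drift u" "8 * (u * W.step.tail u) \<le> W.step.drift u"
      using pos[of u] U[of u] by (auto simp: divide_less_eq)
  qed (rule ratio)
  interpret S0: small_tails W.law T0 by (rule small) simp
  have "\<forall>\<^sub>F u in at_top. W.step.clip_moment2 u / (u * W.step.drift u) < 1 / 6"
    by (rule order_tendstoD(2)[OF S0.clip_moment2_little]) simp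
  then obtain V where V: "\<And>u. V \<le> u \<Longrightarrow> W.step.clip_moment2 u / (u * W.step.drift u) < 1 / 6"
    by (auto simp: eventually_at_top_linorder)
  define T where "T = max T0 (nat \<lceil>V\<rceil>)"
  interpret S: small_tails W.law T by (rule small) (simp add: T_def)
  have returns: "(LBINT t:{0..pi}. Re (W.step.chf t ^ n)) = pi * measure M {\<omega> \<in> space M. walk X n \<omega> = 0}" for n
    using W.walk_Fourier_inversion[of n 0] by simp
  interpret R: recurrent_dominated_walk W.law T
  proof
    fix u assume u: "real T \<le> u"
    then have "V \<le> u" "0 < u" "0 < W.step.drift u"
      using S.T_pos' S.drift_pos[OF u] unfolding T_def by linarith+
    then show "6 * W.step.clip_moment2 u \<le> u * W.step.drift u"
      using V[of u] by (simp add: divide_less_eq)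
  next
    fix t :: real assume "0 < t" "t \<le> pi"
    then show "W.step.chf t \<noteq> 1" by (rule W.chf_neq_1[OF assms(4)])
  next
    show "0 \<le> (LBINT t:{0..pi}. Re (W.step.chf t ^ n))" for n by (simp add: returns)
    show "\<not> summable (\<lambda>n. LBINT t:{0..pi}. Re (W.step.chf t ^ n))"
      using W.return_probabilities_not_summable[OF assms(5)] by (simp add: returns summable_cmult_iff)
  qed
  have support: "\<exists>k\<in>set_pmf W.law. x < \<bar>real_of_int k\<bar>" if x: "0 < x" for x
  proof (rule ccontr)
    assume "\<not> ?thesis"
    then have "set_pmf W.law \<inter> {k. x < \<bar>real_of_int k\<bar>} = {}" by auto
    then have "measure_pmf.prob W.law {k. x < \<bar>real_of_int k\<bar>} = 0"
      by (simp add: measure_pmf_zero_iff)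
    then show False using assms(6)[OF x] W.prob_X[of 0 "{k. x < \<bar>real_of_int k\<bar>}"] by simp
  qed
  \<comment> \<open>Two points of the support suffice to make the characteristic function smaller than one in absolute value almost everywhere.\<close>
  obtain k1 where k1: "k1 \<in> set_pmf W.law" "1 < \<bar>real_of_int k1\<bar>" using support[of 1] by auto
  obtain k2 where k2: "k2 \<in> set_pmf W.law" "\<bar>real_of_int k1\<bar> < \<bar>real_of_int k2\<bar>"
    using support[of "\<bar>real_of_int k1\<bar>", OF less_trans[OF zero_less_one k1(2)]] by auto
  have k12: "k1 \<noteq> k2" using k2(2) by auto
  have pot: "potential M X x = 1 / pi * (LBINT t:{0..pi}. Re ((1 - cis (real_of_int x * t)) * R.resolvent t))" for x
    unfolding R.resolvent_def
    by (rule W.potential_series[OF assms(4) k1(1) k2(1) k12])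
       (rule R.potential_integrable[unfolded R.resolvent_def])
  have x0T: "0 < real x0" "real x0 \<le> real T" using assms(8) by (auto simp: T_def T0_def)
  note concl = R.potential_conclusions[OF x0T pos, of "potential M X"]
  have f: "potential M X n = R.pot 1 (real_of_int n)" "potential M X (- n) = R.pot (- 1) (real_of_int n)" for n
    by (simp_all add: pot R.pot_def)
  have lo: "R.lo_int (real x0) x = (LBINT u:{real x0..x}. W.step.lo_tail u / (W.step.drift u)\<^sup>2)" for x
    by (rule R.lo_int_def[OF x0T]) (rule pos)
  have up: "R.up_int (real x0) x = (LBINT u:{real x0..x}. W.step.up_tail u / (W.step.drift u)\<^sup>2)" for x
    by (rule R.up_int_def[OF x0T]) (rule pos)
  have "sym_potential M X = (\<lambda>n. (potential M X n + potential M X (- n)) / 2)"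
    by (simp add: sym_potential_def fun_eq_iff)
  then show ?thesis
    using concl[OF _ f(1) f(2)] unfolding tl lo up
    by simp
qed

end
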